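(* For every $n\ge 1$ there is a bijection $\Theta:S_n(1423)\to S_n(2413)$ such that for every $\pi\in S_n(1423)$: $\operatorname{Des}\Theta(\pi)=\operatorname{Des}\pi$, $\operatorname{RLmax}\Theta(\pi)=\operatorname{RLmax}\pi$, $\operatorname{Stp}\Theta(\pi)=\operatorname{Stp}\pi$, the value $n$ occupies the same position in $\Theta(\pi)$ as in $\pi$, and the value $n-1$ occupies the same position in $\Theta(\pi)$ as in $\pi$. Additionally, if $\pi\in S_n(1423)\cap S_n(2413)$ then $\Theta(\pi)=\pi$.
   Context: Permutations $\pi\in S_n$ are written in one-line notation $\pi_1\ldots\pi_n$. For a sequence of distinct integers, $\mathrm{std}$ of it is the unique permutation order-isomorphic to it. A permutation $\pi$ avoids $\tau\in S_k$ if no subsequence of $\pi$ is order-isomorphic to $\tau$; $S_n(\tau)$ denotes the set of $\tau$-avoiding permutations in $S_n$. $\operatorname{Des}\pi=\{i:\pi_i>\pi_{i+1}\}$ is the descent set. $\operatorname{RLmax}\pi$ is the set of right-to-left maxima of $\pi$, i.e. indices $i$ such that $\pi_i>\pi_j$ for all $j>i$. $\operatorname{Stp}\pi=\{i:\pi_i-1=\pi_{i+1}\}$ is the set of steps of $\pi$. *)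

theory Defs
  imports "HOL-Combinatorics.Multiset_Permutations" "HOL-Library.Sublist"
begin

text \<open>Permutations of {1,...,n} are represented by their one-line notation, i.e. by the
  elements of \<^term>\<open>permutations_of_set {1..n::nat}\<close>. Indices are 1-based, so \<open>entry\<close>
  shifts the 0-based list access; it is meaningful only for indices in {1,...,n}.\<close>

definition entry :: "nat list \<Rightarrow> nat \<Rightarrow> nat" where
  "entry \<pi> i = \<pi> ! (i - 1)"

definition order_isomorphic :: "nat list \<Rightarrow> nat list \<Rightarrow> bool" where
  "order_isomorphic xs ys \<longleftrightarrow> length xs = length ys \<and>
     (\<forall>i \<in> {1..length xs}. \<forall>j \<in> {1..length xs}.
        entry xs i < entry xs j \<longleftrightarrow> entry ys i < entry ys j)"

definition avoids :: "nat list \<Rightarrow> nat list \<Rightarrow> bool" where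
  "avoids \<pi> \<tau> \<longleftrightarrow> \<not> (\<exists>\<sigma>. subseq \<sigma> \<pi> \<and> order_isomorphic \<sigma> \<tau>)"

definition avoiders :: "nat \<Rightarrow> nat list \<Rightarrow> nat list set" where
  "avoiders n \<tau> = {\<pi> \<in> permutations_of_set {1..n}. avoids \<pi> \<tau>}"

definition Des :: "nat list \<Rightarrow> nat set" where
  "Des \<pi> = {i. 1 \<le> i \<and> i < length \<pi> \<and> entry \<pi> i > entry \<pi> (i + 1)}"

definition RLmax :: "nat list \<Rightarrow> nat set" where
  "RLmax \<pi> = {i \<in> {1..length \<pi>}. \<forall>j \<in> {1..length \<pi>}. j > i \<longrightarrow> entry \<pi> i > entry \<pi> j}"

text \<open>The condition \<open>\<pi>\<^sub>i - 1 = \<pi>\<^sub>i\<^sub>+\<^sub>1\<close> is written without truncated subtraction.\<close>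

definition Stp :: "nat list \<Rightarrow> nat set" where
  "Stp \<pi> = {i. 1 \<le> i \<and> i < length \<pi> \<and> entry \<pi> i = entry \<pi> (i + 1) + 1}"

end

theory Submission
  imports Defs
begin

text \<open>
  Since the intersection of the two classes may be fixed pointwise, it suffices to show that the
  statistics are equidistributed. Steps can be ignored at first: neither pattern contains two
  adjacent entries with values of the form $k+1, k$, so entries forming a step can be merged, and
  the distribution with steps follows from the one without by induction on $n$.

  Write an avoider as $\pi = A\,n\,X$. Then $A$ and $X$ are avoiders, and the possible ways of
  interleaving the values of $A$ with those of $X$ depend only on two numbers: how many value gaps
  of $A$ are active (a new last entry may be placed there) and how many cuts of $X$ are free
  (values of $A$ may be placed there). The interleavings are counted by the same formula for both
  patterns, and reversing an interleaving exchanges its effect on the free cuts of $\pi$ for 1423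
  (they lie above $A$) with its effect for 2413 (they lie below $A$). A new maximum inserted
  into $\pi$ right of $n$ is just a new maximum inserted into $X$; inserted left of $n$ it has to
  split $A$ as a skew sum (1423) or as a direct sum (2413), and in both cases the active gaps of
  the summands add up in the same way.

  This gives a recursion, common to both patterns, for the joint distribution of descents,
  right-to-left maxima, position of the second largest value and free cuts, provided that descents
  and active gaps are jointly equidistributed on shorter avoiders. The latter holds because
  the number of avoiders $P\,n\,D$ with $D$ decreasing of length $k$, as a function of $k$,
  determines the distribution of the number of active gaps of $P$, and these avoiders are
  themselves covered by the recursion.
\<close>


subsection \<open>Equidistribution of statistics\<close>

text \<open>The recursion for \<open>A n X\<close> calls for the active gaps of \<open>A\<close>,
  and these are recovered only from avoiders \<open>A n D\<close> with \<open>D\<close> decreasing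
  of every length. Those are longer than \<open>A\<close>, so an induction on length would be
  circular. What stays bounded is the number of entries that are not right-to-left maxima: for
  \<open>A n D\<close> it is the length of \<open>A\<close>, whatever \<open>D\<close> is. This
  number \<open>M\<close> is therefore the outer induction parameter and the length only the inner
  one. One circle is left: if the second largest value directly follows the maximum, the recursion
  would ask for the active gaps at \<open>M\<close> itself. These avoiders are treated by a separate
  induction on the length of \<open>D\<close>.

  The lengths of \<open>D\<close> suffice because \<open>A\<close> with \<open>c\<close> active gaps
  can be interleaved with \<open>D\<close> of length \<open>k\<close> in binomial(c+k-1, c-1) ways,
  a polynomial in \<open>k\<close> of degree c-1; for different \<open>c\<close> these are linearly
  independent.

  The recursion runs over pairs of an avoider and a place for a new maximum: free cuts are counted
  before the insertion, the other statistics after it.\<close>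

definition eqd :: "('a \<Rightarrow> 'v) \<Rightarrow> 'a set \<Rightarrow> ('b \<Rightarrow> 'v) \<Rightarrow> 'b set \<Rightarrow> bool" where
  "eqd f S g T \<longleftrightarrow> (\<exists>h. bij_betw h S T \<and> (\<forall>x\<in>S. g (h x) = f x))"

lemma eqd_comp:
  assumes "eqd f S g T" "\<And>x. x \<in> S \<Longrightarrow> f' x = p (f x)" "\<And>y. y \<in> T \<Longrightarrow> g' y = p (g y)"
  shows "eqd f' S g' T"
proof -
  obtain h where h: "bij_betw h S T" "\<forall>x\<in>S. g (h x) = f x" using assms(1) unfolding eqd_def by blast
  then have "\<forall>x\<in>S. g' (h x) = f' x" using assms(2,3) bij_betwE[OF h(1)] by simp
  then show ?thesis using h(1) unfolding eqd_def by blast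
qed

lemma eqd_trans:
  assumes "eqd f S g T" "eqd g T k U"
  shows "eqd f S k U"
proof -
  obtain p q where p: "bij_betw p S T" "\<forall>x\<in>S. g (p x) = f x"
    and q: "bij_betw q T U" "\<forall>x\<in>T. k (q x) = g x" using assms unfolding eqd_def by blast
  have "\<forall>x\<in>S. k ((q \<circ> p) x) = f x" using p q bij_betwE[OF p(1)] by simp
  then show ?thesis using bij_betw_trans[OF p(1) q(1)] unfolding eqd_def by blast
qed

lemma eqd_sym:
  assumes "eqd f S g T"
  shows "eqd g T f S"
proof -
  obtain p where p: "bij_betw p S T" "\<forall>x\<in>S. g (p x) = f x" using assms unfolding eqd_def by blast
  have "\<forall>y\<in>T. f (inv_into S p y) = g y"
    using p bij_betw_inv_into_right[OF p(1)] bij_betwE[OF bij_betw_inv_into[OF p(1)]] by metis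
  then show ?thesis using bij_betw_inv_into[OF p(1)] unfolding eqd_def by blast
qed

lemma eqd_bij: "bij_betw p S T \<Longrightarrow> (\<And>x. x \<in> S \<Longrightarrow> g (p x) = f x) \<Longrightarrow> eqd f S g T"
  unfolding eqd_def by blast

lemma eqd_transport:
  assumes "bij_betw p S' S" "bij_betw q T' T" "eqd (\<lambda>x. f (p x)) S' (\<lambda>y. g (q y)) T'"
  shows "eqd f S g T"
  using eqd_trans[OF eqd_trans[OF eqd_sym[OF eqd_bij[OF assms(1), where f = "\<lambda>x. f (p x)" and g = f]]
      assms(3)] eqd_bij[OF assms(2)]]
  by blast

lemma eqd_filter:
  assumes "eqd f S g T" "\<And>x. x \<in> S \<Longrightarrow> P x = R (f x)" "\<And>y. y \<in> T \<Longrightarrow> Q y = R (g y)"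
  shows "eqd f {x\<in>S. P x} g {y\<in>T. Q y}"
proof -
  obtain h where h: "bij_betw h S T" "\<forall>x\<in>S. g (h x) = f x" using assms(1) unfolding eqd_def by blast
  have "bij_betw h {x\<in>S. P x} {y\<in>T. Q y}"
    unfolding bij_betw_def
  proof
    show "inj_on h {x\<in>S. P x}" using h(1) unfolding bij_betw_def inj_on_def by blast
    show "h ` {x \<in> S. P x} = {y \<in> T. Q y}"
      using h assms(2,3) unfolding bij_betw_def by force
  qed
  then show ?thesis using h(2) unfolding eqd_def by blast
qed

lemma eqd_empty: "eqd f {} g {}"
  unfolding eqd_def by (simp add: bij_betw_def)

lemma eqd_UN:
  assumes "\<And>i. i \<in> I \<Longrightarrow> eqd f (S i) g (T i)"
    and "disjoint_family_on S I" "disjoint_family_on T I"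
  shows "eqd f (\<Union>i\<in>I. S i) g (\<Union>i\<in>I. T i)"
proof -
  obtain h where h: "\<And>i. i \<in> I \<Longrightarrow> bij_betw (h i) (S i) (T i)"
    "\<And>i x. i \<in> I \<Longrightarrow> x \<in> S i \<Longrightarrow> g (h i x) = f x"
    using assms(1) unfolding eqd_def by metis
  define k where "k x = h (THE i. i \<in> I \<and> x \<in> S i) x" for x
  have k: "k x = h i x" if "i \<in> I" "x \<in> S i" for i x
  proof -
    have "(THE i. i \<in> I \<and> x \<in> S i) = i"
      using that assms(2) unfolding disjoint_family_on_def by (intro the_equality) blast+
    then show ?thesis by (simp add: k_def)
  qed
  have "bij_betw k (\<Union>i\<in>I. S i) (\<Union>i\<in>I. T i)"
    unfolding bij_betw_def
  proof
    show "inj_on k (\<Union>i\<in>I. S i)"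
    proof (rule inj_onI, clarify)
      fix x y i j assume *: "k x = k y" "i \<in> I" "x \<in> S i" "j \<in> I" "y \<in> S j"
      have "k x \<in> T i" "k y \<in> T j" using * k bij_betwE[OF h(1)] by metis+
      then have "i = j" using *(1,2,4) assms(3) unfolding disjoint_family_on_def by (metis disjoint_iff)
      then show "x = y" using * k h(1) by (auto simp: bij_betw_def inj_on_def)
    qed
    have "k ` S i = T i" if "i \<in> I" for i
      using h(1)[OF that] k[OF that] by (force simp: bij_betw_def)
    then show "k ` (\<Union>i\<in>I. S i) = (\<Union>i\<in>I. T i)" by (simp add: image_UN)
  qed
  moreover have "\<forall>x\<in>(\<Union>i\<in>I. S i). g (k x) = f x" using k h(2) by auto
  ultimately show ?thesis unfolding eqd_def by blast
qed

lemma eqd_Un: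
  assumes "eqd f S g T" "eqd f S' g T'" "S \<inter> S' = {}" "T \<inter> T' = {}"
  shows "eqd f (S \<union> S') g (T \<union> T')"
proof -
  have "eqd f (\<Union>b\<in>UNIV. if b then S else S') g (\<Union>b\<in>UNIV. if b then T else T')"
    by (rule eqd_UN) (use assms in \<open>auto simp: disjoint_family_on_def\<close>)
  then show ?thesis by (simp add: UNIV_bool Un_commute)
qed

text \<open>Fibres have to match only over base points with equal statistics. This is how
  interleavings are transferred, although the set of them depends on the two permutations that are
  interleaved.\<close>

lemma eqd_Sigma:
  assumes "eqd f S g T"
    and "\<And>x y. x \<in> S \<Longrightarrow> y \<in> T \<Longrightarrow> f x = g y \<Longrightarrow> eqd (u x) (F x) (v y) (G y)"
  shows "eqd (\<lambda>(x,z). (f x, u x z)) (Sigma S F) (\<lambda>(y,z). (g y, v y z)) (Sigma T G)"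
proof -
  obtain h where h: "bij_betw h S T" "\<And>x. x \<in> S \<Longrightarrow> g (h x) = f x"
    using assms(1) unfolding eqd_def by blast
  have "eqd (u x) (F x) (v (h x)) (G (h x))" if "x \<in> S" for x
    using assms(2)[OF that, of "h x"] h that by (metis bij_betwE)
  then obtain k where k: "\<And>x. x \<in> S \<Longrightarrow> bij_betw (k x) (F x) (G (h x))"
    "\<And>x z. x \<in> S \<Longrightarrow> z \<in> F x \<Longrightarrow> v (h x) (k x z) = u x z"
    unfolding eqd_def by metis
  let ?m = "\<lambda>(x,z). (h x, k x z)"
  have "bij_betw ?m (Sigma S F) (Sigma T G)"
    unfolding bij_betw_def
  proof
    show "inj_on ?m (Sigma S F)"
      using h(1) k(1) unfolding bij_betw_def inj_on_def by auto
    show "?m ` Sigma S F = Sigma T G"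
    proof
      show "?m ` Sigma S F \<subseteq> Sigma T G" using h(1) k(1) by (auto simp: bij_betw_def)
      show "Sigma T G \<subseteq> ?m ` Sigma S F"
      proof clarify
        fix y z assume y: "y \<in> T" "z \<in> G y"
        obtain x where x: "x \<in> S" "y = h x" using y h(1) by (auto simp: bij_betw_def)
        obtain z' where "z' \<in> F x" "z = k x z'" using y x k(1)[OF x(1)] by (auto simp: bij_betw_def)
        then show "(y,z) \<in> ?m ` Sigma S F" using x by (force intro!: image_eqI[of _ _ "(x,z')"])
      qed
    qed
  qed
  then show ?thesis unfolding eqd_def using h(2) k(2) by (intro exI[of _ ?m]) auto
qed

lemma eqd_Times:
  assumes "eqd f S g T" "eqd u F v G"
  shows "eqd (\<lambda>(x,z). (f x, u z)) (S \<times> F) (\<lambda>(y,z). (g y, v z)) (T \<times> G)"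
  using eqd_Sigma[OF assms(1), of "\<lambda>_. u" "\<lambda>_. F" "\<lambda>_. v" "\<lambda>_. G"] assms(2) by simp

text \<open>The passage from counting to bijections: arguments that cancel terms or compare
  coefficients yield equal fibre sizes, and a bijection is then chosen fibre by fibre.\<close>

lemma eqd_card_iff:
  assumes "finite S" "finite T"
  shows "eqd f S g T \<longleftrightarrow> (\<forall>v. card {x\<in>S. f x = v} = card {y\<in>T. g y = v})"
proof
  assume e: "eqd f S g T"
  show "\<forall>v. card {x\<in>S. f x = v} = card {y\<in>T. g y = v}"
  proof
    fix v
    have "eqd f {x\<in>S. f x = v} g {y\<in>T. g y = v}"
      using eqd_filter[OF e, of "\<lambda>x. f x = v" "\<lambda>x. x = v" "\<lambda>y. g y = v"] by blast
    then show "card {x\<in>S. f x = v} = card {y\<in>T. g y = v}"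
      unfolding eqd_def using bij_betw_same_card by blast
  qed
next
  assume c: "\<forall>v. card {x\<in>S. f x = v} = card {y\<in>T. g y = v}"
  have "eqd f {x\<in>S. f x = v} g {y\<in>T. g y = v}" for v
  proof -
    obtain h where "bij_betw h {x\<in>S. f x = v} {y\<in>T. g y = v}"
      using c finite_same_card_bij[of "{x\<in>S. f x = v}" "{y\<in>T. g y = v}"] assms by auto
    moreover from this have "\<forall>x\<in>{x\<in>S. f x = v}. g (h x) = f x" using bij_betwE by fastforce
    ultimately show ?thesis unfolding eqd_def by blast
  qed
  then have "eqd f (\<Union>v\<in>UNIV. {x\<in>S. f x = v}) g (\<Union>v\<in>UNIV. {y\<in>T. g y = v})"
    by (intro eqd_UN) (auto simp: disjoint_family_on_def)
  moreover have "(\<Union>v\<in>UNIV. {x\<in>S. f x = v}) = S" "(\<Union>v\<in>UNIV. {y\<in>T. g y = v}) = T" by auto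
  ultimately show "eqd f S g T" by simp
qed

text \<open>Fibre sizes are subtracted, hence the finiteness. This serves to take out the common
  avoiders of both classes at the end and, through \<open>eqd_cancel_Un\<close>, the avoiders that
  have a step.\<close>

lemma eqd_Diff:
  assumes "finite S" "finite T" "eqd f S g T" "S' \<subseteq> S" "T' \<subseteq> T" "eqd f S' g T'"
  shows "eqd f (S - S') g (T - T')"
proof -
  have fin: "finite S'" "finite T'" using assms finite_subset by auto
  have "card {x \<in> S - S'. f x = v} = card {x\<in>S. f x = v} - card {x\<in>S'. f x = v}" for v
  proof -
    have "{x \<in> S - S'. f x = v} = {x\<in>S. f x = v} - {x\<in>S'. f x = v}" by auto
    then show ?thesis using card_Diff_subset[of "{x\<in>S'. f x = v}" "{x\<in>S. f x = v}"] fin assms(4) by auto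
  qed
  moreover have "card {x \<in> T - T'. g x = v} = card {x\<in>T. g x = v} - card {x\<in>T'. g x = v}" for v
  proof -
    have "{x \<in> T - T'. g x = v} = {x\<in>T. g x = v} - {x\<in>T'. g x = v}" by auto
    then show ?thesis using card_Diff_subset[of "{x\<in>T'. g x = v}" "{x\<in>T. g x = v}"] fin assms(5) by auto
  qed
  ultimately show ?thesis using assms fin by (simp add: eqd_card_iff)
qed

lemma eqd_cancel_Un:
  assumes "finite (S \<union> S')" "finite (T \<union> T')" "eqd f (S \<union> S') g (T \<union> T')" "eqd f S' g T'"
    "S \<inter> S' = {}" "T \<inter> T' = {}"
  shows "eqd f S g T"
  using eqd_Diff[OF assms(1,2,3) _ _ assms(4)] assms(5,6) by (simp add: Un_Diff Diff_triv)

subsection \<open>Gluing two permutations around the maximum\<close>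

definition perms :: "nat \<Rightarrow> nat list set" where
  "perms n = {xs. distinct xs \<and> set xs = {..<n}}"

lemma perms_length: "xs \<in> perms n \<Longrightarrow> length xs = n"
  unfolding perms_def using distinct_card by fastforce

lemma finite_perms: "finite (perms n)"
proof -
  have "perms n \<subseteq> {xs. set xs \<subseteq> {..<n} \<and> length xs = n}" using perms_length by (auto simp: perms_def)
  then show ?thesis using finite_lists_length_eq finite_subset by blast
qed

section \<open>Subsequences of up to four letters\<close>

lemma subseq_Cons_iff: "subseq (a # l) (x # Q) \<longleftrightarrow> subseq (a # l) Q \<or> (a = x \<and> subseq l Q)"
  by (metis subseq_Cons2_iff subseq_Cons2_neq subseq_Cons' list_emb_Cons)

text \<open>With \<open>ex_split_Nil\<close>, this makes the simplifier enumerate all ways to cut an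
  explicit short list in two.\<close>

lemma ex_split_Cons: "(\<exists>u v. x # l = u @ v \<and> R u v) \<longleftrightarrow> R [] (x # l) \<or> (\<exists>u v. l = u @ v \<and> R (x # u) v)"
  by (metis Cons_eq_append_conv append_Cons append_Nil)

lemma ex_split_Nil: "(\<exists>u v. [] = u @ v \<and> R u v) \<longleftrightarrow> R [] []"
  by auto

lemma subseq2_append: "subseq [y,z] (P @ Q) \<longleftrightarrow>
    subseq [y,z] P \<or> y \<in> set P \<and> z \<in> set Q \<or> subseq [y,z] Q"
  by (auto simp: subseq_append_iff ex_split_Cons ex_split_Nil subseq_singleton_left)

lemma subseq3_append: "subseq [x,y,z] (P @ Q) \<longleftrightarrow>
    subseq [x,y,z] P \<or> subseq [x,y] P \<and> z \<in> set Q \<or> x \<in> set P \<and> subseq [y,z] Q \<or> subseq [x,y,z] Q"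
  by (auto simp: subseq_append_iff ex_split_Cons ex_split_Nil subseq_singleton_left)

lemma subseq4_append: "subseq [w,x,y,z] (P @ Q) \<longleftrightarrow>
    subseq [w,x,y,z] P \<or> subseq [w,x,y] P \<and> z \<in> set Q \<or> subseq [w,x] P \<and> subseq [y,z] Q
    \<or> w \<in> set P \<and> subseq [x,y,z] Q \<or> subseq [w,x,y,z] Q"
  by (auto simp: subseq_append_iff ex_split_Cons ex_split_Nil subseq_singleton_left)

lemma subseq_set: "subseq xs ys \<Longrightarrow> set xs \<subseteq> set ys"
  by (metis notin_set_nthsI subseq_conv_nths subsetI)

lemma subseq_map_iff: "subseq xs (map f ys) \<longleftrightarrow> (\<exists>zs. subseq zs ys \<and> xs = map f zs)"
  by (auto simp: subseq_conv_nths nths_map)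

lemma subseq2_map: "subseq [y,z] (map f ys) \<longleftrightarrow> (\<exists>y' z'. subseq [y',z'] ys \<and> y = f y' \<and> z = f z')"
  by (auto simp: subseq_map_iff Cons_eq_map_conv)

lemma subseq3_map: "subseq [x,y,z] (map f ys) \<longleftrightarrow>
    (\<exists>x' y' z'. subseq [x',y',z'] ys \<and> x = f x' \<and> y = f y' \<and> z = f z')"
  by (auto simp: subseq_map_iff Cons_eq_map_conv)

lemma subseq4_map: "subseq [w,x,y,z] (map f ys) \<longleftrightarrow>
    (\<exists>w' x' y' z'. subseq [w',x',y',z'] ys \<and> w = f w' \<and> x = f x' \<and> y = f y' \<and> z = f z')"
  by (auto simp: subseq_map_iff Cons_eq_map_conv)

text \<open>The flag \<open>\<tau>\<close> selects the pattern: 1423 for \<^term>\<open>True\<close>, 2413 for \<^term>\<open>False\<close>.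
  Permutations are 0-based from here on, in positions and in values.\<close>

definition pat :: "bool \<Rightarrow> nat \<Rightarrow> nat \<Rightarrow> nat \<Rightarrow> nat \<Rightarrow> bool" where
  "pat \<tau> a b c d \<longleftrightarrow> (if \<tau> then a < c \<and> c < d \<and> d < b else c < a \<and> a < d \<and> d < b)"

definition av :: "bool \<Rightarrow> nat list \<Rightarrow> bool" where
  "av \<tau> xs \<longleftrightarrow> (\<forall>a b c d. subseq [a,b,c,d] xs \<longrightarrow> \<not> pat \<tau> a b c d)"

text \<open>The gap \<open>g\<close> lies between the values \<open>g - 1\<close> and \<open>g\<close>: it is active if a new last entry with this
  value does not complete a pattern.\<close>

definition kills_gap :: "bool \<Rightarrow> nat \<Rightarrow> nat \<Rightarrow> nat \<Rightarrow> nat \<Rightarrow> bool" where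
  "kills_gap \<tau> a x y g \<longleftrightarrow> (if \<tau> then a < y \<and> y < g \<and> g \<le> x else y < a \<and> a < g \<and> g \<le> x)"

definition active_gaps :: "bool \<Rightarrow> nat list \<Rightarrow> nat set" where
  "active_gaps \<tau> A = {g. g \<le> length A \<and> (\<forall>a x y. subseq [a,x,y] A \<longrightarrow> \<not> kills_gap \<tau> a x y g)}"

text \<open>A value of \<open>A\<close> at the cut \<open>j\<close> (above exactly \<open>j\<close> values of \<open>X\<close>) would form a pattern with \<open>n, y, z\<close>.\<close>

definition kills_cut :: "bool \<Rightarrow> nat \<Rightarrow> nat \<Rightarrow> nat \<Rightarrow> bool" where
  "kills_cut \<tau> y z j \<longleftrightarrow> (if \<tau> then y < z \<and> j \<le> y else y < j \<and> j \<le> z)"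

definition free_cuts :: "bool \<Rightarrow> nat list \<Rightarrow> nat set" where
  "free_cuts \<tau> X = {j. j \<le> length X \<and> (\<forall>y z. subseq [y,z] X \<longrightarrow> \<not> kills_cut \<tau> y z j)}"

definition av_perms :: "bool \<Rightarrow> nat \<Rightarrow> nat list set" where
  "av_perms \<tau> n = {xs \<in> perms n. av \<tau> xs}"

text \<open>An interleaving is encoded by a weakly increasing word \<open>w\<close>: \<open>w ! v\<close> is the number of values of \<open>X\<close>
  below the \<open>v\<close>-th value of \<open>A\<close>. Then \<open>lo w\<close> and \<open>up w\<close> relabel the values of \<open>A\<close> and \<open>X\<close>.\<close>

definition lo :: "nat list \<Rightarrow> nat \<Rightarrow> nat" where
  "lo w v = v + w ! v"

definition up :: "nat list \<Rightarrow> nat \<Rightarrow> nat" where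
  "up w x = x + card {v. v < length w \<and> w ! v \<le> x}"

definition glue :: "nat list \<Rightarrow> nat list \<Rightarrow> nat list \<Rightarrow> nat list" where
  "glue A X w = map (lo w) A @ (length A + length X) # map (up w) X"

definition words :: "nat \<Rightarrow> nat \<Rightarrow> nat list set" where
  "words a b = {w. length w = a \<and> sorted w \<and> set w \<subseteq> {..b}}"

text \<open>Different letters at \<open>v\<close> and \<open>Suc v\<close> mean that a value of
  \<open>X\<close> falls between these two values of \<open>A\<close>, that is, into the gap
  \<open>Suc v\<close>.\<close>

definition jumps :: "nat list \<Rightarrow> nat set \<Rightarrow> bool" where
  "jumps w S \<longleftrightarrow> (\<forall>v. Suc v < length w \<longrightarrow> w ! v \<noteq> w ! Suc v \<longrightarrow> Suc v \<in> S)"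

definition weaves :: "bool \<Rightarrow> nat list \<Rightarrow> nat list \<Rightarrow> nat list set" where
  "weaves \<tau> A X = {w. length w = length A \<and> sorted w \<and> set w \<subseteq> free_cuts \<tau> X \<and> jumps w (active_gaps \<tau> A)}"

section \<open>Avoidance around a maximal entry\<close>

lemma pat_mono:
  assumes "strict_mono_on S f" "a \<in> S" "b \<in> S" "c \<in> S" "d \<in> S"
  shows "pat \<tau> (f a) (f b) (f c) (f d) \<longleftrightarrow> pat \<tau> a b c d"
  using assms by (simp add: pat_def strict_mono_on_less)

lemma av_map:
  assumes "strict_mono_on (set xs) f"
  shows "av \<tau> (map f xs) \<longleftrightarrow> av \<tau> xs"
proof -
  have "pat \<tau> (f a) (f b) (f c) (f d) \<longleftrightarrow> pat \<tau> a b c d" if "subseq [a,b,c,d] xs" for a b c d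
    using subseq_set[OF that] by (intro pat_mono[OF assms]) auto
  then show ?thesis unfolding av_def subseq4_map by blast
qed

lemma av_subseq: "subseq xs ys \<Longrightarrow> av \<tau> ys \<Longrightarrow> av \<tau> xs"
  unfolding av_def using subseq_order.trans by blast

lemma pat_max:
  assumes "pat \<tau> a b c d" "b \<le> N"
  shows "pat \<tau> a N c d"
  using assms by (auto simp: pat_def split: if_splits)

text \<open>In both patterns the 4 is the second letter, so an occurrence through \<open>N\<close>
  uses \<open>N\<close> as its second letter.\<close>

lemma av_append_max:
  assumes "\<forall>x \<in> set P \<union> set Q. x < N"
  shows "av \<tau> (P @ N # Q) \<longleftrightarrow> av \<tau> (P @ Q) \<and>
    (\<forall>a\<in>set P. \<forall>c d. subseq [c,d] Q \<longrightarrow> \<not> pat \<tau> a N c d)" (is "?L \<longleftrightarrow> ?R")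
proof
  assume L: ?L
  have "subseq (P @ Q) (P @ N # Q)" unfolding subseq_append' by (simp add: list_emb_Cons)
  then have "av \<tau> (P @ Q)" using L av_subseq by blast
  moreover have "\<not> pat \<tau> a N c d" if "a \<in> set P" "subseq [c,d] Q" for a c d
  proof -
    have "subseq [a,N,c,d] (P @ N # Q)" using that by (simp add: subseq4_append)
    then show ?thesis using L unfolding av_def by blast
  qed
  ultimately show ?R by blast
next
  assume R: ?R
  show ?L unfolding av_def
  proof (intro allI impI notI)
    fix a b c d assume s: "subseq [a,b,c,d] (P @ N # Q)" and p: "pat \<tau> a b c d"
    have lt: "a < b" "c < b" "d < b" using p by (auto simp: pat_def split: if_splits)
    have lQ: "x < N" if "x \<in> set Q" for x using that assms by auto
    have lP: "x < N" if "x \<in> set P" for x using that assms by auto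
    consider "subseq [a,b,c,d] P" | "subseq [a,b,c] P" "d \<in> set (N # Q)"
      | "subseq [a,b] P" "subseq [c,d] (N # Q)" | "a \<in> set P" "subseq [b,c,d] (N # Q)"
      | "subseq [a,b,c,d] (N # Q)"
      using s unfolding subseq4_append by blast
    then have "subseq [a,b,c,d] (P @ Q) \<or> (a \<in> set P \<and> b = N \<and> subseq [c,d] Q)"
    proof cases
      case 1 then show ?thesis by (simp add: subseq4_append)
    next
      case 2
      then have "b < N" using lP subseq_set[OF 2(1)] by simp
      then show ?thesis using 2 lt by (simp add: subseq4_append)
    next
      case 3
      then have "b < N" using lP subseq_set[OF 3(1)] by simp
      then show ?thesis using 3 lt by (simp add: subseq4_append subseq_Cons_iff)
    next
      case 4
      then have "b = N \<and> subseq [c,d] Q \<or> subseq [b,c,d] Q" unfolding subseq_Cons_iff[of _ _ N] by blast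
      then show ?thesis using 4(1) unfolding subseq4_append by blast
    next
      case 5
      then have "a \<noteq> N \<or> subseq [b,c,d] Q" by (simp add: subseq_Cons_iff[of _ _ N])
      then have "a \<noteq> N" using lt lQ[of b] subseq_set[of "[b,c,d]" Q] by auto
      then show ?thesis using 5 by (simp add: subseq4_append subseq_Cons_iff[of _ _ N])
    qed
    then show False using R p unfolding av_def by blast
  qed
qed

text \<open>An occurrence in \<open>P @ Q\<close> with its first letter in \<open>P\<close> and its
  last two in \<open>Q\<close> may exchange its 4 for \<open>N\<close>, wherever that 4 stands.
  Among mixed occurrences only those with three letters in \<open>P\<close> then need a condition of
  their own.\<close>

lemma av_split:
  assumes "\<forall>x \<in> set P \<union> set Q. x < N"
  shows "av \<tau> (P @ N # Q) \<longleftrightarrow> av \<tau> P \<and> av \<tau> Q \<and>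
    (\<forall>a\<in>set P. \<forall>c d. subseq [c,d] Q \<longrightarrow> \<not> pat \<tau> a N c d) \<and>
    (\<forall>a b c. subseq [a,b,c] P \<longrightarrow> (\<forall>d\<in>set Q. \<not> pat \<tau> a b c d))" (is "_ \<longleftrightarrow> _ \<and> _ \<and> ?C \<and> ?D")
proof -
  have "av \<tau> (P @ Q) \<longleftrightarrow> av \<tau> P \<and> av \<tau> Q \<and> ?D" if C: ?C
  proof
    assume L: "av \<tau> (P @ Q)"
    show "av \<tau> P \<and> av \<tau> Q \<and> ?D"
      using L unfolding av_def subseq4_append by blast
  next
    assume R: "av \<tau> P \<and> av \<tau> Q \<and> ?D"
    show "av \<tau> (P @ Q)"
      unfolding av_def
    proof (intro allI impI notI)
      fix a b c d assume s: "subseq [a,b,c,d] (P @ Q)" and p: "pat \<tau> a b c d"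
      have "b \<in> set P \<union> set Q" using subseq_set[OF s] by auto
      then have p': "pat \<tau> a N c d" using pat_max[OF p] assms by (simp add: less_imp_le)
      have 1: "a \<in> set P" "subseq [c,d] Q" if "subseq [a,b] P" "subseq [c,d] Q"
        using subseq_set[OF that(1)] that(2) by auto
      have 2: "subseq [c,d] Q" if "subseq [b,c,d] Q" by (rule subseq_Cons'[OF that])
      show False using s unfolding subseq4_append
        using R p p' C 1 2 unfolding av_def by blast
    qed
  qed
  then show ?thesis using av_append_max[OF assms] by blast
qed

section \<open>Interleaving words and their relabellings\<close>

lemma wordsD:
  assumes "w \<in> words a b"
  shows "length w = a" "\<And>v. v < a \<Longrightarrow> w ! v \<le> b" "\<And>u v. u \<le> v \<Longrightarrow> v < a \<Longrightarrow> w ! u \<le> w ! v"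
proof -
  show "length w = a" using assms by (simp add: words_def)
  show "w ! v \<le> b" if "v < a" for v
    using assms nth_mem[of v w] that unfolding words_def by blast
  show "w ! u \<le> w ! v" if "u \<le> v" "v < a" for u v
    using assms that sorted_nth_mono unfolding words_def by blast
qed

lemma words_below:
  assumes "w \<in> words a b" "v < a" "\<not> w ! v \<le> x"
  shows "{u. u < length w \<and> w ! u \<le> x} \<subseteq> {..<v}"
proof clarsimp
  fix u assume u: "u < length w" "w ! u \<le> x"
  show "u < v"
  proof (rule ccontr)
    assume "\<not> u < v"
    then have "w ! v \<le> w ! u" using wordsD(1,3)[OF assms(1)] u by simp
    then show False using u assms(3) by simp
  qed
qed

text \<open>As \<open>w\<close> is weakly increasing, \<open>up w x - x\<close> counts at least the
  indices \<open>0..v\<close> if \<open>w ! v \<le> x\<close>, and otherwise at most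
  \<open>v\<close> indices.\<close>

lemma lo_less_up_iff:
  assumes "w \<in> words a b" "v < a"
  shows "lo w v < up w x \<longleftrightarrow> w ! v \<le> x"
proof
  assume "w ! v \<le> x"
  then have "{..v} \<subseteq> {v. v < length w \<and> w ! v \<le> x}"
    using wordsD[OF assms(1)] assms(2) by (auto intro: order_trans)
  then have "card {..v} \<le> card {v. v < length w \<and> w ! v \<le> x}" by (intro card_mono) auto
  then show "lo w v < up w x" using \<open>w ! v \<le> x\<close> by (simp add: lo_def up_def)
next
  assume l: "lo w v < up w x"
  show "w ! v \<le> x"
  proof (rule ccontr)
    assume n: "\<not> w ! v \<le> x"
    then have "{v. v < length w \<and> w ! v \<le> x} \<subseteq> {..<v}"
      using words_below[OF assms] by simp
    then have "card {v. v < length w \<and> w ! v \<le> x} \<le> card {..<v}" by (intro card_mono) auto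
    then show False using l n by (simp add: lo_def up_def)
  qed
qed

lemma lo_neq_up: "w \<in> words a b \<Longrightarrow> v < a \<Longrightarrow> lo w v \<noteq> up w x"
proof
  assume a: "w \<in> words a b" "v < a" "lo w v = up w x"
  then have n: "\<not> w ! v \<le> x" using lo_less_up_iff[of w a b v x] by simp
  then have "{v. v < length w \<and> w ! v \<le> x} \<subseteq> {..<v}"
    using words_below[OF a(1,2)] by simp
  then have "card {v. v < length w \<and> w ! v \<le> x} \<le> card {..<v}" by (intro card_mono) auto
  then show False using a n by (simp add: lo_def up_def)
qed

lemma up_less_lo_iff:
  assumes "w \<in> words a b" "v < a"
  shows "up w x < lo w v \<longleftrightarrow> x < w ! v"
  using lo_less_up_iff[OF assms, of x] lo_neq_up[OF assms, of x] by linarith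

lemma up_strict: "x < y \<Longrightarrow> up w x < up w y"
proof -
  assume "x < y"
  moreover from this have "card {v. v < length w \<and> w ! v \<le> x} \<le> card {v. v < length w \<and> w ! v \<le> y}"
    by (intro card_mono) auto
  ultimately show ?thesis by (simp add: up_def)
qed

lemma up_less_iff [simp]: "up w x < up w y \<longleftrightarrow> x < y"
  using up_strict by (metis linorder_neqE_nat order_less_asym)

lemma up_mono: "strict_mono_on S (up w)"
  by (simp add: strict_mono_on_def)

lemma lo_mono: "w \<in> words a b \<Longrightarrow> strict_mono_on {..<a} (lo w)"
  by (auto simp: strict_mono_on_def lo_def intro: add_less_le_mono dest: wordsD(3)[OF _ less_imp_le])

lemma lo_lt: "w \<in> words a b \<Longrightarrow> v < a \<Longrightarrow> lo w v < a + b"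
  using wordsD(2) by (simp add: add_less_le_mono lo_def)

lemma up_lt: "w \<in> words a b \<Longrightarrow> x < b \<Longrightarrow> up w x < a + b"
proof -
  assume a: "w \<in> words a b" "x < b"
  have "card {v. v < length w \<and> w ! v \<le> x} \<le> card {..<length w}" by (intro card_mono) auto
  then show ?thesis using a wordsD(1)[OF a(1)] by (simp add: up_def)
qed

lemma up_ge: "x \<le> up w x" by (simp add: up_def)

lemma glue_perms:
  assumes "A \<in> perms a" "X \<in> perms b" "w \<in> words a b"
  shows "glue A X w \<in> perms (a + b + 1)"
proof -
  have s: "set A = {..<a}" "set X = {..<b}" "distinct A" "distinct X" "length A = a" "length X = b"
    using assms perms_length by (auto simp: perms_def)
  have d: "distinct (glue A X w)"
    using s lo_neq_up[OF assms(3)] lo_lt[OF assms(3)] up_lt[OF assms(3)]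
      strict_mono_on_imp_inj_on[OF lo_mono[OF assms(3)]] strict_mono_on_imp_inj_on[OF up_mono[of _ w]]
    by (fastforce simp: glue_def distinct_map)
  moreover have "set (glue A X w) = {..<a+b+1}"
  proof (rule card_seteq)
    show "set (glue A X w) \<subseteq> {..<a+b+1}"
      using s lo_lt[OF assms(3)] up_lt[OF assms(3)] by (auto simp: glue_def less_Suc_eq)
    show "card {..<a+b+1} \<le> card (set (glue A X w))"
      using distinct_card[OF d] s by (simp add: glue_def)
  qed auto
  ultimately show ?thesis by (simp add: perms_def)
qed

text \<open>A strictly increasing function on an initial segment enumerates its image in increasing
  order, so the image determines it.\<close>

lemma strict_mono_image_unique:
  fixes f g :: "nat \<Rightarrow> nat"
  assumes "strict_mono_on {..<a} f" "strict_mono_on {..<a} g" "f ` {..<a} = g ` {..<a}" "v < a"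
  shows "f v = g v"
proof -
  have *: "sorted (map k [0..<a]) \<and> distinct (map k [0..<a])" if "strict_mono_on {..<a} k" for k :: "nat \<Rightarrow> nat"
  proof -
    have "sorted_wrt (<) (map k [0..<a])"
      using that by (auto simp: sorted_wrt_iff_nth_less strict_mono_on_def)
    then show ?thesis by (simp add: strict_sorted_iff)
  qed
  have "map f [0..<a] = map g [0..<a]"
    using *[OF assms(1)] *[OF assms(2)] assms(3)
    by (intro sorted_distinct_set_unique) (auto simp: lessThan_atLeast0)
  then show ?thesis using assms(4) by auto
qed

text \<open>The set of values left of the maximum determines \<open>lo w\<close> and thereby the
  word; once the words agree, both relabellings can be undone.\<close>

lemma glue_inj:
  assumes "A \<in> perms a" "X \<in> perms b" "w \<in> words a b"
    and "A' \<in> perms a" "X' \<in> perms b" "w' \<in> words a b"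
    and "glue A X w = glue A' X' w'"
  shows "A = A' \<and> X = X' \<and> w = w'"
proof -
  have l: "length A = a" "length A' = a" "length X = b" "length X' = b"
    using assms perms_length by auto
  have e: "map (lo w) A = map (lo w') A'" "map (up w) X = map (up w') X'"
    using assms(7) l unfolding glue_def by auto
  have sA: "set A = {..<a}" "set A' = {..<a}" using assms by (auto simp: perms_def)
  have im: "lo w ` {..<a} = lo w' ` {..<a}" using e(1) sA by (metis list.set_map)
  have lo: "lo w v = lo w' v" if "v < a" for v
    using strict_mono_image_unique[OF lo_mono[OF assms(3)] lo_mono[OF assms(6)] im that] .
  have w: "w = w'"
    using lo wordsD(1)[OF assms(3)] wordsD(1)[OF assms(6)] by (intro nth_equalityI) (auto simp: lo_def)
  have "A = A'" using e(1) sA strict_mono_on_imp_inj_on[OF lo_mono[OF assms(3)]] unfolding w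
    by (metis map_inj_on sup.idem)
  moreover have "X = X'" using e(2) strict_mono_on_imp_inj_on[OF up_mono[of UNIV w]] unfolding w
    by (metis inj_map_eq_map)
  ultimately show ?thesis using w by blast
qed

definition rank :: "nat set \<Rightarrow> nat \<Rightarrow> nat" where
  "rank V u = card {v \<in> V. v < u}"

lemma rank_mono: "finite V \<Longrightarrow> strict_mono_on V (rank V)"
  unfolding strict_mono_on_def rank_def by (auto intro!: psubset_card_mono)

lemma rank_bij:
  assumes "finite V"
  shows "bij_betw (rank V) V {..<card V}"
proof -
  have inj: "inj_on (rank V) V" using rank_mono[OF assms] strict_mono_on_imp_inj_on by blast
  have "rank V ` V \<subseteq> {..<card V}"
    using assms by (auto simp: rank_def intro!: psubset_card_mono)
  moreover have "card (rank V ` V) = card V" using inj card_image by blast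
  ultimately show ?thesis using inj by (simp add: bij_betw_def card_subset_eq)
qed

lemma rank_perm:
  assumes "distinct xs"
  shows "map (rank (set xs)) xs \<in> perms (length xs)"
  using rank_bij[of "set xs"] assms distinct_card[OF assms] by (auto simp: perms_def distinct_map bij_betw_def)

lemma glue_surj:
  assumes "\<pi> \<in> perms (a + b + 1)" "\<pi> ! a = a + b"
  shows "\<exists>A X w. A \<in> perms a \<and> X \<in> perms b \<and> w \<in> words a b \<and> \<pi> = glue A X w"
proof -
  have len: "length \<pi> = a + b + 1" using assms perms_length by blast
  define P Q where "P = take a \<pi>" and "Q = drop (Suc a) \<pi>"
  have \<pi>: "\<pi> = P @ (a + b) # Q" using assms(2) len unfolding P_def Q_def
    using id_take_nth_drop[of a \<pi>] by simp
  have lP: "length P = a" "length Q = b" using len by (auto simp: P_def Q_def)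
  have dist: "distinct \<pi>" and set: "set \<pi> = {..<a+b+1}" using assms(1) by (auto simp: perms_def)
  define VP VQ where "VP = set P" and "VQ = set Q"
  have fin: "finite VP" "finite VQ" by (auto simp: VP_def VQ_def)
  have dist': "distinct (P @ (a + b) # Q)" and set': "set (P @ (a + b) # Q) = {..<a+b+1}"
    using dist set by (simp_all only: \<pi>[symmetric])
  have dj: "VP \<inter> VQ = {}" and ab: "a + b \<notin> VP \<union> VQ" using dist' unfolding VP_def VQ_def by auto
  have "VP \<union> VQ = {..<a+b+1} - {a+b}" using set' ab unfolding VP_def VQ_def set_append by fastforce
  also have "\<dots> = {..<a+b}" by auto
  finally have un: "VP \<union> VQ = {..<a+b}" .
  have cP: "card VP = a" and cQ: "card VQ = b"
    using dist' lP unfolding VP_def VQ_def by (simp_all add: distinct_card)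
  have lt: "u \<in> VP \<Longrightarrow> u < a + b" "u \<in> VQ \<Longrightarrow> u < a + b" for u
    using un by (metis UnI1 UnI2 lessThan_iff)+
  define e where "e = inv_into VP (rank VP)"
  \<comment> \<open>\<open>e v\<close> is the \<open>v\<close>-th smallest value left of the
    maximum, and its letter is the number of smaller values on the right.\<close>
  define w where "w = map (\<lambda>v. rank VQ (e v)) [0..<a]"
  have er: "e (rank VP u) = u" if "u \<in> VP" for u
    unfolding e_def using rank_bij[OF fin(1)] that by (simp add: bij_betw_def)
  have eV: "e v \<in> VP" "rank VP (e v) = v" if "v < a" for v
    using rank_bij[OF fin(1)] that cP unfolding e_def
    by (auto simp: bij_betw_def inv_into_into f_inv_into_f)
  have rl: "rank VP u < a" if "u \<in> VP" for u using rank_bij[OF fin(1)] that cP by (auto simp: bij_betw_def)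
  \<comment> \<open>Every value below \<open>u\<close> lies on one of the two sides. This identity
    makes \<open>lo w\<close> and \<open>up w\<close> inverse to the two rank functions.\<close>
  have sum: "rank VP u + rank VQ u = u" if "u < a + b" for u
  proof -
    have "card {v \<in> VP. v < u} + card {v \<in> VQ. v < u} = card ({v \<in> VP. v < u} \<union> {v \<in> VQ. v < u})"
      using fin dj by (intro card_Un_disjoint[symmetric]) auto
    also have "{v \<in> VP. v < u} \<union> {v \<in> VQ. v < u} = {v \<in> VP \<union> VQ. v < u}" by blast
    also have "\<dots> = {..<u}" unfolding un using that by auto
    finally show ?thesis by (simp add: rank_def)
  qed
  have rm: "rank VQ u \<le> rank VQ v" if "u \<le> v" for u v
    using that fin unfolding rank_def by (intro card_mono) auto
  have em: "e u \<le> e v" if "u \<le> v" "v < a" for u v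
    using strict_mono_on_less_eq[OF rank_mono[OF fin(1)], of "e u" "e v"] eV that by auto
  have w: "w \<in> words a b"
  proof -
    have "rank VQ u \<le> b" for u unfolding rank_def cQ[symmetric] using fin by (intro card_mono) auto
    then show ?thesis unfolding words_def w_def
      using em rm by (auto simp: sorted_iff_nth_mono)
  qed
  have lo: "lo w (rank VP u) = u" if "u \<in> VP" for u
    using sum[OF lt(1)[OF that]] rl[OF that] er[OF that] by (simp add: lo_def w_def)
  have up: "up w (rank VQ u) = u" if "u \<in> VQ" for u
  proof -
    have "rank VQ u' \<le> rank VQ u \<longleftrightarrow> u' < u" if "u' \<in> VP" for u'
    proof
      assume l: "rank VQ u' \<le> rank VQ u"
      show "u' < u"
      proof (rule ccontr)
        assume "\<not> u' < u"
        then have "u < u'" using that \<open>u \<in> VQ\<close> dj by (metis IntI empty_iff linorder_neqE_nat)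
        then have "rank VQ u < rank VQ u'" unfolding rank_def using fin \<open>u \<in> VQ\<close>
          by (intro psubset_card_mono) auto
        then show False using l by simp
      qed
    next
      assume "u' < u" then show "rank VQ u' \<le> rank VQ u" using rm by simp
    qed
    then have "{v. v < length w \<and> w ! v \<le> rank VQ u} = rank VP ` {u' \<in> VP. u' < u}"
      using eV er rl unfolding w_def by (auto simp: image_iff) metis
    moreover have "card (rank VP ` {u' \<in> VP. u' < u}) = rank VP u"
      unfolding rank_def[of VP u] using strict_mono_on_imp_inj_on[OF rank_mono[OF fin(1)]]
      by (intro card_image) (auto simp: inj_on_def)
    ultimately show ?thesis using sum[OF lt(2)[OF that]] by (simp add: up_def)
  qed
  have "\<pi> = glue (map (rank VP) P) (map (rank VQ) Q) w"
  proof -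
    have "map (\<lambda>u. lo w (rank VP u)) P = P" using lo unfolding VP_def by (intro map_idI) auto
    moreover have "map (\<lambda>u. up w (rank VQ u)) Q = Q" using up unfolding VQ_def by (intro map_idI) auto
    ultimately show ?thesis unfolding glue_def \<pi> by (simp add: lP o_def)
  qed
  moreover have "map (rank VP) P \<in> perms a" "map (rank VQ) Q \<in> perms b"
    using rank_perm[of P] rank_perm[of Q] lP dist' unfolding VP_def VQ_def by auto
  ultimately show ?thesis using w by blast
qed

lemma free_cuts_le: "j \<in> free_cuts \<tau> X \<Longrightarrow> j \<le> length X"
  by (simp add: free_cuts_def)

lemma weaves_words: "X \<in> perms b \<Longrightarrow> A \<in> perms a \<Longrightarrow> w \<in> weaves \<tau> A X \<Longrightarrow> w \<in> words a b"
  using perms_length free_cuts_le unfolding weaves_def words_def by fastforce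

lemma jump_between:
  assumes "u \<le> v" "(w::nat list) ! u < w ! v"
  shows "\<exists>k. u \<le> k \<and> k < v \<and> w ! k \<noteq> w ! Suc k"
proof (rule ccontr)
  assume "\<not> ?thesis"
  then have n: "\<And>k. u \<le> k \<Longrightarrow> k < v \<Longrightarrow> w ! k = w ! Suc k" by blast
  have "k \<le> v \<longrightarrow> w ! u = w ! k" if "u \<le> k" for k
    using that by (induction k rule: dec_induct) (use n in auto)
  then show False using assms by auto
qed

text \<open>By \<open>av_split\<close> two kinds of mixed occurrences remain: only the first letter
  in \<open>A\<close>, with the maximum as the 4, which the free cuts exclude (\<open>C\<close>),
  and only the last letter in \<open>X\<close>, which the restriction of jumps to active gaps
  excludes (\<open>D\<close>).\<close>

lemma av_glue:
  assumes A: "A \<in> perms a" and X: "X \<in> perms b" and w: "w \<in> words a b"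
  shows "av \<tau> (glue A X w) \<longleftrightarrow> av \<tau> A \<and> av \<tau> X \<and> w \<in> weaves \<tau> A X"
proof -
  have s: "set A = {..<a}" "set X = {..<b}" "length A = a" "length X = b"
    using assms perms_length by (auto simp: perms_def)
  have lt: "\<forall>x \<in> set (map (lo w) A) \<union> set (map (up w) X). x < a + b"
    using s lo_lt[OF w] up_lt[OF w] by auto
  have C: "(\<forall>e\<in>set (map (lo w) A). \<forall>c d. subseq [c,d] (map (up w) X) \<longrightarrow> \<not> pat \<tau> e (a+b) c d)
      \<longleftrightarrow> set w \<subseteq> free_cuts \<tau> X"
  proof -
    have "pat \<tau> (lo w v) (a+b) (up w y) (up w z) \<longleftrightarrow> kills_cut \<tau> y z (w ! v)" if "v < a" "subseq [y,z] X" for v y z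
    proof -
      have "z < b" using subseq_set[OF that(2)] s by auto
      then show ?thesis using up_lt[OF w] lo_less_up_iff[OF w that(1)] up_less_lo_iff[OF w that(1)]
        by (auto simp: pat_def kills_cut_def)
    qed
    moreover have "(\<forall>e\<in>set (map (lo w) A). \<forall>c d. subseq [c,d] (map (up w) X) \<longrightarrow> \<not> pat \<tau> e (a+b) c d)
      \<longleftrightarrow> (\<forall>v\<in>{..<a}. \<forall>y z. subseq [y,z] X \<longrightarrow> \<not> pat \<tau> (lo w v) (a+b) (up w y) (up w z))"
      unfolding subseq2_map set_map s(1) by blast
    ultimately have "(\<forall>e\<in>set (map (lo w) A). \<forall>c d. subseq [c,d] (map (up w) X) \<longrightarrow> \<not> pat \<tau> e (a+b) c d)
      \<longleftrightarrow> (\<forall>v<a. \<forall>y z. subseq [y,z] X \<longrightarrow> \<not> kills_cut \<tau> y z (w ! v))"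
      by (metis lessThan_iff)
    also have "\<dots> \<longleftrightarrow> (\<forall>v<a. w ! v \<in> free_cuts \<tau> X)"
      using wordsD(2)[OF w] s by (auto simp: free_cuts_def)
    also have "\<dots> \<longleftrightarrow> set w \<subseteq> free_cuts \<tau> X"
      using wordsD(1)[OF w] by (auto simp: set_conv_nth)
    finally show ?thesis .
  qed
  have D: "(\<forall>e f g. subseq [e,f,g] (map (lo w) A) \<longrightarrow> (\<forall>d\<in>set (map (up w) X). \<not> pat \<tau> e f g d))
      \<longleftrightarrow> jumps w (active_gaps \<tau> A)" (is "?L \<longleftrightarrow> ?R")
  proof -
    have P: "(\<exists>z<b. pat \<tau> (lo w x) (lo w u) (lo w y) (up w z)) \<longleftrightarrow>
        (if \<tau> then x < y \<and> w ! y < w ! u else y < x \<and> w ! x < w ! u)"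
      if "subseq [x,u,y] A" for x y u
    proof -
      have l: "x < a" "u < a" "y < a" using subseq_set[OF that] s by auto
      \<comment> \<open>The witness is \<open>z = w ! p\<close>; it is below \<open>b\<close>
        because the letters of \<open>w\<close> are at most \<open>b\<close>.\<close>
      have *: "(\<exists>z<b. w ! p \<le> z \<and> z < w ! u) \<longleftrightarrow> w ! p < w ! u" for p
        using wordsD(2)[OF w l(2)] by (meson le_less_trans less_le_trans order_refl)
      have m: "lo w i < lo w j \<longleftrightarrow> i < j" if "i < a" "j < a" for i j
        using strict_mono_on_less[OF lo_mono[OF w]] that by auto
      show ?thesis
        using l * by (auto simp: pat_def m lo_less_up_iff[OF w] up_less_lo_iff[OF w])
    qed
    have L: "?L \<longleftrightarrow> (\<forall>x u y. subseq [x,u,y] A \<longrightarrow>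
        \<not> (if \<tau> then x < y \<and> w ! y < w ! u else y < x \<and> w ! x < w ! u))" (is "_ \<longleftrightarrow> ?L'")
    proof -
      have "?L \<longleftrightarrow> (\<forall>x u y. subseq [x,u,y] A \<longrightarrow> \<not> (\<exists>z<b. pat \<tau> (lo w x) (lo w u) (lo w y) (up w z)))"
      proof -
        have "?L \<longleftrightarrow> (\<forall>x u y. subseq [x,u,y] A \<longrightarrow> (\<forall>z\<in>{..<b}. \<not> pat \<tau> (lo w x) (lo w u) (lo w y) (up w z)))"
          unfolding subseq3_map set_map s(2) by blast
        then show ?thesis by (simp add: Ball_def)
      qed
      then show ?thesis using P by simp
    qed
    have "?L' \<longleftrightarrow> ?R"
    proof
      assume L': ?L'
      show ?R unfolding jumps_def
      proof (intro allI impI)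
        fix v assume v: "Suc v < length w" "w ! v \<noteq> w ! Suc v"
        have va: "Suc v < a" using v wordsD(1)[OF w] by simp
        have wl: "w ! v < w ! Suc v" using v wordsD(3)[OF w, of v "Suc v"] va by simp
        show "Suc v \<in> active_gaps \<tau> A"
          unfolding active_gaps_def
        proof (intro CollectI conjI allI impI notI)
          show "Suc v \<le> length A" using va s by simp
          fix x u y assume t: "subseq [x,u,y] A" "kills_gap \<tau> x u y (Suc v)"
          have l: "x < a" "u < a" "y < a" using subseq_set[OF t(1)] s by auto
          have *: "w ! p < w ! u" if "p < Suc v" "Suc v \<le> u" for p
            using wordsD(3)[OF w, of p v] wordsD(3)[OF w, of "Suc v" u] that wl l va by simp
          show False using L' t * unfolding kills_gap_def by (metis (full_types))
        qed
      qed
    next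
      assume R: ?R
      show ?L'
      proof (intro allI impI notI)
        fix x u y assume t: "subseq [x,u,y] A"
          and c: "if \<tau> then x < y \<and> w ! y < w ! u else y < x \<and> w ! x < w ! u"
        have l: "x < a" "u < a" "y < a" using subseq_set[OF t] s by auto
        \<comment> \<open>\<open>p\<close> plays the 2, the next value below the missing 3: it is
          the third letter in 1423 and the first in 2413.\<close>
        define p where "p = (if \<tau> then y else x)"
        have p: "w ! p < w ! u" "p < a" using c l by (auto simp: p_def split: if_splits)
        then have "p \<le> u" using wordsD(3)[OF w, of u p] by (meson leI less_imp_le not_le)
        then obtain k where k: "p \<le> k" "k < u" "w ! k \<noteq> w ! Suc k" using jump_between p by blast
        then have "Suc k \<in> active_gaps \<tau> A" using R l wordsD(1)[OF w] unfolding jumps_def by simp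
        moreover have "kills_gap \<tau> x u y (Suc k)" using k c by (auto simp: kills_gap_def p_def split: if_splits)
        ultimately show False using t unfolding active_gaps_def by blast
      qed
    qed
    then show ?thesis using L by blast
  qed
  have "av \<tau> (map (lo w) A) \<longleftrightarrow> av \<tau> A" "av \<tau> (map (up w) X) \<longleftrightarrow> av \<tau> X"
    using av_map lo_mono[OF w] up_mono s by auto
  moreover have "w \<in> weaves \<tau> A X \<longleftrightarrow> set w \<subseteq> free_cuts \<tau> X \<and> jumps w (active_gaps \<tau> A)"
    using w s by (simp add: weaves_def words_def)
  ultimately show ?thesis
    unfolding glue_def s av_split[OF lt, of \<tau>] C D by blast
qed

section \<open>Free cuts of a glued permutation\<close>

lemma free_cuts_append_max:
  assumes "\<forall>x \<in> set P \<union> set Q. x < N"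
  shows "j \<in> free_cuts \<tau> (P @ N # Q) \<longleftrightarrow> j \<le> length P + length Q + 1 \<and> (\<forall>v\<in>set P. \<not> kills_cut \<tau> v N j)
    \<and> (\<forall>y z. subseq [y,z] Q \<longrightarrow> \<not> kills_cut \<tau> y z j)" (is "?L \<longleftrightarrow> ?R")
proof
  assume L: ?L
  then show ?R unfolding free_cuts_def subseq2_append subseq_Cons_iff[of _ _ N] by auto
next
  assume R: ?R
  have "\<not> kills_cut \<tau> y z j" if "subseq [y,z] (P @ N # Q)" for y z
  proof
    assume c: "kills_cut \<tau> y z j"
    have y: "y \<in> set P \<union> {N} \<union> set Q" and z: "z \<in> set P \<union> {N} \<union> set Q" using subseq_set[OF that] by auto
    have "z \<le> N" using z assms by (metis UnE UnI1 UnI2 less_imp_le order_refl singletonD)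
    \<comment> \<open>Raising the second entry of a pair only enlarges the set of cuts that it
      kills.\<close>
    then have "kills_cut \<tau> y N j" if "y \<noteq> N"
      using c that y assms by (auto simp: kills_cut_def split: if_splits)
    moreover have "y \<noteq> N"
      using c \<open>z \<le> N\<close> by (auto simp: kills_cut_def split: if_splits)
    moreover have "y \<in> set P \<or> subseq [y,z] Q"
      using that subseq_set[of "[y,z]" P] \<open>y \<noteq> N\<close> unfolding subseq2_append subseq_Cons_iff[of _ _ N] by auto
    ultimately show False using R c by blast
  qed
  then show ?L using R by (simp add: free_cuts_def)
qed

lemma glue_Nil: "glue [] X [] = length X # X"
  by (simp add: glue_def up_def map_idI)

lemma card_free_cuts_Cons_max:
  assumes "\<forall>x\<in>set X. x < length X"
  shows "card (free_cuts \<tau> (length X # X)) = Suc (card (free_cuts \<tau> X))"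
proof -
  have "j \<in> free_cuts \<tau> (length X # X) \<longleftrightarrow> j \<le> Suc (length X) \<and> (\<forall>y z. subseq [y,z] X \<longrightarrow> \<not> kills_cut \<tau> y z j)" for j
    using free_cuts_append_max[of "[]" X "length X" j \<tau>] assms by simp
  moreover have "\<not> kills_cut \<tau> y z (Suc (length X))" if "subseq [y,z] X" for y z
    using subseq_set[OF that] assms by (auto simp: kills_cut_def)
  ultimately have "free_cuts \<tau> (length X # X) = insert (Suc (length X)) (free_cuts \<tau> X)"
    by (auto simp: free_cuts_def le_Suc_eq)
  moreover have "Suc (length X) \<notin> free_cuts \<tau> X" by (simp add: free_cuts_def)
  moreover have "finite (free_cuts \<tau> X)" by (rule finite_subset[of _ "{..length X}"]) (auto simp: free_cuts_def)
  ultimately show ?thesis by simp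
qed

lemma finite_free_cuts [simp]: "finite (free_cuts \<tau> X)"
  by (rule finite_subset[of _ "{..length X}"]) (auto simp: free_cuts_def)

lemma finite_active_gaps [simp]: "finite (active_gaps \<tau> A)"
  by (rule finite_subset[of _ "{..length A}"]) (auto simp: active_gaps_def)

text \<open>An entry of \<open>A\<close> together with the maximum kills all cuts below that entry
  for 1423, and all cuts between that entry and the maximum for 2413. Apart from the cut above the
  maximum, which is always free and gives the \<open>Suc\<close>, the surviving cuts lie above all
  of \<open>A\<close>, respectively below all of \<open>A\<close>, and there they are the free cuts
  of \<open>X\<close>.\<close>

lemma card_free_cuts_glue:
  assumes A: "A \<in> perms a" and X: "X \<in> perms b" and w: "w \<in> words a b" and "a > 0"
  shows "card (free_cuts \<tau> (glue A X w)) =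
    Suc (card (if \<tau> then {j \<in> free_cuts \<tau> X. last w \<le> j} else {j \<in> free_cuts \<tau> X. j \<le> hd w}))"
proof -
  have s: "set A = {..<a}" "set X = {..<b}" "length A = a" "length X = b"
    using assms perms_length by (auto simp: perms_def)
  have lt: "\<forall>x \<in> set (map (lo w) A) \<union> set (map (up w) X). x < a + b"
    using s lo_lt[OF w] up_lt[OF w] by auto
  have lw: "length w = a" using wordsD(1)[OF w] .
  have hd: "hd w = w ! 0" and la: "last w = w ! (a - 1)" using \<open>a > 0\<close> lw
    by (auto simp: hd_conv_nth last_conv_nth)
  have mem: "j \<in> free_cuts \<tau> (glue A X w) \<longleftrightarrow> j \<le> a + b + 1 \<and> (\<forall>v<a. \<not> kills_cut \<tau> (lo w v) (a+b) j)
    \<and> (\<forall>y z. subseq [y,z] X \<longrightarrow> \<not> kills_cut \<tau> (up w y) (up w z) j)" for j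
  proof -
    have "(\<forall>v\<in>set (map (lo w) A). \<not> kills_cut \<tau> v (a+b) j) \<longleftrightarrow> (\<forall>v<a. \<not> kills_cut \<tau> (lo w v) (a+b) j)"
      unfolding set_map s(1) by (metis (no_types, lifting) imageE image_eqI lessThan_iff)
    moreover have "(\<forall>y z. subseq [y,z] (map (up w) X) \<longrightarrow> \<not> kills_cut \<tau> y z j) \<longleftrightarrow>
      (\<forall>y z. subseq [y,z] X \<longrightarrow> \<not> kills_cut \<tau> (up w y) (up w z) j)"
      unfolding subseq2_map by blast
    ultimately show ?thesis unfolding glue_def s free_cuts_append_max[OF lt, of j \<tau>] by (simp add: s)
  qed
  show ?thesis
  proof (cases \<tau>)
    case True
    have up1: "up w y \<le> a + y" for y
    proof -
      have "card {v. v < length w \<and> w ! v \<le> y} \<le> card {..<a}" using lw by (intro card_mono) auto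
      then show ?thesis by (simp add: up_def)
    qed
    have up2: "up w y = a + y" if "last w \<le> y" for y
    proof -
      have "w ! v \<le> y" if "v < a" for v
      proof -
        have "v \<le> a - 1" "a - 1 < a" using that by linarith+
        then have "w ! v \<le> w ! (a - 1)" using wordsD(3)[OF w] by blast
        then show ?thesis using \<open>last w \<le> y\<close> la by linarith
      qed
      then have "{v. v < length w \<and> w ! v \<le> y} = {..<a}" using lw by auto
      then show ?thesis by (simp add: up_def)
    qed
    have C1: "(\<forall>v<a. \<not> kills_cut True (lo w v) (a+b) j) \<longleftrightarrow> a + last w \<le> j" for j
    proof -
      have "(\<forall>v<a. \<not> kills_cut True (lo w v) (a+b) j) \<longleftrightarrow> (\<forall>v<a. lo w v < j)"
        using lo_lt[OF w] by (auto simp: kills_cut_def)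
      also have "\<dots> \<longleftrightarrow> lo w (a - 1) < j"
      proof
        assume l: "lo w (a - 1) < j"
        show "\<forall>v<a. lo w v < j"
        proof (intro allI impI)
          fix v assume "v < a"
          then have "w ! v \<le> w ! (a - 1)" "v \<le> a - 1" using wordsD(3)[OF w, of v "a-1"] by auto
          then show "lo w v < j" using l by (simp add: lo_def)
        qed
      qed (use \<open>a > 0\<close> in auto)
      finally show ?thesis using \<open>a > 0\<close> la by (auto simp: lo_def)
    qed
    have C2: "kills_cut True (up w y) (up w z) (a + i) \<longleftrightarrow> kills_cut True y z i" if "last w \<le> i" for i y z
    proof -
      have "a + i \<le> up w y \<longleftrightarrow> i \<le> y" using up1[of y] up2[of y] that by auto
      then show ?thesis by (auto simp: kills_cut_def)
    qed
    have M: "a + i \<in> free_cuts True (glue A X w) \<longleftrightarrow>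
        last w \<le> i \<and> i \<le> b + 1 \<and> (\<forall>y z. subseq [y,z] X \<longrightarrow> \<not> kills_cut True y z i)" for i
      using mem[of "a+i"] C1[of "a+i"] C2[of i] True by auto
    have N: "\<not> kills_cut True y z (Suc b)" if "subseq [y,z] X" for y z
      using subseq_set[OF that] s by (auto simp: kills_cut_def)
    have "last w \<le> b" using la wordsD(2)[OF w, of "a-1"] \<open>a > 0\<close> by simp
    \<comment> \<open>All of \<open>A\<close> lies below such a cut, hence the shift by
      \<open>a\<close>; \<open>Suc b\<close> stands for the cut above the maximum.\<close>
    have "free_cuts True (glue A X w) = (\<lambda>i. a + i) ` (insert (Suc b) {j \<in> free_cuts True X. last w \<le> j})" (is "_ = ?R")
    proof (intro set_eqI iffI)
      fix j assume j: "j \<in> free_cuts True (glue A X w)"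
      then have "a + last w \<le> j" using mem[of j] C1[of j] True by auto
      then obtain i where i: "j = a + i" by (metis add_leD1 le_iff_add)
      then show "j \<in> ?R" using M[of i] j s by (auto simp: free_cuts_def le_Suc_eq)
    next
      fix j assume "j \<in> ?R"
      then obtain i where i: "j = a + i" "i = Suc b \<or> i \<in> free_cuts True X \<and> last w \<le> i" by auto
      then show "j \<in> free_cuts True (glue A X w)" using M[of i] N s \<open>last w \<le> b\<close> by (auto simp: free_cuts_def)
    qed
    moreover have "Suc b \<notin> free_cuts True X" using s by (simp add: free_cuts_def)
    then have "card (insert (Suc b) {j \<in> free_cuts True X. last w \<le> j}) = Suc (card {j \<in> free_cuts True X. last w \<le> j})"
      by (subst card_insert_disjoint) auto
    moreover have "card ((\<lambda>i. a + i) ` S) = card S" for S :: "nat set" by (intro card_image) simp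
    ultimately show ?thesis using True by (simp del: image_insert)
  next
    case False
    have up0: "up w y = y" if "y < hd w" for y
    proof -
      have "y < w ! v" if "v < a" for v
        using wordsD(3)[OF w, of 0 v] that \<open>y < hd w\<close> hd by auto
      then have "{v. v < length w \<and> w ! v \<le> y} = {}" using lw by (auto simp: not_le)
      then show ?thesis by (simp add: up_def)
    qed
    have C1: "(\<forall>v<a. \<not> kills_cut False (lo w v) (a+b) j) \<longleftrightarrow> j \<le> hd w" if "j \<le> a + b" for j
    proof -
      have "(\<forall>v<a. \<not> kills_cut False (lo w v) (a+b) j) \<longleftrightarrow> (\<forall>v<a. j \<le> lo w v)"
        using that by (auto simp: kills_cut_def)
      also have "\<dots> \<longleftrightarrow> j \<le> lo w 0"
      proof
        assume l: "j \<le> lo w 0"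
        show "\<forall>v<a. j \<le> lo w v"
        proof (intro allI impI)
          fix v assume "v < a"
          then have "w ! 0 \<le> w ! v" using wordsD(3)[OF w, of 0 v] by auto
          then show "j \<le> lo w v" using l by (simp add: lo_def)
        qed
      qed (use \<open>a > 0\<close> in auto)
      finally show ?thesis using hd by (auto simp: lo_def)
    qed
    have C2: "kills_cut False (up w y) (up w z) j \<longleftrightarrow> kills_cut False y z j" if "j \<le> hd w" for j y z
    proof -
      have "u < j \<longleftrightarrow> up w u < j" for u using up0[of u] that up_ge[of u w] by auto
      then show ?thesis by (auto simp: kills_cut_def not_less[symmetric])
    qed
    have "hd w \<le> b" using hd wordsD(2)[OF w, of 0] \<open>a > 0\<close> by simp
    have T: "a + b + 1 \<in> free_cuts False (glue A X w)"
    proof -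
      have "\<not> kills_cut False (up w y) (up w z) (a+b+1)" if "subseq [y,z] X" for y z
      proof -
        have "z < b" using subseq_set[OF that] s by auto
        then show ?thesis using up_lt[OF w] by (fastforce simp: kills_cut_def)
      qed
      then show ?thesis using mem[of "a+b+1"] False by (auto simp: kills_cut_def)
    qed
    have M: "j \<in> free_cuts False (glue A X w) \<longleftrightarrow> j \<in> free_cuts False X \<and> j \<le> hd w" if "j \<le> a + b" for j
      using mem[of j] C1[OF that] C2[of j] that s \<open>hd w \<le> b\<close> False by (auto simp: free_cuts_def)
    have "free_cuts False (glue A X w) = insert (a+b+1) {j \<in> free_cuts False X. j \<le> hd w}" (is "_ = ?R")
    proof (intro set_eqI iffI)
      fix j assume j: "j \<in> free_cuts False (glue A X w)"
      then have "j \<le> a + b + 1" using mem[of j] False by auto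
      then show "j \<in> ?R" using M[of j] j by (cases "j = a + b + 1") auto
    next
      fix j assume "j \<in> ?R"
      then show "j \<in> free_cuts False (glue A X w)" using T M[of j] \<open>hd w \<le> b\<close> by auto
    qed
    moreover have "a + b + 1 \<notin> {j \<in> free_cuts False X. j \<le> hd w}" using \<open>hd w \<le> b\<close> by simp
    ultimately show ?thesis using False by simp
  qed
qed

subsection \<open>Inserting a new maximum\<close>

definition ins :: "nat \<Rightarrow> nat list \<Rightarrow> nat list" where
  "ins i xs = take i xs @ length xs # drop i xs"

definition join :: "bool \<Rightarrow> nat list \<Rightarrow> nat list \<Rightarrow> nat list" where
  "join \<tau> E F = (if \<tau> then map (\<lambda>x. x + length F) E @ F else E @ map (\<lambda>x. x + length E) F)"

text \<open>Splitting as a skew sum for 1423 and as a direct sum for 2413.\<close>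

definition split_at :: "bool \<Rightarrow> nat \<Rightarrow> nat list \<Rightarrow> bool" where
  "split_at \<tau> i A \<longleftrightarrow> (\<forall>e\<in>set (take i A). \<forall>f\<in>set (drop i A). if \<tau> then f < e else e < f)"

text \<open>The 4 is compared directly only with the 3, so any value above \<open>d\<close> can take
  its place.\<close>

lemma pat_big:
  assumes "d < N" "d < M"
  shows "pat \<tau> a N c d \<longleftrightarrow> pat \<tau> a M c d"
  using assms by (auto simp: pat_def)

lemma ins_perms: "xs \<in> perms n \<Longrightarrow> ins i xs \<in> perms (Suc n)"
proof -
  assume a: "xs \<in> perms n"
  have l: "length xs = n" using a perms_length by blast
  have s: "set (take i xs) \<union> set (drop i xs) = {..<n}" using a unfolding perms_def
    by (metis (mono_tags, lifting) append_take_drop_id mem_Collect_eq set_append)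
  have "distinct (take i xs @ drop i xs)" using a by (simp add: perms_def)
  then have d: "distinct (take i xs)" "distinct (drop i xs)" "set (take i xs) \<inter> set (drop i xs) = {}"
    unfolding distinct_append by blast+
  have "n \<notin> set (take i xs) \<union> set (drop i xs)" unfolding s by simp
  then have "distinct (ins i xs)" using d l unfolding ins_def by auto
  moreover have "set (ins i xs) = {..<Suc n}"
    unfolding ins_def using s l by (simp add: lessThan_Suc Un_insert_right)
  ultimately show ?thesis by (simp add: perms_def)
qed

lemma av_ins:
  assumes "xs \<in> perms n"
  shows "av \<tau> (ins i xs) \<longleftrightarrow> av \<tau> xs \<and>
    (\<forall>e\<in>set (take i xs). \<forall>c d. subseq [c,d] (drop i xs) \<longrightarrow> \<not> pat \<tau> e n c d)"
proof -
  have l: "length xs = n" using assms perms_length by blast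
  have "\<forall>x \<in> set (take i xs) \<union> set (drop i xs). x < n"
    using assms by (auto simp: perms_def dest!: in_set_takeD in_set_dropD)
  from av_append_max[OF this, of \<tau>] show ?thesis unfolding ins_def l append_take_drop_id .
qed

lemma glue_length: "length (glue A X w) = length A + length X + 1"
  by (simp add: glue_def)

text \<open>A first letter in \<open>A\<close> creates nothing new, since the old maximum would
  already have served as the 4. The old maximum itself cannot be a first letter, because it exceeds
  everything in \<open>X\<close>. What remains are occurrences inside \<open>X\<close> with its new
  maximum.\<close>

lemma site_right:
  assumes A: "A \<in> perms a" and X: "X \<in> perms b" and w: "w \<in> words a b"
    and i: "i \<le> b" and av: "av \<tau> (glue A X w)"
  shows "av \<tau> (ins (a + 1 + i) (glue A X w)) \<longleftrightarrow> av \<tau> (ins i X)"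
proof -
  let ?g = "glue A X w"
  have s: "set A = {..<a}" "set X = {..<b}" "length A = a" "length X = b"
    using assms perms_length by (auto simp: perms_def)
  have g: "?g \<in> perms (a+b+1)" using glue_perms[OF A X w] .
  have tk: "take (a+1+i) ?g = map (lo w) A @ (a+b) # map (up w) (take i X)"
    and dr: "drop (a+1+i) ?g = map (up w) (drop i X)"
    using s by (simp_all add: glue_def take_map drop_map)
  have lt: "\<forall>x \<in> set (map (lo w) A) \<union> set (map (up w) X). x < a + b"
    using s lo_lt[OF w] up_lt[OF w] by auto
  have avX: "av \<tau> X" using av_glue[OF A X w] av by blast
  have sub: "subseq [c,d] X" if "subseq [c,d] (drop i X)" for c d
    using that by (metis append_take_drop_id subseq2_append)
  have dlt: "d < b" if "subseq [c,d] (drop i X)" for c d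
    using subseq_set[OF sub[OF that]] s by auto
  have e: "pat \<tau> (up w x) (a+b+1) (up w c) (up w d) \<longleftrightarrow> pat \<tau> x b c d" if "d < b" for x c d
    using up_lt[OF w that] that by (auto simp: pat_def)
  have 1: "\<not> pat \<tau> e (a+b+1) c' d'"
    if eA: "e \<in> set (map (lo w) A)" and sb: "subseq [c',d'] (map (up w) (drop i X))" for e c' d'
  proof -
    obtain c d where cd: "subseq [c,d] (drop i X)" "c' = up w c" "d' = up w d"
      using sb unfolding subseq2_map by blast
    have d: "d' < a + b" using up_lt[OF w dlt[OF cd(1)]] cd by simp
    have "subseq [c',d'] (map (up w) X)" using sub[OF cd(1)] cd unfolding subseq2_map by blast
    moreover have "av \<tau> (map (lo w) A @ (a+b) # map (up w) X)" using av s by (simp add: glue_def)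
    ultimately have "\<not> pat \<tau> e (a+b) c' d'" using av_append_max[OF lt, of \<tau>] eA by blast
    then show ?thesis using pat_big[of d' "a+b" "a+b+1"] d by simp
  qed
  have 2: "\<not> pat \<tau> (a+b) (a+b+1) c' d'" if sb: "subseq [c',d'] (map (up w) (drop i X))" for c' d'
  proof -
    obtain c d where cd: "subseq [c,d] (drop i X)" "c' = up w c" "d' = up w d"
      using sb unfolding subseq2_map by blast
    then have "d' < a + b" using up_lt[OF w dlt[OF cd(1)]] by simp
    moreover have "c < b" using subseq_set[OF sub[OF cd(1)]] s by auto
    then have "c' < a + b" using up_lt[OF w] cd(2) by simp
    ultimately show ?thesis by (auto simp: pat_def)
  qed
  have 3: "(\<forall>e\<in>set (map (up w) (take i X)). \<forall>c d. subseq [c,d] (map (up w) (drop i X)) \<longrightarrow> \<not> pat \<tau> e (a+b+1) c d)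
    \<longleftrightarrow> (\<forall>e\<in>set (take i X). \<forall>c d. subseq [c,d] (drop i X) \<longrightarrow> \<not> pat \<tau> e b c d)"
    (is "?L \<longleftrightarrow> ?R")
  proof
    assume L: ?L
    show ?R
    proof (intro ballI allI impI)
      fix e c d assume "e \<in> set (take i X)" and cd: "subseq [c,d] (drop i X)"
      then have "up w e \<in> set (map (up w) (take i X))" "subseq [up w c, up w d] (map (up w) (drop i X))"
        unfolding subseq2_map by auto
      then have "\<not> pat \<tau> (up w e) (a+b+1) (up w c) (up w d)" using L by blast
      then show "\<not> pat \<tau> e b c d" using e[OF dlt[OF cd]] by blast
    qed
  next
    assume R: ?R
    show ?L
    proof (intro ballI allI impI)
      fix e' c' d' assume "e' \<in> set (map (up w) (take i X))" "subseq [c',d'] (map (up w) (drop i X))"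
      then obtain x c d where "x \<in> set (take i X)" "e' = up w x" and cd: "subseq [c,d] (drop i X)"
        "c' = up w c" "d' = up w d" unfolding subseq2_map by auto
      then show "\<not> pat \<tau> e' (a+b+1) c' d'" using R e[OF dlt[OF cd(1)]] by simp
    qed
  qed
  show ?thesis
    unfolding av_ins[OF g] av_ins[OF X] tk dr using av avX 1 2 3 by auto
qed

text \<open>An entry \<open>e\<close> left of the new maximum and an entry \<open>f\<close> between
  the two maxima form a pattern with the new maximum as the 4 and the old one as the 3, unless
  \<open>e\<close> and \<open>f\<close> are ordered as \<open>split_at\<close> demands. Any other
  new occurrence has its last two letters in \<open>X\<close> and would have existed with the old
  maximum as its 4.\<close>

lemma site_left:
  assumes A: "A \<in> perms a" and X: "X \<in> perms b" and w: "w \<in> words a b"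
    and i: "i \<le> a" and av: "av \<tau> (glue A X w)"
  shows "av \<tau> (ins i (glue A X w)) \<longleftrightarrow> split_at \<tau> i A"
proof -
  let ?g = "glue A X w"
  have s: "set A = {..<a}" "set X = {..<b}" "length A = a" "length X = b"
    using assms perms_length by (auto simp: perms_def)
  have g: "?g \<in> perms (a+b+1)" using glue_perms[OF A X w] .
  have tk: "take i ?g = map (lo w) (take i A)"
    and dr: "drop i ?g = map (lo w) (drop i A) @ (a+b) # map (up w) X"
    using s i by (simp_all add: glue_def take_map drop_map)
  have lt: "\<forall>x \<in> set (map (lo w) A) \<union> set (map (up w) X). x < a + b"
    using s lo_lt[OF w] up_lt[OF w] by auto
  have "distinct (take i A @ drop i A)" using A by (simp add: perms_def)
  then have dj: "set (take i A) \<inter> set (drop i A) = {}" unfolding distinct_append by blast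
  have sA: "set (take i A) \<subseteq> {..<a}" "set (drop i A) \<subseteq> {..<a}"
    using s(1) set_take_subset set_drop_subset by (metis)+
  have m: "lo w x < lo w y \<longleftrightarrow> x < y" if "x < a" "y < a" for x y
    using strict_mono_on_less[OF lo_mono[OF w]] that by auto
  have "(\<forall>e\<in>set (map (lo w) (take i A)). \<forall>c d. subseq [c,d] (map (lo w) (drop i A) @ (a+b) # map (up w) X)
    \<longrightarrow> \<not> pat \<tau> e (a+b+1) c d) \<longleftrightarrow> split_at \<tau> i A" (is "?L \<longleftrightarrow> ?R")
  proof
    assume L: ?L
    show ?R unfolding split_at_def
    proof (intro ballI)
      fix e f assume e: "e \<in> set (take i A)" and f: "f \<in> set (drop i A)"
      then have l: "e < a" "f < a" "e \<noteq> f" using sA dj by auto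
      have "subseq [lo w f, a+b] (map (lo w) (drop i A) @ (a+b) # map (up w) X)"
        using f by (simp add: subseq2_append)
      then have "\<not> pat \<tau> (lo w e) (a+b+1) (lo w f) (a+b)" using L e by auto
      then show "if \<tau> then f < e else e < f" using l m[of e f] m[of f e] lo_lt[OF w, of f] lo_lt[OF w, of e]
        by (auto simp: pat_def)
    qed
  next
    assume R: ?R
    show ?L
    proof (intro ballI allI impI notI)
      fix e' c d assume e': "e' \<in> set (map (lo w) (take i A))"
        and sb: "subseq [c,d] (map (lo w) (drop i A) @ (a+b) # map (up w) X)"
        and p: "pat \<tau> e' (a+b+1) c d"
      obtain e where e: "e \<in> set (take i A)" "e' = lo w e" using e' by auto
      have "c \<notin> set (map (lo w) (drop i A))"
      proof
        assume "c \<in> set (map (lo w) (drop i A))"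
        then obtain f where f: "f \<in> set (drop i A)" "c = lo w f" by auto
        have l: "e < a" "f < a" using e f sA by auto
        show False using R e(1) f(1) p m[OF l] m[OF l(2,1)] unfolding split_at_def
          by (auto simp: pat_def e(2) f(2) split: if_splits)
      qed
      moreover have "c \<noteq> a + b"
        using p e' lt sb subseq_set[OF sb] s lo_lt[OF w] up_lt[OF w] sA lo_lt[OF w, of e] e
        by (auto simp: pat_def split: if_splits)
      ultimately have cd: "subseq [c,d] (map (up w) X)"
        using sb subseq_set[of "[c,d]" "map (lo w) (drop i A)"]
        unfolding subseq2_append subseq_Cons_iff[of _ _ "a+b"] by auto
      have "d < a + b" using subseq_set[OF cd] lt by auto
      then have "pat \<tau> e' (a+b) c d" using p pat_big[of d "a+b+1" "a+b"] by simp
      moreover have "e' \<in> set (map (lo w) A)" using e in_set_takeD by fastforce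
      moreover have "av \<tau> (map (lo w) A @ (a+b) # map (up w) X)" using av s by (simp add: glue_def)
      ultimately show False using av_append_max[OF lt, of \<tau>] cd by blast
    qed
  qed
  then show ?thesis unfolding av_ins[OF g] tk dr using av by blast
qed

section \<open>Skew sums and direct sums\<close>

lemma join_length [simp]: "length (join \<tau> E F) = length E + length F"
  by (simp add: join_def)

lemma join_Nil [simp]: "join \<tau> E [] = E"
  by (simp add: join_def)

lemma shift_mono: "strict_mono_on S (\<lambda>x::nat. x + k)"
  by (simp add: strict_mono_on_def)

lemma join_perms:
  assumes "E \<in> perms e" "F \<in> perms f"
  shows "join \<tau> E F \<in> perms (e + f)"
proof -
  have s: "set E = {..<e}" "set F = {..<f}" "distinct E" "distinct F" "length E = e" "length F = f"
    using assms perms_length by (auto simp: perms_def)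
  have *: "(\<lambda>x. x + k) ` {..<m} \<union> {..<k} = {..<m + k}" for k m :: nat
  proof -
    have "x \<in> (\<lambda>x. x + k) ` {..<m} \<union> {..<k}" if "x < m + k" for x
      using that by (cases "x < k") (auto intro!: image_eqI[of _ _ "x - k"])
    then show ?thesis by auto
  qed
  show ?thesis
  proof (cases \<tau>)
    case True
    then show ?thesis using s *[of f e] by (auto simp: perms_def join_def distinct_map inj_on_def)
  next
    case False
    then show ?thesis using s *[of e f] by (auto simp: perms_def join_def distinct_map inj_on_def Un_commute add.commute)
  qed
qed

lemma join_split:
  assumes "E \<in> perms e" "F \<in> perms f"
  shows "split_at \<tau> e (join \<tau> E F)"
  using assms perms_length[OF assms(1)] perms_length[OF assms(2)]
  by (auto simp: split_at_def join_def perms_def)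

lemma av_join:
  assumes "E \<in> perms e" "F \<in> perms f"
  shows "av \<tau> (join \<tau> E F) \<longleftrightarrow> av \<tau> E \<and> av \<tau> F"
proof -
  have s: "set E = {..<e}" "set F = {..<f}" "length E = e" "length F = f"
    using assms perms_length by (auto simp: perms_def)
  have gen: "av \<tau> (P @ Q) \<longleftrightarrow> av \<tau> P \<and> av \<tau> Q"
    if "\<forall>x\<in>set P. \<forall>y\<in>set Q. if \<tau> then y < x else x < y" for P Q
  proof
    assume "av \<tau> (P @ Q)"
    then show "av \<tau> P \<and> av \<tau> Q" using av_subseq subseq_rev_drop_many subseq_drop_many
      by (metis subseq_order.order_refl)
  next
    assume R: "av \<tau> P \<and> av \<tau> Q"
    show "av \<tau> (P @ Q)" unfolding av_def
    proof (intro allI impI notI)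
      fix a b c d assume sb: "subseq [a,b,c,d] (P @ Q)" and p: "pat \<tau> a b c d"
      consider "subseq [a,b,c,d] P" | "subseq [a,b,c] P" "d \<in> set Q"
      | "subseq [a,b] P" "subseq [c,d] Q" | "a \<in> set P" "subseq [b,c,d] Q"
      | "subseq [a,b,c,d] Q"
      using sb unfolding subseq4_append by blast
      then show False
      proof cases
        case 2 then show False using that p subseq_set[OF 2(1)] by (fastforce simp: pat_def split: if_splits)
      next
        case 3 then show False using that p subseq_set[OF 3(1)] subseq_set[OF 3(2)]
          by (fastforce simp: pat_def split: if_splits)
      next
        case 4 then show False using that p subseq_set[OF 4(2)] by (fastforce simp: pat_def split: if_splits)
      qed (use R p in \<open>auto simp: av_def\<close>)
    qed
  qed
  show ?thesis
  proof (cases \<tau>)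
    case True
    then show ?thesis using gen[of "map (\<lambda>x. x + length F) E" F] av_map[OF shift_mono, where xs = E and \<tau> = \<tau>] s
      by (auto simp: join_def)
  next
    case False
    then show ?thesis using gen[of E "map (\<lambda>x. x + length E) F"] av_map[OF shift_mono, where xs = F and \<tau> = \<tau>] s
      by (auto simp: join_def)
  qed
qed

lemma active_gaps_0: "0 \<in> active_gaps \<tau> A"
  by (auto simp: active_gaps_def kills_gap_def)

lemma active_gaps_top: "A \<in> perms a \<Longrightarrow> a \<in> active_gaps \<tau> A"
proof -
  assume A: "A \<in> perms a"
  have "x < a" if "subseq [e,x,y] A" for e x y using subseq_set[OF that] A by (auto simp: perms_def)
  then show ?thesis using perms_length[OF A] by (fastforce simp: active_gaps_def kills_gap_def)
qed

text \<open>In a triple that kills a gap, the first and last letters are ordered against the order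
  of the summands, so the whole triple lies in one summand. The gaps of the lower summand and the
  shifted gaps of the upper one share only the boundary gap, which is active for both; hence the
  \<open>- 1\<close>.\<close>

lemma card_active_gaps_join:
  assumes "E \<in> perms e" "F \<in> perms f"
  shows "card (active_gaps \<tau> (join \<tau> E F)) = card (active_gaps \<tau> E) + card (active_gaps \<tau> F) - 1"
proof -
  have s: "set E = {..<e}" "set F = {..<f}" "length E = e" "length F = f"
    using assms perms_length by (auto simp: perms_def)
  have card: "card (S \<union> (\<lambda>x. x + k) ` T) = card S + card T - 1"
    if "finite S" "finite T" "S \<subseteq> {..k}" "k \<in> S" "0 \<in> T" for S T and k :: nat
  proof -
    have "S \<inter> (\<lambda>x. x + k) ` T = {k}" using that by force
    moreover have "card ((\<lambda>x. x + k) ` T) = card T" by (intro card_image) (simp add: inj_on_def)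
    ultimately show ?thesis using card_Un_Int[of S "(\<lambda>x. x + k) ` T"] that by simp
  qed
  show ?thesis
  proof (cases \<tau>)
    case True
    have "g \<in> active_gaps True (join True E F) \<longleftrightarrow> g \<in> active_gaps True F \<union> (\<lambda>x. x + f) ` active_gaps True E" for g
    proof -
      have "(\<forall>a x y. subseq [a,x,y] (map (\<lambda>x. x + f) E @ F) \<longrightarrow> \<not> kills_gap True a x y g) \<longleftrightarrow>
        (\<forall>a x y. subseq [a,x,y] E \<longrightarrow> \<not> kills_gap True (a+f) (x+f) (y+f) g) \<and>
        (\<forall>a x y. subseq [a,x,y] F \<longrightarrow> \<not> kills_gap True a x y g)" (is "?L \<longleftrightarrow> ?R")
      proof
        assume ?L then show ?R unfolding subseq3_append subseq3_map by blast
      next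
        assume R: ?R
        show ?L
        proof (intro allI impI notI)
          fix a x y assume sb: "subseq [a,x,y] (map (\<lambda>x. x + f) E @ F)" and t: "kills_gap True a x y g"
          have lt: "a < y" "y < x" using t by (auto simp: kills_gap_def)
          have "\<not> (a \<in> set (map (\<lambda>x. x + f) E) \<and> y \<in> set F)" using lt s by auto
          then have "subseq [a,x,y] (map (\<lambda>x. x + f) E) \<or> subseq [a,x,y] F"
            using sb subseq_set[of "[a,x]" "map (\<lambda>x. x + f) E"] subseq_set[of "[x,y]" F]
            unfolding subseq3_append by auto
          then show False using R t unfolding subseq3_map by blast
        qed
      qed
      moreover have "kills_gap True (a+f) (x+f) (y+f) g \<longleftrightarrow> f \<le> g \<and> kills_gap True a x y (g - f)" for a x y
        by (auto simp: kills_gap_def)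
      moreover have "\<not> kills_gap True a x y g" if "subseq [a,x,y] F" "f \<le> g" for a x y
        using subseq_set[OF that(1)] that(2) s by (auto simp: kills_gap_def)
      moreover have im: "g \<in> (\<lambda>x. x + f) ` active_gaps True E \<longleftrightarrow> f \<le> g \<and> g - f \<in> active_gaps True E"
        by (auto intro: image_eqI[of _ _ "g - f"])
      ultimately have "g \<in> active_gaps True (join True E F) \<longleftrightarrow> (if f \<le> g then g - f \<in> active_gaps True E else g \<in> active_gaps True F)"
        by (auto simp: active_gaps_def join_def s)
      moreover have "g = f" if "f \<le> g" "g \<in> active_gaps True F" using that s by (simp add: active_gaps_def)
      ultimately show ?thesis using im active_gaps_0 by auto
    qed
    then have "active_gaps True (join True E F) = active_gaps True F \<union> (\<lambda>x. x + f) ` active_gaps True E" by blast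
    then show ?thesis
      using card[of "active_gaps True F" "active_gaps True E" f] active_gaps_top[OF assms(2)] active_gaps_0 s True
      by (auto simp: active_gaps_def add.commute)
  next
    case False
    have "g \<in> active_gaps False (join False E F) \<longleftrightarrow> g \<in> active_gaps False E \<union> (\<lambda>x. x + e) ` active_gaps False F" for g
    proof -
      have "(\<forall>a x y. subseq [a,x,y] (E @ map (\<lambda>x. x + e) F) \<longrightarrow> \<not> kills_gap False a x y g) \<longleftrightarrow>
        (\<forall>a x y. subseq [a,x,y] F \<longrightarrow> \<not> kills_gap False (a+e) (x+e) (y+e) g) \<and>
        (\<forall>a x y. subseq [a,x,y] E \<longrightarrow> \<not> kills_gap False a x y g)" (is "?L \<longleftrightarrow> ?R")
      proof
        assume ?L then show ?R unfolding subseq3_append subseq3_map by blast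
      next
        assume R: ?R
        show ?L
        proof (intro allI impI notI)
          fix a x y assume sb: "subseq [a,x,y] (E @ map (\<lambda>x. x + e) F)" and t: "kills_gap False a x y g"
          have lt: "y < a" "a < x" using t by (auto simp: kills_gap_def)
          have "\<not> (a \<in> set E \<and> y \<in> set (map (\<lambda>x. x + e) F))" using lt s by auto
          then have "subseq [a,x,y] (map (\<lambda>x. x + e) F) \<or> subseq [a,x,y] E"
            using sb subseq_set[of "[a,x]" E] subseq_set[of "[x,y]" "map (\<lambda>x. x + e) F"]
            unfolding subseq3_append by auto
          then show False using R t unfolding subseq3_map by blast
        qed
      qed
      moreover have "kills_gap False (a+e) (x+e) (y+e) g \<longleftrightarrow> e \<le> g \<and> kills_gap False a x y (g - e)" for a x y
        by (auto simp: kills_gap_def)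
      moreover have "\<not> kills_gap False a x y g" if "subseq [a,x,y] E" "e \<le> g" for a x y
        using subseq_set[OF that(1)] that(2) s by (auto simp: kills_gap_def)
      moreover have im: "g \<in> (\<lambda>x. x + e) ` active_gaps False F \<longleftrightarrow> e \<le> g \<and> g - e \<in> active_gaps False F"
        by (auto intro: image_eqI[of _ _ "g - e"])
      ultimately have "g \<in> active_gaps False (join False E F) \<longleftrightarrow> (if e \<le> g then g - e \<in> active_gaps False F else g \<in> active_gaps False E)"
        by (auto simp: active_gaps_def join_def s)
      moreover have "g = e" if "e \<le> g" "g \<in> active_gaps False E" using that s by (simp add: active_gaps_def)
      ultimately show ?thesis using im active_gaps_0 by auto
    qed
    then have "active_gaps False (join False E F) = active_gaps False E \<union> (\<lambda>x. x + e) ` active_gaps False F" by blast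
    then show ?thesis
      using card[of "active_gaps False E" "active_gaps False F" e] active_gaps_top[OF assms(1)] active_gaps_0 s False
      by (auto simp: active_gaps_def add.commute)
  qed
qed

lemma initial_segment:
  assumes "S \<union> T = {..<n}" "\<forall>x\<in>S. \<forall>y\<in>T. x < (y::nat)"
  shows "S = {..<card S}"
proof -
  have fin: "finite S" using assms(1) by (metis finite_Un finite_lessThan)
  have dn: "y \<in> S" if "x \<in> S" "y < x" for x y
  proof -
    have "y \<in> S \<union> T" using that assms(1) by (metis UnI1 lessThan_iff less_trans)
    then show ?thesis using assms(2) that by fastforce
  qed
  show ?thesis
  proof (cases "S = {}")
    case False
    have "S = {..<Suc (Max S)}"
      using dn Max_in[OF fin False] Max_ge[OF fin] by (fastforce simp: less_Suc_eq_le le_less)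
    then show ?thesis by (metis card_lessThan)
  qed simp
qed

lemma split_at_join:
  assumes "A \<in> perms (e + f)" "split_at \<tau> e A"
  shows "\<exists>E F. E \<in> perms e \<and> F \<in> perms f \<and> A = join \<tau> E F"
proof -
  define P Q where "P = take e A" and "Q = drop e A"
  have A: "A = P @ Q" by (simp add: P_def Q_def)
  have l: "length P = e" "length Q = f" using perms_length[OF assms(1)] by (auto simp: P_def Q_def)
  have "distinct (P @ Q)" "set (P @ Q) = {..<e+f}" using assms(1) unfolding perms_def A[symmetric] by blast+
  then have d: "distinct (P @ Q)" "set P \<union> set Q = {..<e+f}" by simp_all
  have c: "card (set P) = e" "card (set Q) = f" using d(1) l by (simp_all add: distinct_card)
  have dj: "set P \<inter> set Q = {}" using d by auto
  have sub: "\<exists>R. R \<in> perms m \<and> Q' = map (\<lambda>x. x + k) R"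
    if "distinct Q'" "set Q' = {k..<k+m}" for Q' k m
  proof (intro exI conjI)
    show "map (\<lambda>x. x - k) Q' \<in> perms m"
    proof -
      have "(\<lambda>x. x - k) ` {k..<k+m} = {..<m}"
        by (force intro: image_eqI[of _ _ "_ + k"])
      then show ?thesis using that by (auto simp: perms_def distinct_map inj_on_def)
    qed
    show "Q' = map (\<lambda>x. x + k) (map (\<lambda>x. x - k) Q')"
      using that by (auto simp: o_def intro!: map_idI[symmetric])
  qed
  have cmp: "{..<k+m} - {..<k} = {k..<k+m}" for k m :: nat by auto
  show ?thesis
  proof (cases \<tau>)
    case True
    have "\<forall>x\<in>set Q. \<forall>y\<in>set P. x < y" using assms(2) True unfolding split_at_def P_def Q_def by simp
    then have Q: "set Q = {..<f}" using initial_segment[of "set Q" "set P" "e+f"] d c by (simp add: Un_commute)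
    have "set P = {..<f+e} - set Q" using dj d(2) by (auto simp: add.commute)
    then have "set P = {..<f+e} - {..<f}" unfolding Q .
    then have "set P = {f..<f+e}" using cmp by simp
    then obtain R where "R \<in> perms e" "P = map (\<lambda>x. x + f) R" using sub[of P f e] d by auto
    moreover have "Q \<in> perms f" using Q d by (simp add: perms_def)
    ultimately show ?thesis using True A l by (intro exI[of _ R] exI[of _ Q]) (simp add: join_def)
  next
    case False
    have "\<forall>x\<in>set P. \<forall>y\<in>set Q. x < y" using assms(2) False unfolding split_at_def P_def Q_def by simp
    then have P: "set P = {..<e}" using initial_segment[of "set P" "set Q" "e+f"] d c by simp
    have "set Q = {..<e+f} - set P" using dj d(2) by auto
    then have "set Q = {..<e+f} - {..<e}" unfolding P .
    then have "set Q = {e..<e+f}" using cmp by simp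
    then obtain R where "R \<in> perms f" "Q = map (\<lambda>x. x + e) R" using sub[of Q e f] d by auto
    moreover have "P \<in> perms e" using P d by (simp add: perms_def)
    ultimately show ?thesis using False A l by (intro exI[of _ P] exI[of _ R]) (simp add: join_def)
  qed
qed

lemma join_inj:
  assumes "length E = length E'" "length F = length F'" "join \<tau> E F = join \<tau> E' F'"
  shows "E = E' \<and> F = F'"
proof -
  have i: "inj (\<lambda>x::nat. x + k)" for k by (simp add: inj_on_def)
  show ?thesis using assms i by (auto simp: join_def inj_map_eq_map split: if_splits)
qed

subsection \<open>Counting gluing words\<close>

text \<open>The number of weakly increasing words of length \<open>r\<close> with last letter \<open>k\<close>; equivalently, by reversal,
  of those whose first letter has \<open>k\<close> larger letters.\<close>

fun word_count :: "nat \<Rightarrow> nat \<Rightarrow> nat" where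
  "word_count 0 k = (if k = 0 then 1 else 0)"
| "word_count (Suc r) k = (\<Sum>j\<le>k. word_count r j)"

lemma word_count_one [simp]: "word_count (Suc 0) k = 1"
  by (induction k) auto

lemma word_count_diff: "word_count (Suc r) (Suc k) = word_count (Suc r) k + word_count r (Suc k)"
  by simp

text \<open>Taking differences in \<open>k\<close> lowers \<open>r\<close>, but says nothing at the first argument; hence the
  hypothesis only for large \<open>k\<close>.\<close>

lemma word_count_independent:
  fixes d :: "nat \<Rightarrow> int"
  assumes "\<And>k. k \<ge> m \<Longrightarrow> (\<Sum>r<R. d r * int (word_count (Suc r) k)) = 0" "r < R"
  shows "d r = 0"
  using assms
proof (induction R arbitrary: d m r)
  case 0
  then show ?case by simp
next
  case (Suc R)
  have "(\<Sum>r<R. d (Suc r) * int (word_count (Suc r) k)) = 0" if "k \<ge> Suc m" for k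
  proof -
    obtain k' where k: "k = Suc k'" "k' \<ge> m" using Suc_le_D[OF \<open>k \<ge> Suc m\<close>] \<open>k \<ge> Suc m\<close> by auto
    have "(\<Sum>r<Suc R. d r * int (word_count (Suc r) (Suc k'))) - (\<Sum>r<Suc R. d r * int (word_count (Suc r) k'))
      = (\<Sum>r<Suc R. d r * int (word_count r (Suc k')))"
      unfolding sum_subtractf[symmetric] word_count_diff by (simp add: algebra_simps)
    also have "\<dots> = d 0 * int (word_count 0 (Suc k')) + (\<Sum>r<R. d (Suc r) * int (word_count (Suc r) (Suc k')))"
      by (rule sum.lessThan_Suc_shift)
    finally show ?thesis using Suc.prems(1)[of "Suc k'"] Suc.prems(1)[of k'] k by simp
  qed
  then have *: "d (Suc r) = 0" if "r < R" for r
    using Suc.IH[of "Suc m" "\<lambda>r. d (Suc r)" r] that by blast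
  have "(\<Sum>r<Suc R. d r * int (word_count (Suc r) m)) = d 0"
    unfolding sum.lessThan_Suc_shift using * by simp
  then have "d 0 = 0" using Suc.prems(1)[of m] by simp
  then show ?case using * Suc.prems(2) by (cases r) auto
qed

definition weave_words :: "nat set \<Rightarrow> nat set \<Rightarrow> nat \<Rightarrow> nat list set" where
  "weave_words S K a = {w. length w = a \<and> sorted w \<and> set w \<subseteq> K \<and> jumps w S}"

lemma finite_weave_words: "finite K \<Longrightarrow> finite (weave_words S K a)"
  by (rule finite_subset[OF _ finite_lists_length_eq[of K a]]) (auto simp: weave_words_def)

lemma sum_rank:
  assumes "finite K" "j \<in> K"
  shows "(\<Sum>i\<in>{i\<in>K. i \<le> j}. f (rank K i)) = (\<Sum>k\<le>rank K j. f k)"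
proof (rule sum.reindex_bij_betw)
  have "rank K i \<le> rank K j \<longleftrightarrow> i \<le> j" if "i \<in> K" for i
    using strict_mono_on_less_eq[OF rank_mono[OF assms(1)] that assms(2)] .
  moreover have "rank K j < card K" using rank_bij[OF assms(1)] assms(2) by (auto simp: bij_betw_def)
  ultimately have "rank K ` {i \<in> K. i \<le> j} = {..rank K j}"
    using rank_bij[OF assms(1)] unfolding bij_betw_def
    by (auto simp: image_iff) (metis (mono_tags, lifting) imageE lessThan_iff order_le_less_trans)
  moreover have "inj_on (rank K) {i \<in> K. i \<le> j}"
    using rank_bij[OF assms(1)] unfolding bij_betw_def inj_on_def by blast
  ultimately show "bij_betw (rank K) {i \<in> K. i \<le> j} {..rank K j}" by (simp add: bij_betw_def)
qed

text \<open>The rank counted from above: the two patterns read an interleaving from opposite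
  ends.\<close>

definition corank :: "nat set \<Rightarrow> nat \<Rightarrow> nat" where
  "corank K j = card {i \<in> K. j < i}"

lemma rank_corank:
  assumes "finite K" "j \<in> K"
  shows "rank K j + corank K j + 1 = card K"
proof -
  have "card K = card ({i\<in>K. i < j} \<union> ({i\<in>K. j < i} \<union> {j}))" using assms(2) by (intro arg_cong[of _ _ card]) auto
  also have "\<dots> = card {i\<in>K. i < j} + (card {i\<in>K. j < i} + 1)"
    using assms(1) by (subst card_Un_disjoint) (auto simp: card_Un_disjoint)
  finally show ?thesis by (simp add: rank_def corank_def)
qed

lemma sum_corank:
  assumes "finite K" "j \<in> K"
  shows "(\<Sum>i\<in>{i\<in>K. j \<le> i}. f (corank K i)) = (\<Sum>k\<le>corank K j. f k)"
proof (rule sum.reindex_bij_betw)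
  have c: "corank K i = card K - 1 - rank K i" if "i \<in> K" for i using rank_corank[OF assms(1) that] by linarith
  have m: "corank K i \<le> corank K j \<longleftrightarrow> j \<le> i" if "i \<in> K" for i
    using strict_mono_on_less_eq[OF rank_mono[OF assms(1)] assms(2) that]
      rank_corank[OF assms(1) that] rank_corank[OF assms] by linarith
  have "inj_on (corank K) {i \<in> K. j \<le> i}"
  proof (rule inj_onI)
    fix x y assume xy: "x \<in> {i \<in> K. j \<le> i}" "y \<in> {i \<in> K. j \<le> i}" "corank K x = corank K y"
    then have "rank K x = rank K y" using rank_corank[OF assms(1)] by (metis (mono_tags, lifting) add_right_cancel mem_Collect_eq)
    then show "x = y" using xy rank_bij[OF assms(1)] unfolding bij_betw_def inj_on_def by blast
  qed
  moreover have "corank K ` {i \<in> K. j \<le> i} = {..corank K j}"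
  proof (intro set_eqI iffI)
    fix x assume "x \<in> corank K ` {i \<in> K. j \<le> i}" then show "x \<in> {..corank K j}" using m by auto
  next
    fix x assume x: "x \<in> {..corank K j}"
    then have "card K - 1 - x < card K" using rank_corank[OF assms] by auto
    then obtain i where i: "i \<in> K" "rank K i = card K - 1 - x"
      using rank_bij[OF assms(1)] unfolding bij_betw_def by (metis imageE lessThan_iff)
    then have "corank K i = x" using x rank_corank[OF assms(1) i(1)] rank_corank[OF assms] by auto
    then show "x \<in> corank K ` {i \<in> K. j \<le> i}" using i m[OF i(1)] x by auto
  qed
  ultimately show "bij_betw (corank K) {i \<in> K. j \<le> i} {..corank K j}" by (simp add: bij_betw_def)
qed

lemma jumps_append1:
  assumes "u \<noteq> []"
  shows "jumps (u @ [j]) S \<longleftrightarrow> jumps u S \<and> (last u \<noteq> j \<longrightarrow> length u \<in> S)"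
proof -
  obtain l where l: "length u = Suc l" using assms by (cases u) auto
  have "last u = u ! l" using assms l by (simp add: last_conv_nth)
  then show ?thesis unfolding jumps_def using l by (auto simp: nth_append less_Suc_eq)
qed

lemma jumps_Cons:
  assumes "u \<noteq> []"
  shows "jumps (j # u) S \<longleftrightarrow> jumps u {v. Suc v \<in> S} \<and> (hd u \<noteq> j \<longrightarrow> 1 \<in> S)"
proof -
  have h: "hd u = u ! 0" using assms by (simp add: hd_conv_nth)
  have "jumps (j # u) S \<longleftrightarrow> (\<forall>v<length u. (j # u) ! v \<noteq> u ! v \<longrightarrow> Suc v \<in> S)"
    by (auto simp: jumps_def)
  also have "\<dots> \<longleftrightarrow> (j \<noteq> u ! 0 \<longrightarrow> 1 \<in> S) \<and> (\<forall>v. Suc v < length u \<longrightarrow> u ! v \<noteq> u ! Suc v \<longrightarrow> Suc (Suc v) \<in> S)"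
  proof (intro iffI conjI allI impI)
    fix v assume "\<forall>v<length u. (j # u) ! v \<noteq> u ! v \<longrightarrow> Suc v \<in> S" "Suc v < length u" "u ! v \<noteq> u ! Suc v"
    then show "Suc (Suc v) \<in> S" by (metis nth_Cons_Suc)
  next
    fix v assume "(j \<noteq> u ! 0 \<longrightarrow> 1 \<in> S) \<and> (\<forall>v. Suc v < length u \<longrightarrow> u ! v \<noteq> u ! Suc v \<longrightarrow> Suc (Suc v) \<in> S)"
      "v < length u" "(j # u) ! v \<noteq> u ! v"
    then show "Suc v \<in> S" by (cases v) auto
  qed (use assms in \<open>auto dest!: spec[of _ 0]\<close>)
  finally show ?thesis unfolding jumps_def h by auto
qed

text \<open>Remove the last letter. If a jump at \<open>a\<close> is allowed, the letter before it
  is any element of \<open>K\<close> up to \<open>j\<close>, which is the recursion of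
  \<open>word_count\<close>; if not, it is \<open>j\<close> again and the count does not change. So
  only allowed jump positions contribute to the first argument.\<close>

lemma card_words_last:
  assumes "finite K" "j \<in> K" "a > 0"
  shows "card {w \<in> weave_words S K a. last w = j} = word_count (Suc (card (S \<inter> {1..<a}))) (rank K j)"
  using assms(2,3)
proof (induction a arbitrary: j)
  case 0
  then show ?case by simp
next
  case (Suc a)
  show ?case
  proof (cases "a = 0")
    case True
    have "{w \<in> weave_words S K (Suc a). last w = j} = {[j]}"
      using True Suc.prems by (auto simp: weave_words_def jumps_def length_Suc_conv)
    then show ?thesis using True by simp
  next
    case False
    then have a: "a > 0" by simp
    let ?D = "if a \<in> S then {i \<in> K. i \<le> j} else {j}"
    have eq: "{w \<in> weave_words S K (Suc a). last w = j} = (\<lambda>u. u @ [j]) ` (\<Union>i\<in>?D. {u \<in> weave_words S K a. last u = i})"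
    proof (intro set_eqI iffI)
      fix w assume w: "w \<in> {w \<in> weave_words S K (Suc a). last w = j}"
      then obtain u where u: "w = u @ [j]" by (cases w rule: rev_cases) (auto simp: weave_words_def)
      have lu: "length u = a" using w u by (simp add: weave_words_def)
      then have ne: "u \<noteq> []" using a by auto
      then have "last u \<in> set u" by simp
      then show "w \<in> (\<lambda>u. u @ [j]) ` (\<Union>i\<in>?D. {u \<in> weave_words S K a. last u = i})"
        using w u lu jumps_append1[OF ne, of j S] unfolding weave_words_def by (auto simp: sorted_append)
    next
      fix w assume "w \<in> (\<lambda>u. u @ [j]) ` (\<Union>i\<in>?D. {u \<in> weave_words S K a. last u = i})"
      then obtain u where u: "w = u @ [j]" "u \<in> weave_words S K a" "last u \<in> ?D" by auto
      then have ne: "u \<noteq> []" and lu: "length u = a" using a by (auto simp: weave_words_def)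
      have "last u \<le> j" using u(3) by (auto split: if_splits)
      moreover have "\<forall>x\<in>set u. x \<le> last u"
      proof
        fix x assume "x \<in> set u"
        then obtain k where "k < length u" "x = u ! k" by (auto simp: in_set_conv_nth)
        then show "x \<le> last u" using u(2) ne unfolding weave_words_def
          by (auto simp: last_conv_nth intro!: sorted_nth_mono)
      qed
      ultimately show "w \<in> {w \<in> weave_words S K (Suc a). last w = j}"
        using u lu jumps_append1[OF ne, of j S] Suc.prems(1) unfolding weave_words_def
        by (auto simp: sorted_append split: if_splits intro: order_trans)
    qed
    have "card {w \<in> weave_words S K (Suc a). last w = j} = card (\<Union>i\<in>?D. {u \<in> weave_words S K a. last u = i})"
      unfolding eq by (intro card_image) (auto simp: inj_on_def)
    also have "\<dots> = (\<Sum>i\<in>?D. card {u \<in> weave_words S K a. last u = i})"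
      using assms(1) finite_weave_words[OF assms(1)] by (intro card_UN_disjoint) auto
    also have "\<dots> = (\<Sum>i\<in>?D. word_count (Suc (card (S \<inter> {1..<a}))) (rank K i))"
      using Suc.IH[OF _ a] Suc.prems(1) by (intro sum.cong) (auto split: if_splits)
    also have "\<dots> = word_count (Suc (card (S \<inter> {1..<Suc a}))) (rank K j)"
    proof (cases "a \<in> S")
      case True
      then have "S \<inter> {1..<Suc a} = insert a (S \<inter> {1..<a})" using a by auto
      then have "card (S \<inter> {1..<Suc a}) = Suc (card (S \<inter> {1..<a}))" by simp
      then show ?thesis using True sum_rank[OF assms(1) Suc.prems(1)] by (simp del: word_count.simps add: word_count.simps(2)[of "Suc _"])
    next
      case False
      then have "S \<inter> {1..<Suc a} = S \<inter> {1..<a}" by (auto simp: less_Suc_eq)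
      then show ?thesis using False by simp
    qed
    finally show ?thesis .
  qed
qed

text \<open>Mirror image of \<open>card_words_last\<close>. Removing a letter at the front shifts
  all positions by one, so the induction has to be general in \<open>S\<close>.\<close>

lemma card_words_hd:
  assumes "finite K" "j \<in> K" "a > 0"
  shows "card {w \<in> weave_words S K a. hd w = j} = word_count (Suc (card (S \<inter> {1..<a}))) (corank K j)"
  using assms(2,3)
proof (induction a arbitrary: j S)
  case 0
  then show ?case by simp
next
  case (Suc a)
  show ?case
  proof (cases "a = 0")
    case True
    have "{w \<in> weave_words S K (Suc a). hd w = j} = {[j]}"
      using True Suc.prems by (auto simp: weave_words_def jumps_def length_Suc_conv)
    then show ?thesis using True by simp
  next
    case False
    then have a: "a > 0" by simp
    let ?D = "if 1 \<in> S then {i \<in> K. j \<le> i} else {j}"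
    let ?S = "{v. Suc v \<in> S}"
    have eq: "{w \<in> weave_words S K (Suc a). hd w = j} = (\<lambda>u. j # u) ` (\<Union>i\<in>?D. {u \<in> weave_words ?S K a. hd u = i})"
    proof (intro set_eqI iffI)
      fix w assume w: "w \<in> {w \<in> weave_words S K (Suc a). hd w = j}"
      then obtain u where u: "w = j # u" by (cases w) (auto simp: weave_words_def)
      have lu: "length u = a" using w u by (simp add: weave_words_def)
      then have ne: "u \<noteq> []" using a by auto
      then have "hd u \<in> set u" by simp
      then show "w \<in> (\<lambda>u. j # u) ` (\<Union>i\<in>?D. {u \<in> weave_words ?S K a. hd u = i})"
        using w u lu jumps_Cons[OF ne, of j S] unfolding weave_words_def by auto
    next
      fix w assume "w \<in> (\<lambda>u. j # u) ` (\<Union>i\<in>?D. {u \<in> weave_words ?S K a. hd u = i})"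
      then obtain u where u: "w = j # u" "u \<in> weave_words ?S K a" "hd u \<in> ?D" by auto
      then have ne: "u \<noteq> []" and lu: "length u = a" using a by (auto simp: weave_words_def)
      have "j \<le> hd u" using u(3) by (auto split: if_splits)
      moreover have "\<forall>x\<in>set u. hd u \<le> x" using u(2) by (cases u) (auto simp: weave_words_def)
      ultimately show "w \<in> {w \<in> weave_words S K (Suc a). hd w = j}"
        using u lu jumps_Cons[OF ne, of j S] Suc.prems(1) unfolding weave_words_def
        by (auto split: if_splits intro: order_trans)
    qed
    have "card {w \<in> weave_words S K (Suc a). hd w = j} = card (\<Union>i\<in>?D. {u \<in> weave_words ?S K a. hd u = i})"
      unfolding eq by (intro card_image) (auto simp: inj_on_def)
    also have "\<dots> = (\<Sum>i\<in>?D. card {u \<in> weave_words ?S K a. hd u = i})"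
      using assms(1) finite_weave_words[OF assms(1)] by (intro card_UN_disjoint) auto
    also have "\<dots> = (\<Sum>i\<in>?D. word_count (Suc (card (?S \<inter> {1..<a}))) (corank K i))"
      using Suc.IH[OF _ a] Suc.prems(1) by (intro sum.cong) (auto split: if_splits)
    also have "\<dots> = word_count (Suc (card (S \<inter> {1..<Suc a}))) (corank K j)"
    proof -
      have im: "S \<inter> {2..<Suc a} = Suc ` (?S \<inter> {1..<a})"
      proof (intro set_eqI iffI)
        fix x assume "x \<in> S \<inter> {2..<Suc a}"
        then show "x \<in> Suc ` (?S \<inter> {1..<a})" by (intro image_eqI[of _ _ "x - 1"]) auto
      qed auto
      have c: "card (S \<inter> {2..<Suc a}) = card (?S \<inter> {1..<a})" unfolding im by (simp add: card_image)
      show ?thesis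
      proof (cases "1 \<in> S")
        case True
        then have "S \<inter> {1..<Suc a} = insert 1 (S \<inter> {2..<Suc a})" using a by auto
        then have "card (S \<inter> {1..<Suc a}) = Suc (card (?S \<inter> {1..<a}))" using c by simp
        then show ?thesis using True sum_corank[OF assms(1) Suc.prems(1)] by (simp del: word_count.simps add: word_count.simps(2)[of "Suc _"])
      next
        case False
        then have "S \<inter> {1..<Suc a} = S \<inter> {2..<Suc a}" by (auto simp: Suc_le_eq le_less numeral_2_eq_2)
        then show ?thesis using False c by simp
      qed
    qed
    finally show ?thesis .
  qed
qed

lemma weaves_eq_weave_words: "weaves \<tau> A X = weave_words (active_gaps \<tau> A) (free_cuts \<tau> X) (length A)"
  by (simp add: weaves_def weave_words_def)

lemma finite_weaves: "finite (weaves \<tau> A X)"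
  unfolding weaves_eq_weave_words by (rule finite_weave_words) simp

text \<open>The outermost gaps \<open>0\<close> and \<open>a\<close> are always active, but no word
  can jump there.\<close>

lemma active_gaps_inner:
  assumes "A \<in> perms a" "a > 0"
  shows "Suc (card (active_gaps \<tau> A \<inter> {1..<a})) = card (active_gaps \<tau> A) - 1" "card (active_gaps \<tau> A) \<ge> 2"
proof -
  have "active_gaps \<tau> A = insert 0 (insert a (active_gaps \<tau> A \<inter> {1..<a}))"
    using active_gaps_0[of \<tau> A] active_gaps_top[OF assms(1), of \<tau>] perms_length[OF assms(1)] assms(2)
    by (auto simp: active_gaps_def Suc_le_eq)
  then have "card (active_gaps \<tau> A) = card (insert 0 (insert a (active_gaps \<tau> A \<inter> {1..<a})))" by simp
  also have "\<dots> = Suc (Suc (card (active_gaps \<tau> A \<inter> {1..<a})))" using assms(2) by simp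
  finally show "Suc (card (active_gaps \<tau> A \<inter> {1..<a})) = card (active_gaps \<tau> A) - 1" "card (active_gaps \<tau> A) \<ge> 2" by simp_all
qed

lemma free_cuts_top: "X \<in> perms b \<Longrightarrow> b \<in> free_cuts \<tau> X"
proof -
  assume X: "X \<in> perms b"
  have "y < b \<and> z < b" if "subseq [y,z] X" for y z using subseq_set[OF that] X by (auto simp: perms_def)
  then show ?thesis using perms_length[OF X] by (fastforce simp: free_cuts_def kills_cut_def)
qed

text \<open>A word leaves \<open>Suc (card ?K) - r\<close> free cuts, where \<open>r\<close> is the
  rank of its last letter for 1423 and the corank of its first letter for 2413. The words with given
  \<open>r\<close> are counted by \<open>card_words_last\<close> and \<open>card_words_hd\<close>,
  with the same result. The lower bound 2 stems from the cut above the maximum and the cut given by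
  the letter itself.\<close>

lemma card_weaves_fiber:
  assumes A: "A \<in> perms a" and X: "X \<in> perms b" and "a > 0"
  shows "card {w \<in> weaves \<tau> A X. card (free_cuts \<tau> (glue A X w)) = k} =
    (if 2 \<le> k \<and> k \<le> Suc (card (free_cuts \<tau> X)) then word_count (card (active_gaps \<tau> A) - 1) (Suc (card (free_cuts \<tau> X)) - k) else 0)"
proof -
  let ?K = "free_cuts \<tau> X"
  have lA: "length A = a" using A perms_length by blast
  define f where "f w = (if \<tau> then last w else hd w)" for w :: "nat list"
  define r where "r = (if \<tau> then rank ?K else corank ?K)"
  have rb: "j \<in> ?K \<Longrightarrow> r j < card ?K" for j
    using rank_corank[of ?K j] by (cases \<tau>) (auto simp: r_def)
  have fK: "f w \<in> ?K" if "w \<in> weaves \<tau> A X" for w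
  proof -
    have "w \<noteq> []" using that lA \<open>a > 0\<close> by (auto simp: weaves_def)
    then have "hd w \<in> set w" "last w \<in> set w" by simp_all
    then show ?thesis using that by (auto simp: weaves_def f_def)
  qed
  have val: "card (free_cuts \<tau> (glue A X w)) = Suc (card ?K) - r (f w)" if "w \<in> weaves \<tau> A X" for w
  proof -
    have wd: "w \<in> words a b" using weaves_words[OF X A that] .
    have 1: "card {j \<in> ?K. i \<le> j} = Suc (corank ?K i)" if "i \<in> ?K" for i
    proof -
      have "{j \<in> ?K. i \<le> j} = insert i {j \<in> ?K. i < j}" using that by auto
      then show ?thesis by (simp add: corank_def)
    qed
    have 2: "card {j \<in> ?K. j \<le> i} = Suc (rank ?K i)" if "i \<in> ?K" for i
    proof -
      have "{j \<in> ?K. j \<le> i} = insert i {j \<in> ?K. j < i}" using that by auto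
      then show ?thesis by (simp add: rank_def)
    qed
    show ?thesis using card_free_cuts_glue[OF A X wd \<open>a > 0\<close>, of \<tau>] fK[OF that] 1 2 rank_corank[of ?K "f w"]
      by (cases \<tau>) (auto simp: f_def r_def)
  qed
  have word_count: "card {w \<in> weaves \<tau> A X. f w = j} = word_count (card (active_gaps \<tau> A) - 1) (r j)" if "j \<in> ?K" for j
    using card_words_last[of ?K j a "active_gaps \<tau> A"] card_words_hd[of ?K j a "active_gaps \<tau> A"] that \<open>a > 0\<close>
    unfolding weaves_eq_weave_words lA active_gaps_inner(1)[OF A \<open>a > 0\<close>] by (cases \<tau>) (simp_all add: f_def r_def)
  show ?thesis
  proof (cases "2 \<le> k \<and> k \<le> Suc (card ?K)")
    case False
    then have em: "{w \<in> weaves \<tau> A X. card (free_cuts \<tau> (glue A X w)) = k} = {}"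
      using val fK rb by fastforce
    show ?thesis unfolding if_not_P[OF False] em by simp
  next
    case True
    let ?q = "Suc (card ?K) - k"
    have "?q < card ?K" using True by auto
    obtain j where j: "j \<in> ?K" "r j = ?q"
    proof (cases \<tau>)
      case t: True
      have "?q \<in> rank ?K ` ?K" using rank_bij[of ?K] \<open>?q < card ?K\<close> by (auto simp: bij_betw_def)
      then show ?thesis using that t by (auto simp: r_def)
    next
      case t: False
      have "card ?K - 1 - ?q \<in> rank ?K ` ?K" using rank_bij[of ?K] \<open>?q < card ?K\<close> by (auto simp: bij_betw_def)
      then obtain j where "j \<in> ?K" "rank ?K j = card ?K - 1 - ?q" by auto
      then show ?thesis using that t rank_corank[of ?K j] \<open>?q < card ?K\<close> by (auto simp: r_def)
    qed
    have "card (free_cuts \<tau> (glue A X w)) = k \<longleftrightarrow> f w = j" if w: "w \<in> weaves \<tau> A X" for w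
    proof
      assume "card (free_cuts \<tau> (glue A X w)) = k"
      then have "r (f w) = r j" using val[OF w] j rb[OF fK[OF w]] by simp
      then have "rank ?K (f w) = rank ?K j"
        using rank_corank[of ?K j] rank_corank[of ?K "f w"] j fK[OF w] by (cases \<tau>) (auto simp: r_def)
      then show "f w = j" using rank_bij[of ?K] j fK[OF w] unfolding bij_betw_def inj_on_def by auto
    next
      assume "f w = j" then show "card (free_cuts \<tau> (glue A X w)) = k" using val[OF w] j True by simp
    qed
    then have "{w \<in> weaves \<tau> A X. card (free_cuts \<tau> (glue A X w)) = k} = {w \<in> weaves \<tau> A X. f w = j}" by blast
    then show ?thesis using word_count[OF j(1)] j True by simp
  qed
qed

text \<open>Summing over the last letter is one more step of the recursion of
  \<open>word_count\<close>. The sum reaches up to the largest rank, because the top cut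
  \<open>b\<close> is always free.\<close>

lemma card_weaves:
  assumes A: "A \<in> perms a" and X: "X \<in> perms b" and "a > 0"
  shows "card (weaves \<tau> A X) = word_count (card (active_gaps \<tau> A)) (card (free_cuts \<tau> X) - 1)"
proof -
  let ?K = "free_cuts \<tau> X"
  have bK: "b \<in> ?K" using free_cuts_top[OF X] .
  have le: "j \<le> b" if "j \<in> ?K" for j using that perms_length[OF X] by (auto simp: free_cuts_def)
  have lA: "length A = a" using A perms_length by blast
  have "last w \<in> ?K" if "w \<in> weaves \<tau> A X" for w
  proof -
    have "w \<noteq> []" using that lA \<open>a > 0\<close> by (auto simp: weaves_def)
    then have "last w \<in> set w" by simp
    then show ?thesis using that by (auto simp: weaves_def)
  qed
  then have "weaves \<tau> A X = (\<Union>j\<in>?K. {w \<in> weaves \<tau> A X. last w = j})" by auto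
  then have "card (weaves \<tau> A X) = card (\<Union>j\<in>?K. {w \<in> weaves \<tau> A X. last w = j})" by simp
  also have "\<dots> = (\<Sum>j\<in>?K. card {w \<in> weaves \<tau> A X. last w = j})"
    using finite_weaves by (intro card_UN_disjoint) auto
  also have "\<dots> = (\<Sum>j\<in>{j\<in>?K. j \<le> b}. word_count (card (active_gaps \<tau> A) - 1) (rank ?K j))"
  proof (rule sum.cong)
    show "?K = {j \<in> ?K. j \<le> b}" using le by auto
    fix j assume "j \<in> {j\<in>?K. j \<le> b}"
    then show "card {w \<in> weaves \<tau> A X. last w = j} = word_count (card (active_gaps \<tau> A) - 1) (rank ?K j)"
      using card_words_last[of ?K j a "active_gaps \<tau> A"] \<open>a > 0\<close> unfolding weaves_eq_weave_words lA active_gaps_inner(1)[OF A \<open>a > 0\<close>] by simp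
  qed
  also have "\<dots> = (\<Sum>k\<le>rank ?K b. word_count (card (active_gaps \<tau> A) - 1) k)" using sum_rank[OF _ bK] by simp
  also have "rank ?K b = card ?K - 1"
  proof -
    have "corank ?K b = 0" using le by (force simp: corank_def)
    then show ?thesis using rank_corank[of ?K b] bK by simp
  qed
  finally have "card (weaves \<tau> A X) = word_count (Suc (card (active_gaps \<tau> A) - 1)) (card ?K - 1)" by simp
  then show ?thesis using active_gaps_inner(2)[OF A \<open>a > 0\<close>, of \<tau>] by (simp del: word_count.simps)
qed

text \<open>The numbers of active gaps and of free cuts determine the distribution, independently of the pattern.\<close>

lemma eqd_weaves:
  assumes "A \<in> perms a" "X \<in> perms b" "A' \<in> perms a" "X' \<in> perms b"
    and "card (active_gaps \<tau> A) = card (active_gaps \<tau>' A')" "card (free_cuts \<tau> X) = card (free_cuts \<tau>' X')"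
  shows "eqd (\<lambda>w. card (free_cuts \<tau> (glue A X w))) (weaves \<tau> A X) (\<lambda>w. card (free_cuts \<tau>' (glue A' X' w))) (weaves \<tau>' A' X')"
proof (cases "a = 0")
  case True
  \<comment> \<open>The fibre count refers to a first or last letter, so the empty word is treated
    by hand.\<close>
  then have A: "A = []" "A' = []" using assms perms_length by (metis length_0_conv)+
  have W: "weaves \<tau> [] Y = {[]}" for \<tau> Y by (auto simp: weaves_def jumps_def)
  have "card (free_cuts \<tau> (glue [] X [])) = card (free_cuts \<tau>' (glue [] X' []))"
    unfolding glue_Nil using assms perms_length[OF assms(2)] perms_length[OF assms(4)]
    by (subst (1 2) card_free_cuts_Cons_max) (auto simp: perms_def)
  then show ?thesis unfolding A W eqd_def by (intro exI[of _ id]) auto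
next
  case False
  then show ?thesis using assms by (subst eqd_card_iff) (simp_all add: finite_weaves card_weaves_fiber)
qed

subsection \<open>Statistics of glued permutations\<close>

definition des :: "nat list \<Rightarrow> nat set" where
  "des xs = {i. Suc i < length xs \<and> xs ! Suc i < xs ! i}"

definition rl :: "nat list \<Rightarrow> nat set" where
  "rl xs = {i. i < length xs \<and> (\<forall>j. i < j \<longrightarrow> j < length xs \<longrightarrow> xs ! j < xs ! i)}"

text \<open>The position of the second largest value, which is \<open>n - 2\<close> as values are
  0-based. As a set it also makes sense for permutations of fewer than two values, where it is
  empty.\<close>

definition second :: "nat list \<Rightarrow> nat set" where
  "second xs = {i. i < length xs \<and> Suc (Suc (xs ! i)) = length xs}"

lemma des_map: "strict_mono_on (set xs) f \<Longrightarrow> des (map f xs) = des xs"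
  by (auto simp: des_def strict_mono_on_less)

lemma rl_map: "strict_mono_on (set xs) f \<Longrightarrow> rl (map f xs) = rl xs"
  by (auto simp: rl_def strict_mono_on_less)

lemma des_Nil [simp]: "des [] = {}" by (simp add: des_def)
lemma rl_Nil [simp]: "rl [] = {}" by (simp add: rl_def)

lemma des_append:
  "des (P @ Q) = des P \<union> (if P \<noteq> [] \<and> Q \<noteq> [] \<and> hd Q < last P then {length P - 1} else {})
    \<union> (\<lambda>i. i + length P) ` des Q"
proof (intro set_eqI iffI)
  fix i assume i: "i \<in> des (P @ Q)"
  consider "Suc i < length P" | "Suc i = length P" | "length P \<le> i" by linarith
  then show "i \<in> des P \<union> (if P \<noteq> [] \<and> Q \<noteq> [] \<and> hd Q < last P then {length P - 1} else {})
    \<union> (\<lambda>i. i + length P) ` des Q"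
  proof cases
    case 1 then show ?thesis using i by (auto simp: des_def nth_append)
  next
    case 2
    then have "P \<noteq> []" "Q \<noteq> []" using i by (auto simp: des_def)
    moreover have li: "length P - 1 = i" using 2 by linarith
    moreover have "last P = P ! i" "hd Q = Q ! 0" using calculation by (simp_all add: last_conv_nth hd_conv_nth)
    ultimately show ?thesis using i 2 by (auto simp: des_def nth_append)
  next
    case 3
    then have "i - length P \<in> des Q" using i by (auto simp: des_def nth_append Suc_diff_le)
    then show ?thesis using 3 by (auto intro!: image_eqI[of _ _ "i - length P"])
  qed
next
  fix i assume "i \<in> des P \<union> (if P \<noteq> [] \<and> Q \<noteq> [] \<and> hd Q < last P then {length P - 1} else {})
    \<union> (\<lambda>i. i + length P) ` des Q"
  then consider "i \<in> des P" | "P \<noteq> []" "Q \<noteq> []" "hd Q < last P" "i = length P - 1"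
    | k where "k \<in> des Q" "i = k + length P" by (auto split: if_splits)
  then show "i \<in> des (P @ Q)"
  proof cases
    case 1 then show ?thesis by (auto simp: des_def nth_append)
  next
    case 2
    then have "last P = P ! i" "hd Q = Q ! 0" "Suc i = length P"
      by (auto simp: last_conv_nth hd_conv_nth)
    then show ?thesis using 2 by (auto simp: des_def nth_append)
  next
    case 3 then show ?thesis by (auto simp: des_def nth_append)
  qed
qed

lemma des_Cons: "des (x # Q) = (if Q \<noteq> [] \<and> hd Q < x then {0} else {}) \<union> Suc ` des Q"
proof -
  have "des [x] = {}" by (simp add: des_def)
  then show ?thesis using des_append[of "[x]" Q] by simp
qed

lemma rl_append:
  assumes "\<forall>p\<in>set P. \<exists>q\<in>set Q. p < q"
  shows "rl (P @ Q) = (\<lambda>i. i + length P) ` rl Q"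
proof (intro set_eqI iffI)
  fix i assume i: "i \<in> rl (P @ Q)"
  have "length P \<le> i"
  proof (rule ccontr)
    assume "\<not> length P \<le> i"
    then have "P ! i \<in> set P" by simp
    then obtain q where "q \<in> set Q" "P ! i < q" using assms by blast
    then obtain k where "k < length Q" "P ! i < Q ! k" by (auto simp: in_set_conv_nth)
    moreover have "(P @ Q) ! (length P + k) < (P @ Q) ! i"
    proof -
      have "\<forall>j. i < j \<longrightarrow> j < length (P @ Q) \<longrightarrow> (P @ Q) ! j < (P @ Q) ! i" using i unfolding rl_def by blast
      then show ?thesis using \<open>k < length Q\<close> \<open>\<not> length P \<le> i\<close> by (auto simp del: nth_append_length_plus)
    qed
    ultimately show False using \<open>\<not> length P \<le> i\<close> by (simp add: nth_append)
  qed
  moreover have "i - length P \<in> rl Q"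
    unfolding rl_def
  proof (intro CollectI conjI allI impI)
    show "i - length P < length Q" using i \<open>length P \<le> i\<close> by (auto simp: rl_def)
    fix j assume j: "i - length P < j" "j < length Q"
    have "\<forall>j. i < j \<longrightarrow> j < length (P @ Q) \<longrightarrow> (P @ Q) ! j < (P @ Q) ! i" using i unfolding rl_def by blast
    from this[rule_format, of "length P + j"] have "(P @ Q) ! (length P + j) < (P @ Q) ! i" using j by simp
    then show "Q ! j < Q ! (i - length P)" using \<open>length P \<le> i\<close> by (simp add: nth_append)
  qed
  ultimately show "i \<in> (\<lambda>i. i + length P) ` rl Q" by (auto intro!: image_eqI[of _ _ "i - length P"])
next
  fix i assume "i \<in> (\<lambda>i. i + length P) ` rl Q"
  then obtain k where k: "k \<in> rl Q" "i = k + length P" by blast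
  show "i \<in> rl (P @ Q)"
    using k(1) unfolding rl_def k(2) by (auto simp: nth_append)
qed

lemma rl_Cons_max:
  assumes "\<forall>q\<in>set Q. q < x"
  shows "rl (x # Q) = insert 0 (Suc ` rl Q)"
proof -
  have 0: "0 \<in> rl (x # Q)" unfolding rl_def
  proof (intro CollectI conjI allI impI)
    fix j assume "0 < j" "j < length (x # Q)"
    then obtain k where "j = Suc k" "k < length Q" by (cases j) auto
    then show "(x # Q) ! j < (x # Q) ! 0" using assms by simp
  qed simp
  have S: "Suc k \<in> rl (x # Q) \<longleftrightarrow> k \<in> rl Q" for k
  proof
    assume a: "Suc k \<in> rl (x # Q)"
    show "k \<in> rl Q" unfolding rl_def
    proof (intro CollectI conjI allI impI)
      show "k < length Q" using a by (simp add: rl_def)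
      fix j assume "k < j" "j < length Q"
      have "\<forall>l. Suc k < l \<longrightarrow> l < length (x # Q) \<longrightarrow> (x # Q) ! l < (x # Q) ! Suc k"
        using a unfolding rl_def by blast
      from this[rule_format, of "Suc j"] have "(x # Q) ! Suc j < (x # Q) ! Suc k"
        using \<open>k < j\<close> \<open>j < length Q\<close> by simp
      then show "Q ! j < Q ! k" by simp
    qed
  next
    assume a: "k \<in> rl Q"
    show "Suc k \<in> rl (x # Q)" unfolding rl_def
    proof (intro CollectI conjI allI impI)
      show "Suc k < length (x # Q)" using a by (simp add: rl_def)
      fix j assume "Suc k < j" "j < length (x # Q)"
      then obtain l where "j = Suc l" "k < l" "l < length Q" by (cases j) auto
      then show "(x # Q) ! j < (x # Q) ! Suc k" using a by (simp add: rl_def)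
    qed
  qed
  show ?thesis
  proof (rule set_eqI)
    fix i show "i \<in> rl (x # Q) \<longleftrightarrow> i \<in> insert 0 (Suc ` rl Q)"
      using 0 S by (cases i) auto
  qed
qed

lemma rl_subset: "rl xs \<subseteq> {..<length xs}" by (auto simp: rl_def)

lemma finite_rl [simp]: "finite (rl xs)" using rl_subset finite_subset by blast

lemma second_eq:
  assumes "xs \<in> perms n" "i < n" "Suc (Suc (xs ! i)) = n"
  shows "second xs = {i}"
proof -
  have l: "length xs = n" "distinct xs" using assms(1) perms_length by (auto simp: perms_def)
  have "j = i" if "j < n" "Suc (Suc (xs ! j)) = n" for j
  proof -
    have "xs ! j = xs ! i" using that(2) assms(3) by (metis Suc_inject)
    then show ?thesis using nth_eq_iff_index_eq[OF l(2)] that(1) assms(2) unfolding l(1) by blast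
  qed
  then show ?thesis using assms(2,3) unfolding second_def l(1) by blast
qed

lemma ins_length [simp]: "length (ins i xs) = Suc (length xs)"
  by (simp add: ins_def)

lemma ins_0: "ins 0 X = length X # X"
  by (simp add: ins_def)

lemma glue_parts:
  assumes A: "A \<in> perms a" and X: "X \<in> perms b" and w: "w \<in> words a b"
  shows "length A = a" "length X = b" "set A = {..<a}" "set X = {..<b}"
    "des (map (lo w) A) = des A" "des (map (up w) X) = des X"
    "\<forall>x\<in>set (map (lo w) A). x < a + b" "\<forall>x\<in>set (map (up w) X). x < a + b"
proof -
  show s: "length A = a" "length X = b" "set A = {..<a}" "set X = {..<b}"
    using assms perms_length by (auto simp: perms_def)
  show "des (map (lo w) A) = des A" using des_map[of A "lo w"] lo_mono[OF w] s by simp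
  show "des (map (up w) X) = des X" using des_map[of X "up w"] up_mono by blast
  show "\<forall>x\<in>set (map (lo w) A). x < a + b" "\<forall>x\<in>set (map (up w) X). x < a + b"
    using s lo_lt[OF w] up_lt[OF w] by auto
qed

lemma last_lt_max: "\<forall>p\<in>set P. p < N \<Longrightarrow> P \<noteq> [] \<Longrightarrow> \<not> N < (last P :: nat)"
  using last_in_set by fastforce

text \<open>All is expressed by the statistics of \<open>ins i X\<close>, as the recursion requires.
  The old maximum at position \<open>a\<close> becomes the second largest value and is followed by a
  descent unless the new maximum comes directly after it; that case, \<open>i = 0\<close>, is
  visible as \<open>0 \<in> rl Y2\<close>.\<close>

lemma stats_right:
  assumes A: "A \<in> perms a" and X: "X \<in> perms b" and w: "w \<in> words a b" and i: "i \<le> b"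
  defines "Y \<equiv> ins (a + 1 + i) (glue A X w)" and "Y2 \<equiv> ins i X"
  shows "des Y = des A \<union> (if 0 \<in> rl Y2 then {} else {a}) \<union> (\<lambda>k. k + (a + 1)) ` des Y2"
    and "rl Y = (\<lambda>k. k + (a + 1)) ` rl Y2"
    and "second Y = {a}"
proof -
  note p = glue_parts[OF A X w]
  \<comment> \<open>\<open>f\<close> extends the relabelling of \<open>X\<close> to the new
    maximum.\<close>
  define f where "f x = (if x < b then up w x else a + b + 1)" for x
  define R where "R = map f Y2"
  have Y2: "Y2 = take i X @ b # drop i X" unfolding Y2_def ins_def p(2) ..
  have tk: "x < b" if "x \<in> set (take i X) \<union> set (drop i X)" for x
    using that p(4) by (auto dest: in_set_takeD in_set_dropD)
  have "map f (take i X) = map (up w) (take i X)" "map f (drop i X) = map (up w) (drop i X)"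
    using tk by (auto simp: f_def)
  then have R: "R = map (up w) (take i X) @ (a + b + 1) # map (up w) (drop i X)"
    unfolding R_def Y2 by (simp add: f_def)
  have Y: "Y = map (lo w) A @ (a + b) # R"
    unfolding Y_def ins_def glue_def using p(1,2) i by (simp add: R take_map drop_map)
  have Y2p: "Y2 \<in> perms (Suc b)" unfolding Y2_def by (rule ins_perms[OF X])
  have mono: "strict_mono_on (set Y2) f"
  proof (rule strict_mono_onI)
    fix x y assume "x \<in> set Y2" "y \<in> set Y2" "x < y"
    moreover from this have "x < b" using Y2p by (auto simp: perms_def)
    ultimately show "f x < f y" using up_lt[OF w \<open>x < b\<close>] by (simp add: f_def)
  qed
  have dR: "des R = des Y2" and rR: "rl R = rl Y2"
    unfolding R_def using des_map[OF mono] rl_map[OF mono] by auto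
  have zero: "0 \<in> rl Y2 \<longleftrightarrow> i = 0"
  proof
    assume z: "0 \<in> rl Y2"
    show "i = 0"
    proof (rule ccontr)
      assume "i \<noteq> 0"
      then have "Y2 ! i < Y2 ! 0" using z i p(2) unfolding rl_def Y2_def by simp
      moreover have "Y2 ! i = b" using i p(2) unfolding Y2 by (simp add: nth_append)
      moreover have "Y2 ! 0 < Suc b" using Y2p perms_length[OF Y2p] nth_mem[of 0 Y2] by (auto simp: perms_def)
      ultimately show False by simp
    qed
  next
    assume "i = 0"
    then have "Y2 = b # X" using Y2 by simp
    then show "0 \<in> rl Y2" using rl_Cons_max[of X b] p(4) by simp
  qed
  have hR: "hd R < a + b \<longleftrightarrow> i \<noteq> 0"
  proof (cases "i = 0")
    case False
    then have "take i X \<noteq> []" using i p(2) by auto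
    then have "hd (take i X) \<in> set X" using in_set_takeD hd_in_set by metis
    then have "hd R \<in> set (map (up w) X)" unfolding R using \<open>take i X \<noteq> []\<close> by (simp add: hd_map)
    then have "hd R < a + b" using p(8) by blast
    then show ?thesis using False by simp
  qed (simp add: R)
  have ne: "R \<noteq> []" by (simp add: R)
  have "des Y = des A \<union> (\<lambda>k. k + a) ` des ((a + b) # R)"
    unfolding Y des_append using p last_lt_max[OF p(7)] by auto
  also have "\<dots> = des A \<union> (if i = 0 then {} else {a}) \<union> (\<lambda>k. k + (a + 1)) ` des R"
    unfolding des_Cons using hR ne by (auto simp: image_iff)
  finally show "des Y = des A \<union> (if 0 \<in> rl Y2 then {} else {a}) \<union> (\<lambda>k. k + (a + 1)) ` des Y2"
    using dR zero by simp
  have "Y = (map (lo w) A @ [a + b]) @ R" using Y by simp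
  moreover have "\<forall>x\<in>set (map (lo w) A @ [a + b]). \<exists>q\<in>set R. x < q"
    using p(7) by (auto simp: R)
  ultimately have "rl Y = (\<lambda>k. k + length (map (lo w) A @ [a + b])) ` rl R" using rl_append by metis
  then show "rl Y = (\<lambda>k. k + (a + 1)) ` rl Y2" using rR p(1) by simp
  have Yp: "Y \<in> perms (Suc (a + b + 1))" unfolding Y_def by (rule ins_perms[OF glue_perms[OF A X w]])
  show "second Y = {a}"
    by (rule second_eq[OF Yp]) (simp_all add: Y p nth_append)
qed

text \<open>The new maximum stands before \<open>F\<close>, yet the suffix is described by
  \<open>ins 0 X\<close>: the old maximum in front of \<open>X\<close> plays the part of a maximum
  inserted at \<open>0\<close>.\<close>

lemma stats_left:
  fixes \<tau> :: bool
  assumes E: "E \<in> perms e" and F: "F \<in> perms f" and X: "X \<in> perms b" and w: "w \<in> words (e + f) b"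
  defines "Y \<equiv> ins e (glue (join \<tau> E F) X w)" and "Y2 \<equiv> ins 0 X"
  shows "des Y = des E \<union> {e} \<union> (\<lambda>k. k + (e + 1)) ` des F \<union> (\<lambda>k. k + (e + f + 1)) ` des Y2"
    and "rl Y = insert e ((\<lambda>k. k + (e + f + 1)) ` rl Y2)"
    and "second Y = {e + f + 1}"
proof -
  let ?A = "join \<tau> E F"
  have A: "?A \<in> perms (e + f)" using join_perms[OF E F] .
  note p = glue_parts[OF A X w]
  have l: "length E = e" "length F = f" "set E = {..<e}" "set F = {..<f}"
    using E F perms_length by (auto simp: perms_def)
  define P where "P = map (lo w) (take e ?A)"
  define Q where "Q = map (lo w) (drop e ?A)"
  define R where "R = map (up w) X"
  have PQ: "map (lo w) ?A = P @ Q" unfolding P_def Q_def by (metis append_take_drop_id map_append)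
  have lP: "length P = e" "length Q = f" using p(1) by (auto simp: P_def Q_def)
  have Y: "Y = P @ (e + f + b + 1) # Q @ (e + f + b) # R"
    unfolding Y_def ins_def glue_def P_def Q_def R_def using p(1,2) by (simp add: take_map drop_map)
  have bd: "\<forall>x\<in>set P. x < e + f + b" "\<forall>x\<in>set Q. x < e + f + b" "\<forall>x\<in>set R. x < e + f + b"
    using p(7,8) unfolding PQ R_def by auto
  have tE: "take e ?A = (if \<tau> then map (\<lambda>x. x + f) E else E)" and dF: "drop e ?A = (if \<tau> then F else map (\<lambda>x. x + e) F)"
    using l by (simp_all add: join_def)
  have sub: "set (take e ?A) \<subseteq> {..<e+f}" "set (drop e ?A) \<subseteq> {..<e+f}"
    using p(3) by (auto dest: in_set_takeD in_set_dropD)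
  have mono: "strict_mono_on S (lo w)" if "S \<subseteq> {..<e+f}" for S
    using lo_mono[OF w] that by (auto simp: strict_mono_on_def)
  have dP: "des P = des E"
    unfolding P_def using des_map[OF mono[OF sub(1)]] tE des_map[OF shift_mono, where xs = E] by simp
  have dQ: "des Q = des F"
    unfolding Q_def using des_map[OF mono[OF sub(2)]] dF des_map[OF shift_mono, where xs = F] by simp
  have dR: "des ((e + f + b) # R) = des Y2"
    unfolding Y2_def ins_0 des_Cons using p(6,8) p(2,4) R_def by (cases X) auto
  have "des Y = des P \<union> (\<lambda>k. k + e) ` des ((e + f + b + 1) # Q @ (e + f + b) # R)"
  proof -
    have "\<forall>x\<in>set P. x < e + f + b + 1" using bd by auto
    then show ?thesis unfolding Y des_append[of P] lP using last_lt_max[of P] by auto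
  qed
  also have "des ((e + f + b + 1) # Q @ (e + f + b) # R) = insert 0 (Suc ` des (Q @ (e + f + b) # R))"
    using bd(2) by (subst des_Cons) (cases Q; auto)
  also have "des (Q @ (e + f + b) # R) = des Q \<union> (\<lambda>k. k + f) ` des ((e + f + b) # R)"
    unfolding des_append[of Q] lP using last_lt_max[OF bd(2)] by auto
  finally show "des Y = des E \<union> {e} \<union> (\<lambda>k. k + (e + 1)) ` des F \<union> (\<lambda>k. k + (e + f + 1)) ` des Y2"
    unfolding dP dQ dR by (simp add: image_Un image_image add_ac Un_assoc)
  have "rl Y = (\<lambda>k. k + e) ` rl ((e + f + b + 1) # Q @ (e + f + b) # R)"
    unfolding Y using bd by (subst rl_append) (auto simp: lP less_Suc_eq)
  also have "rl ((e + f + b + 1) # Q @ (e + f + b) # R) = insert 0 (Suc ` rl (Q @ (e + f + b) # R))"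
    using bd by (intro rl_Cons_max) (auto simp: less_Suc_eq)
  also have "rl (Q @ (e + f + b) # R) = (\<lambda>k. k + f) ` rl ((e + f + b) # R)"
    using bd by (subst rl_append) (auto simp: lP)
  also have "rl ((e + f + b) # R) = rl Y2"
  proof -
    have "rl ((e + f + b) # R) = insert 0 (Suc ` rl R)" using bd by (intro rl_Cons_max)
    moreover have "rl (b # X) = insert 0 (Suc ` rl X)" using p(4) by (intro rl_Cons_max) auto
    moreover have "rl R = rl X" unfolding R_def by (rule rl_map[OF up_mono])
    ultimately show ?thesis unfolding Y2_def ins_0 p(2) by simp
  qed
  finally show "rl Y = insert e ((\<lambda>k. k + (e + f + 1)) ` rl Y2)"
    by (simp add: image_image add_ac)
  have Yp: "Y \<in> perms (Suc (e + f + b + 1))" unfolding Y_def by (rule ins_perms[OF glue_perms[OF A X w]])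
  show "second Y = {e + f + 1}"
    by (rule second_eq[OF Yp]) (simp_all add: Y lP nth_append)
qed

subsection \<open>The recursion for active sites\<close>

text \<open>Codes for the avoiders of length \<open>Suc n\<close>, by \<open>bij_ins\<close>; they
  keep the avoider before the insertion accessible.\<close>

definition sites :: "bool \<Rightarrow> nat \<Rightarrow> (nat list \<times> nat) set" where
  "sites \<tau> n = {(\<pi>, i). \<pi> \<in> av_perms \<tau> n \<and> i \<le> n \<and> av \<tau> (ins i \<pi>)}"

text \<open>The free cuts are those before the insertion, because a maximum inserted into
  \<open>X\<close> takes no part in the interleaving of \<open>X\<close> with a prefix
  \<open>A\<close>.\<close>

definition site_stats :: "bool \<Rightarrow> nat list \<times> nat \<Rightarrow> nat set \<times> nat set \<times> nat set \<times> nat" where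
  "site_stats \<tau> p = (des (ins (snd p) (fst p)), rl (ins (snd p) (fst p)), second (ins (snd p) (fst p)),
     card (free_cuts \<tau> (fst p)))"

text \<open>The induction measure: the number of entries after the insertion that are not
  right-to-left maxima.\<close>

definition num_non_rl :: "nat list \<times> nat \<Rightarrow> nat" where
  "num_non_rl p = Suc (length (fst p)) - card (rl (ins (snd p) (fst p)))"

text \<open>\<open>c\<close> is the contribution of a prefix to the measure. Without subtraction the
  set is simply empty for \<open>c > M\<close>.\<close>

definition sites_with :: "bool \<Rightarrow> nat \<Rightarrow> nat \<Rightarrow> nat \<Rightarrow> (nat list \<times> nat) set" where
  "sites_with \<tau> n c M = {p \<in> sites \<tau> n. c + num_non_rl p = M}"

definition right_sites :: "bool \<Rightarrow> nat \<Rightarrow> nat \<Rightarrow> nat \<Rightarrow> (nat list \<times> nat) set" where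
  "right_sites \<tau> n M a = {p \<in> sites_with \<tau> n 0 M. a < snd p \<and> a < n \<and> Suc (fst p ! a) = n}"

text \<open>\<open>e\<close> entries precede the new maximum and \<open>f\<close> entries separate
  it from the old one.\<close>

definition left_sites :: "bool \<Rightarrow> nat \<Rightarrow> nat \<Rightarrow> nat \<Rightarrow> nat \<Rightarrow> (nat list \<times> nat) set" where
  "left_sites \<tau> n M e f = {p \<in> sites_with \<tau> n 0 M. snd p = e \<and> e + f < n \<and> Suc (fst p ! (e + f)) = n}"

lemma av_permsD_perms: "A \<in> av_perms \<tau> a \<Longrightarrow> A \<in> perms a" and av_permsD_av: "A \<in> av_perms \<tau> a \<Longrightarrow> av \<tau> A"
  by (auto simp: av_perms_def)

lemma av_perms_length: "A \<in> av_perms \<tau> a \<Longrightarrow> length A = a"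
  using av_permsD_perms perms_length by blast

lemma finite_av_perms: "finite (av_perms \<tau> n)"
  unfolding av_perms_def using finite_perms by simp

lemma card_rl_le: "card (rl xs) \<le> length xs"
  using card_mono[OF _ rl_subset[of xs]] by simp

lemma card_rl_ins:
  assumes "\<pi> \<in> perms n" "i \<le> n"
  shows "card (rl (ins i \<pi>)) \<ge> 1"
proof -
  have l: "length \<pi> = n" using assms perms_length by blast
  have "\<forall>x\<in>set (take i \<pi>). x < n" "\<forall>x\<in>set (drop i \<pi>). x < n"
    using assms by (auto simp: perms_def dest: in_set_takeD in_set_dropD)
  then have "i \<in> rl (ins i \<pi>)" unfolding ins_def l
    by (subst rl_append) (use l assms(2) in \<open>auto simp: rl_Cons_max image_iff\<close>)
  then have "card (rl (ins i \<pi>)) \<noteq> 0" by auto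
  then show ?thesis by linarith
qed

lemma glue_nth: "A \<in> perms a \<Longrightarrow> X \<in> perms b \<Longrightarrow> glue A X w ! a = a + b"
  using perms_length by (simp add: glue_def nth_append)

lemma av_perms_glue:
  assumes "A \<in> av_perms \<tau> a" "X \<in> av_perms \<tau> b" "w \<in> weaves \<tau> A X"
  shows "glue A X w \<in> av_perms \<tau> (a + b + 1)" "w \<in> words a b"
proof -
  show w: "w \<in> words a b" using weaves_words av_permsD_perms assms by blast
  show "glue A X w \<in> av_perms \<tau> (a + b + 1)"
    using glue_perms[OF av_permsD_perms[OF assms(1)] av_permsD_perms[OF assms(2)] w]
      av_glue[OF av_permsD_perms[OF assms(1)] av_permsD_perms[OF assms(2)] w] assms by (simp add: av_perms_def)
qed

lemma av_perms_glueE: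
  assumes "\<pi> \<in> av_perms \<tau> (a + b + 1)" "\<pi> ! a = a + b"
  obtains A X w where "A \<in> av_perms \<tau> a" "X \<in> av_perms \<tau> b" "w \<in> weaves \<tau> A X" "\<pi> = glue A X w"
proof -
  obtain A X w where g: "A \<in> perms a" "X \<in> perms b" "w \<in> words a b" "\<pi> = glue A X w"
    using glue_surj[of \<pi> a b] assms by (auto simp: av_perms_def)
  show ?thesis
    by (rule that[of A X w]) (use g av_glue[OF g(1-3), of \<tau>] assms(1) in \<open>simp_all add: av_perms_def\<close>)
qed

abbreviation right_data :: "bool \<Rightarrow> nat \<Rightarrow> nat \<Rightarrow> nat \<Rightarrow> ((nat list \<times> nat list \<times> nat) \<times> nat list) set" where
  "right_data \<tau> a b M \<equiv> SIGMA q : av_perms \<tau> a \<times> sites_with \<tau> b (a + 1) M. weaves \<tau> (fst q) (fst (snd q))"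

definition glue_right :: "(nat list \<times> nat list \<times> nat) \<times> nat list \<Rightarrow> nat list \<times> nat" where
  "glue_right = (\<lambda>((A, X, i), w). (glue A X w, length A + 1 + i))"

text \<open>\<open>A\<close> and the old maximum precede the new maximum, so none of these
  \<open>a + 1\<close> entries is a right-to-left maximum.\<close>

lemma num_non_rl_right:
  assumes "A \<in> perms a" "X \<in> perms b" "w \<in> words a b" "i \<le> b"
  shows "num_non_rl (glue A X w, a + 1 + i) = a + 1 + num_non_rl (X, i)"
proof -
  have "card (rl (ins (a + 1 + i) (glue A X w))) = card (rl (ins i X))"
    unfolding stats_right(2)[OF assms] by (intro card_image) (simp add: inj_on_def)
  moreover have "card (rl (ins i X)) \<le> Suc b"
    using card_rl_le[of "ins i X"] perms_length[OF assms(2)] by simp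
  ultimately show ?thesis using perms_length[OF assms(1)] perms_length[OF assms(2)]
    by (simp add: num_non_rl_def glue_length)
qed

lemma bij_right: "bij_betw glue_right (right_data \<tau> a b M) (right_sites \<tau> (a + b + 1) M a)"
  unfolding bij_betw_def
proof
  show "inj_on glue_right (right_data \<tau> a b M)"
  proof (rule inj_onI)
    fix p q assume *: "p \<in> right_data \<tau> a b M" "q \<in> right_data \<tau> a b M" "glue_right p = glue_right q"
    obtain A X i w A' X' i' w' where pq: "p = ((A,X,i),w)" "q = ((A',X',i'),w')" by (metis surj_pair)
    have m: "A \<in> av_perms \<tau> a" "X \<in> av_perms \<tau> b" "w \<in> weaves \<tau> A X" "A' \<in> av_perms \<tau> a" "X' \<in> av_perms \<tau> b" "w' \<in> weaves \<tau> A' X'"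
      using * by (auto simp: pq sites_with_def sites_def)
    have "glue A X w = glue A' X' w'" "length A + 1 + i = length A' + 1 + i'"
      using *(3) unfolding pq glue_right_def by auto
    then have "A = A' \<and> X = X' \<and> w = w'" "i = i'"
      using glue_inj[of A a X b w A' X' w'] m av_perms_glue(2) av_permsD_perms av_perms_length[OF m(1)] av_perms_length[OF m(4)] by auto
    then show "p = q" using pq by simp
  qed
  show "glue_right ` right_data \<tau> a b M = right_sites \<tau> (a + b + 1) M a"
  proof
    show "glue_right ` right_data \<tau> a b M \<subseteq> right_sites \<tau> (a + b + 1) M a"
    proof
      fix r assume "r \<in> glue_right ` right_data \<tau> a b M"
      then obtain A X i w where r: "r = glue_right ((A,X,i),w)" "((A,X,i),w) \<in> right_data \<tau> a b M" by auto
      then have m: "A \<in> av_perms \<tau> a" "X \<in> av_perms \<tau> b" "w \<in> weaves \<tau> A X" "i \<le> b" "av \<tau> (ins i X)" "a + 1 + num_non_rl (X,i) = M"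
        by (auto simp: sites_with_def sites_def)
      note p = av_permsD_perms[OF m(1)] av_permsD_perms[OF m(2)] av_perms_glue(2)[OF m(1-3)]
      have g: "glue A X w \<in> av_perms \<tau> (a + b + 1)" using av_perms_glue(1)[OF m(1-3)] .
      have "av \<tau> (ins (a + 1 + i) (glue A X w))" using site_right[OF p m(4) av_permsD_av[OF g]] m(5) by simp
      then show "r \<in> right_sites \<tau> (a + b + 1) M a"
        using g m num_non_rl_right[OF p m(4)] glue_nth[OF p(1,2)] perms_length[OF p(1)]
        by (simp add: r right_sites_def sites_with_def sites_def glue_right_def)
    qed
    show "right_sites \<tau> (a + b + 1) M a \<subseteq> glue_right ` right_data \<tau> a b M"
    proof
      fix r assume r: "r \<in> right_sites \<tau> (a + b + 1) M a"
      obtain \<pi> j where rp: "r = (\<pi>, j)" by (cases r)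
      have m: "\<pi> \<in> av_perms \<tau> (a + b + 1)" "j \<le> a + b + 1" "av \<tau> (ins j \<pi>)" "num_non_rl (\<pi>, j) = M" "a < j" "\<pi> ! a = a + b"
        using r by (auto simp: rp right_sites_def sites_with_def sites_def)
      obtain A X w where g: "A \<in> av_perms \<tau> a" "X \<in> av_perms \<tau> b" "w \<in> weaves \<tau> A X" "\<pi> = glue A X w"
        using av_perms_glueE[OF m(1,6)] .
      note p = av_permsD_perms[OF g(1)] av_permsD_perms[OF g(2)] av_perms_glue(2)[OF g(1-3)]
      define i where "i = j - (a + 1)"
      have i: "j = a + 1 + i" "i \<le> b" using m by (auto simp: i_def)
      have "av \<tau> (ins i X)" using site_right[OF p i(2)] m g i av_permsD_av[OF m(1)] by simp
      then have "((A,X,i),w) \<in> right_data \<tau> a b M"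
        using g i m num_non_rl_right[OF p i(2)] by (simp add: sites_with_def sites_def)
      moreover have "r = glue_right ((A,X,i),w)" using rp g i perms_length[OF p(1)] by (simp add: glue_right_def)
      ultimately show "r \<in> glue_right ` right_data \<tau> a b M" by blast
    qed
  qed
qed

abbreviation left_data :: "bool \<Rightarrow> nat \<Rightarrow> nat \<Rightarrow> nat \<Rightarrow> nat \<Rightarrow> (((nat list \<times> nat list) \<times> nat list \<times> nat) \<times> nat list) set" where
  "left_data \<tau> e f b M \<equiv> SIGMA q : (av_perms \<tau> e \<times> av_perms \<tau> f) \<times> {p \<in> sites_with \<tau> b (e + f) M. snd p = 0}.
     weaves \<tau> (join \<tau> (fst (fst q)) (snd (fst q))) (fst (snd q))"

definition glue_left :: "bool \<Rightarrow> ((nat list \<times> nat list) \<times> nat list \<times> nat) \<times> nat list \<Rightarrow> nat list \<times> nat" where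
  "glue_left \<tau> = (\<lambda>(((E, F), X, i), w). (glue (join \<tau> E F) X w, length E))"

text \<open>Here the old maximum remains a right-to-left maximum and counts as the maximum of
  \<open>ins 0 X\<close>; only the entries of \<open>E\<close> and \<open>F\<close> are
  lost.\<close>

lemma num_non_rl_left:
  assumes "E \<in> perms e" "F \<in> perms f" "X \<in> perms b" "w \<in> words (e + f) b"
  shows "num_non_rl (glue (join \<tau> E F) X w, e) = e + f + num_non_rl (X, 0)"
proof -
  have "card (rl (ins e (glue (join \<tau> E F) X w))) = Suc (card ((\<lambda>k. k + (e + f + 1)) ` rl (ins 0 X)))"
    unfolding stats_left(2)[OF assms] by (subst card_insert_disjoint) auto
  also have "card ((\<lambda>k. k + (e + f + 1)) ` rl (ins 0 X)) = card (rl (ins 0 X))"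
    by (intro card_image) (simp add: inj_on_def)
  finally have "card (rl (ins e (glue (join \<tau> E F) X w))) = Suc (card (rl (ins 0 X)))" .
  moreover have "card (rl (ins 0 X)) \<le> Suc b"
    using card_rl_le[of "ins 0 X"] perms_length[OF assms(3)] by simp
  ultimately show ?thesis
    using perms_length[OF assms(1)] perms_length[OF assms(2)] perms_length[OF assms(3)]
    by (simp add: num_non_rl_def glue_length)
qed

lemma av_perms_join: "E \<in> av_perms \<tau> e \<Longrightarrow> F \<in> av_perms \<tau> f \<Longrightarrow> join \<tau> E F \<in> av_perms \<tau> (e + f)"
  using join_perms av_join unfolding av_perms_def by blast

lemma site_0: "xs \<in> perms n \<Longrightarrow> av \<tau> xs \<Longrightarrow> av \<tau> (ins 0 xs)"
  by (simp add: av_ins)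

lemma bij_left: "bij_betw (glue_left \<tau>) (left_data \<tau> e f b M) (left_sites \<tau> (e + f + b + 1) M e f)"
  unfolding bij_betw_def
proof
  show "inj_on (glue_left \<tau>) (left_data \<tau> e f b M)"
  proof (rule inj_onI)
    fix p q assume *: "p \<in> left_data \<tau> e f b M" "q \<in> left_data \<tau> e f b M" "glue_left \<tau> p = glue_left \<tau> q"
    obtain E F X i w E' F' X' i' w' where pq: "p = (((E,F),X,i),w)" "q = (((E',F'),X',i'),w')" by (metis surj_pair)
    have m: "E \<in> av_perms \<tau> e" "F \<in> av_perms \<tau> f" "X \<in> av_perms \<tau> b" "w \<in> weaves \<tau> (join \<tau> E F) X" "i = 0"
      "E' \<in> av_perms \<tau> e" "F' \<in> av_perms \<tau> f" "X' \<in> av_perms \<tau> b" "w' \<in> weaves \<tau> (join \<tau> E' F') X'" "i' = 0"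
      using * by (auto simp: pq sites_with_def sites_def)
    have j: "join \<tau> E F \<in> av_perms \<tau> (e + f)" "join \<tau> E' F' \<in> av_perms \<tau> (e + f)" using av_perms_join m by blast+
    have "glue (join \<tau> E F) X w = glue (join \<tau> E' F') X' w'"
      using *(3) unfolding pq glue_left_def by auto
    then have "join \<tau> E F = join \<tau> E' F' \<and> X = X' \<and> w = w'"
      using glue_inj[of "join \<tau> E F" "e+f" X b w "join \<tau> E' F'" X' w'] m j av_perms_glue(2) av_permsD_perms by auto
    moreover from this have "E = E' \<and> F = F'"
      using join_inj av_perms_length[OF m(1)] av_perms_length[OF m(2)] av_perms_length[OF m(6)] av_perms_length[OF m(7)] by metis
    ultimately show "p = q" using pq m by simp
  qed
  show "glue_left \<tau> ` left_data \<tau> e f b M = left_sites \<tau> (e + f + b + 1) M e f"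
  proof
    show "glue_left \<tau> ` left_data \<tau> e f b M \<subseteq> left_sites \<tau> (e + f + b + 1) M e f"
    proof
      fix r assume "r \<in> glue_left \<tau> ` left_data \<tau> e f b M"
      then obtain E F X i w where r: "r = glue_left \<tau> (((E,F),X,i),w)" "(((E,F),X,i),w) \<in> left_data \<tau> e f b M" by auto
      then have m: "E \<in> av_perms \<tau> e" "F \<in> av_perms \<tau> f" "X \<in> av_perms \<tau> b" "w \<in> weaves \<tau> (join \<tau> E F) X" "e + f + num_non_rl (X,0) = M"
        by (auto simp: sites_with_def sites_def)
      have j: "join \<tau> E F \<in> av_perms \<tau> (e + f)" using av_perms_join m by blast
      note p = av_permsD_perms[OF j] av_permsD_perms[OF m(3)] av_perms_glue(2)[OF j m(3,4)]
      have g: "glue (join \<tau> E F) X w \<in> av_perms \<tau> (e + f + b + 1)" using av_perms_glue(1)[OF j m(3,4)] .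
      have "av \<tau> (ins e (glue (join \<tau> E F) X w))"
        using site_left[OF p _ av_permsD_av[OF g], of e] join_split[OF av_permsD_perms[OF m(1)] av_permsD_perms[OF m(2)]] by simp
      then show "r \<in> left_sites \<tau> (e + f + b + 1) M e f"
        using g m num_non_rl_left[OF av_permsD_perms[OF m(1)] av_permsD_perms[OF m(2)] p(2,3)] glue_nth[OF p(1,2)] av_perms_length[OF m(1)]
        by (simp add: r left_sites_def sites_with_def sites_def glue_left_def)
    qed
    show "left_sites \<tau> (e + f + b + 1) M e f \<subseteq> glue_left \<tau> ` left_data \<tau> e f b M"
    proof
      fix r assume r: "r \<in> left_sites \<tau> (e + f + b + 1) M e f"
      obtain \<pi> where rp: "r = (\<pi>, e)" using r by (cases r) (auto simp: left_sites_def)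
      have m: "\<pi> \<in> av_perms \<tau> (e + f + b + 1)" "av \<tau> (ins e \<pi>)" "num_non_rl (\<pi>, e) = M" "\<pi> ! (e + f) = e + f + b"
        using r by (auto simp: rp left_sites_def sites_with_def sites_def)
      obtain A X w where g: "A \<in> av_perms \<tau> (e + f)" "X \<in> av_perms \<tau> b" "w \<in> weaves \<tau> A X" "\<pi> = glue A X w"
        using av_perms_glueE[OF m(1,4)] .
      note p = av_permsD_perms[OF g(1)] av_permsD_perms[OF g(2)] av_perms_glue(2)[OF g(1-3)]
      have "split_at \<tau> e A" using site_left[OF p, of e \<tau>] m g av_permsD_av[OF m(1)] by simp
      then obtain E F where EF: "E \<in> perms e" "F \<in> perms f" "A = join \<tau> E F"
        using split_at_join[OF p(1)] by blast
      then have EF': "E \<in> av_perms \<tau> e" "F \<in> av_perms \<tau> f" using av_join[OF EF(1,2)] av_permsD_av[OF g(1)] by (auto simp: av_perms_def)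
      have "(((E,F),X,0),w) \<in> left_data \<tau> e f b M"
        using g EF' EF m num_non_rl_left[OF EF(1,2) p(2,3)] site_0[OF p(2) av_permsD_av[OF g(2)]] by (simp add: sites_with_def sites_def)
      moreover have "r = glue_left \<tau> (((E,F),X,0),w)" using rp g EF perms_length[OF EF(1)] by (simp add: glue_left_def)
      ultimately show "r \<in> glue_left \<tau> ` left_data \<tau> e f b M" by blast
    qed
  qed
qed

section \<open>Transfer of equidistribution through the recursion\<close>

definition sites_eqd :: "nat \<Rightarrow> nat \<Rightarrow> bool" where
  "sites_eqd n M \<longleftrightarrow> eqd (site_stats True) (sites_with True n 0 M) (site_stats False) (sites_with False n 0 M)"

definition gaps_eqd :: "nat \<Rightarrow> bool" where
  "gaps_eqd M \<longleftrightarrow> eqd (\<lambda>A. (des A, card (active_gaps True A))) (av_perms True M) (\<lambda>A. (des A, card (active_gaps False A))) (av_perms False M)"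

lemma sites_with_shift: "c \<le> M \<Longrightarrow> sites_with \<tau> n c M = sites_with \<tau> n 0 (M - c)"
  by (auto simp: sites_with_def)

lemma sites_with_eqd:
  assumes "c \<le> M \<Longrightarrow> sites_eqd n (M - c)"
  shows "eqd (site_stats True) (sites_with True n c M) (site_stats False) (sites_with False n c M)"
proof (cases "c \<le> M")
  case True
  then show ?thesis using assms[OF True] unfolding sites_eqd_def sites_with_shift[OF True] by simp
next
  case False
  then have "sites_with \<tau> n c M = {}" for \<tau> by (auto simp: sites_with_def)
  then show ?thesis using eqd_empty by simp
qed

text \<open>Prefixes and suffixes are matched independently of each other, and the interleavings
  over a matched pair by \<open>eqd_weaves\<close>.\<close>

lemma right_sites_eqd:
  assumes "gaps_eqd a" "a + 1 \<le> M \<Longrightarrow> sites_eqd b (M - (a + 1))"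
  shows "eqd (site_stats True) (right_sites True (a + b + 1) M a) (site_stats False) (right_sites False (a + b + 1) M a)"
proof (rule eqd_transport[OF bij_right bij_right])
  let ?u = "\<lambda>\<tau> q. ((des (fst q), card (active_gaps \<tau> (fst q))), site_stats \<tau> (snd q))"
  let ?v = "\<lambda>\<tau> q w. card (free_cuts \<tau> (glue (fst q) (fst (snd q)) w))"
  have 1: "eqd (?u True) (av_perms True a \<times> sites_with True b (a + 1) M) (?u False) (av_perms False a \<times> sites_with False b (a + 1) M)"
    by (rule eqd_comp[OF eqd_Times[OF assms(1)[unfolded gaps_eqd_def] sites_with_eqd[OF assms(2)]], where p = id]) auto
  have 2: "eqd (\<lambda>(q, w). (?u True q, ?v True q w)) (right_data True a b M) (\<lambda>(q, w). (?u False q, ?v False q w)) (right_data False a b M)"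
  proof (rule eqd_Sigma[OF 1])
    fix x y assume x: "x \<in> av_perms True a \<times> sites_with True b (a + 1) M" and y: "y \<in> av_perms False a \<times> sites_with False b (a + 1) M"
      and e: "?u True x = ?u False y"
    show "eqd (?v True x) (weaves True (fst x) (fst (snd x))) (?v False y) (weaves False (fst y) (fst (snd y)))"
    proof (rule eqd_weaves)
      show "fst x \<in> perms a" "fst y \<in> perms a" "fst (snd x) \<in> perms b" "fst (snd y) \<in> perms b"
        using x y by (auto simp: sites_with_def sites_def av_perms_def)
      show "card (active_gaps True (fst x)) = card (active_gaps False (fst y))"
        "card (free_cuts True (fst (snd x))) = card (free_cuts False (fst (snd y)))"
        using e by (auto simp: site_stats_def)
    qed
  qed
  \<comment> \<open>\<open>?\<phi>\<close> is the content of \<open>stats_right\<close>;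
    \<open>l\<close> is the number of free cuts of the glued permutation.\<close>
  let ?\<phi> = "\<lambda>(((dA, cA), (d, r, s, k)), l). (dA \<union> (if 0 \<in> r then {} else {a}) \<union> (\<lambda>k. k + (a + 1)) ` d,
      (\<lambda>k. k + (a + 1)) ` r, {a}, l)"
  have 3: "site_stats \<tau> (glue_right x) = ?\<phi> ((\<lambda>(q, w). (?u \<tau> q, ?v \<tau> q w)) x)" if "x \<in> right_data \<tau> a b M" for x \<tau>
  proof -
    obtain A X i w where x: "x = ((A,X,i),w)" by (metis surj_pair)
    have m: "A \<in> av_perms \<tau> a" "X \<in> av_perms \<tau> b" "w \<in> weaves \<tau> A X" "i \<le> b"
      using that by (auto simp: x sites_with_def sites_def)
    note p = av_permsD_perms[OF m(1)] av_permsD_perms[OF m(2)] av_perms_glue(2)[OF m(1-3)]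
    show ?thesis using stats_right[OF p m(4)] perms_length[OF p(1)] by (simp add: x glue_right_def site_stats_def)
  qed
  show "eqd (\<lambda>x. site_stats True (glue_right x)) (right_data True a b M) (\<lambda>y. site_stats False (glue_right y)) (right_data False a b M)"
    by (rule eqd_comp[OF 2, where p = ?\<phi>]) (rule 3, assumption)+
qed

lemma left_sites_eqd:
  assumes "gaps_eqd e" "gaps_eqd f" "e + f \<le> M \<Longrightarrow> sites_eqd b (M - (e + f))"
  shows "eqd (site_stats True) (left_sites True (e + f + b + 1) M e f) (site_stats False) (left_sites False (e + f + b + 1) M e f)"
proof (rule eqd_transport[OF bij_left bij_left])
  let ?a = "\<lambda>\<tau> A. (des A, card (active_gaps \<tau> A))"
  let ?u = "\<lambda>\<tau> q. ((?a \<tau> (fst (fst q)), ?a \<tau> (snd (fst q))), site_stats \<tau> (snd q))"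
  let ?v = "\<lambda>\<tau> q w. card (free_cuts \<tau> (glue (join \<tau> (fst (fst q)) (snd (fst q))) (fst (snd q)) w))"
  let ?D = "\<lambda>\<tau>. (av_perms \<tau> e \<times> av_perms \<tau> f) \<times> {p \<in> sites_with \<tau> b (e + f) M. snd p = 0}"
  \<comment> \<open>The site \<open>0\<close> is recognised by the right-to-left maxima, so the
    restriction to it respects equidistribution.\<close>
  have z: "snd p = 0 \<longleftrightarrow> 0 \<in> fst (snd (site_stats \<tau> p))" if ps: "p \<in> sites_with \<tau> b (e + f) M" for p \<tau>
  proof -
    obtain X i where p: "p = (X, i)" by (cases p)
    have X: "X \<in> perms b" "i \<le> b" using ps by (auto simp: p sites_with_def sites_def av_perms_def)
    have l: "length X = b" using perms_length X by blast
    have bd: "\<forall>x\<in>set (take i X). x < b" "\<forall>x\<in>set (drop i X). x < b"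
      using X by (auto simp: perms_def dest: in_set_takeD in_set_dropD)
    have "rl (ins i X) = (\<lambda>k. k + i) ` insert 0 (Suc ` rl (drop i X))"
      unfolding ins_def l using bd X l by (subst rl_append) (auto simp: rl_Cons_max)
    then show ?thesis by (auto simp: p site_stats_def)
  qed
  have 0: "eqd (site_stats True) {p \<in> sites_with True b (e + f) M. snd p = 0} (site_stats False) {p \<in> sites_with False b (e + f) M. snd p = 0}"
    by (rule eqd_filter[OF sites_with_eqd[OF assms(3)], where R = "\<lambda>t. 0 \<in> fst (snd t)"]) (auto simp: z)
  have 1: "eqd (?u True) (?D True) (?u False) (?D False)"
    by (rule eqd_comp[OF eqd_Times[OF eqd_Times[OF assms(1)[unfolded gaps_eqd_def] assms(2)[unfolded gaps_eqd_def]] 0], where p = id]) auto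
  have 2: "eqd (\<lambda>(q, w). (?u True q, ?v True q w)) (left_data True e f b M) (\<lambda>(q, w). (?u False q, ?v False q w)) (left_data False e f b M)"
  proof (rule eqd_Sigma[OF 1])
    fix x y assume x: "x \<in> ?D True" and y: "y \<in> ?D False" and eq: "?u True x = ?u False y"
    have px: "fst (fst x) \<in> perms e" "snd (fst x) \<in> perms f" and py: "fst (fst y) \<in> perms e" "snd (fst y) \<in> perms f"
      using x y by (auto simp: av_perms_def)
    show "eqd (?v True x) (weaves True (join True (fst (fst x)) (snd (fst x))) (fst (snd x)))
        (?v False y) (weaves False (join False (fst (fst y)) (snd (fst y))) (fst (snd y)))"
    proof (rule eqd_weaves)
      show "join True (fst (fst x)) (snd (fst x)) \<in> perms (e + f)" "join False (fst (fst y)) (snd (fst y)) \<in> perms (e + f)"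
        using join_perms px py by blast+
      show "fst (snd x) \<in> perms b" "fst (snd y) \<in> perms b"
        using x y by (auto simp: sites_with_def sites_def av_perms_def)
      show "card (active_gaps True (join True (fst (fst x)) (snd (fst x)))) = card (active_gaps False (join False (fst (fst y)) (snd (fst y))))"
        unfolding card_active_gaps_join[OF px] card_active_gaps_join[OF py] using eq by simp
      show "card (free_cuts True (fst (snd x))) = card (free_cuts False (fst (snd y)))"
        using eq by (auto simp: site_stats_def)
    qed
  qed
  let ?\<phi> = "\<lambda>((((dE, cE), (dF, cF)), (d, r, s, k)), l).
      (dE \<union> {e} \<union> (\<lambda>k. k + (e + 1)) ` dF \<union> (\<lambda>k. k + (e + f + 1)) ` d,
      insert e ((\<lambda>k. k + (e + f + 1)) ` r), {e + f + 1}, l)"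
  have 3: "site_stats \<tau> (glue_left \<tau> x) = ?\<phi> ((\<lambda>(q, w). (?u \<tau> q, ?v \<tau> q w)) x)" if "x \<in> left_data \<tau> e f b M" for x \<tau>
  proof -
    obtain E F X i w where x: "x = (((E,F),X,i),w)" by (metis surj_pair)
    have m: "E \<in> av_perms \<tau> e" "F \<in> av_perms \<tau> f" "X \<in> av_perms \<tau> b" "w \<in> weaves \<tau> (join \<tau> E F) X" "i = 0"
      using that by (auto simp: x sites_with_def sites_def)
    note p = av_permsD_perms[OF m(1)] av_permsD_perms[OF m(2)] av_permsD_perms[OF m(3)] av_perms_glue(2)[OF av_perms_join[OF m(1,2)] m(3,4)]
    show ?thesis using stats_left[OF p] perms_length[OF p(1)] m(5) by (simp add: x glue_left_def site_stats_def)
  qed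
  show "eqd (\<lambda>x. site_stats True (glue_left True x)) (left_data True e f b M) (\<lambda>y. site_stats False (glue_left False y)) (left_data False e f b M)"
    by (rule eqd_comp[OF 2, where p = ?\<phi>]) (rule 3, assumption)+
qed

lemma perm_pos:
  assumes "\<pi> \<in> perms n" "n > 0"
  shows "\<exists>a<n. Suc (\<pi> ! a) = n" and "a < n \<Longrightarrow> a' < n \<Longrightarrow> Suc (\<pi> ! a) = n \<Longrightarrow> Suc (\<pi> ! a') = n \<Longrightarrow> a = a'"
proof -
  have l: "length \<pi> = n" "distinct \<pi>" "set \<pi> = {..<n}" using assms perms_length by (auto simp: perms_def)
  have "n - 1 \<in> set \<pi>" using l assms by simp
  then show "\<exists>a<n. Suc (\<pi> ! a) = n" using l(1) assms(2) by (auto simp: in_set_conv_nth)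
  show "a < n \<Longrightarrow> a' < n \<Longrightarrow> Suc (\<pi> ! a) = n \<Longrightarrow> Suc (\<pi> ! a') = n \<Longrightarrow> a = a'"
    using nth_eq_iff_index_eq[OF l(2)] l(1) by (metis Suc_inject)
qed

text \<open>Sites are classified by the place of the old maximum relative to the new one. The
  entries of a prefix are never right-to-left maxima, so a nonempty class has prefixes of length at
  most \<open>M\<close>, while its suffixes are shorter than \<open>n\<close>. The left class with
  \<open>e = M\<close> and \<open>f = 0\<close> is why \<open>gaps_eqd M\<close> itself is among the
  premises.\<close>

lemma sites_eqd_step:
  assumes "\<And>m. m \<le> M \<Longrightarrow> gaps_eqd m" "\<And>b m. b < n \<Longrightarrow> m \<le> M \<Longrightarrow> sites_eqd b m" "n > 0"
  shows "sites_eqd n M"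
proof -
  define C where "C \<tau> x = (case x of Inl a \<Rightarrow> right_sites \<tau> n M a | Inr (e, f) \<Rightarrow> left_sites \<tau> n M e f)" for \<tau> and x :: "nat + nat \<times> nat"
  let ?I = "Inl ` {..<n} \<union> Inr ` {(e, f). e + f < n}"
  have cover: "sites_with \<tau> n 0 M = (\<Union>x\<in>?I. C \<tau> x)" for \<tau>
  proof (intro set_eqI iffI)
    fix p assume p: "p \<in> sites_with \<tau> n 0 M"
    obtain \<pi> i where pp: "p = (\<pi>, i)" by (cases p)
    have "\<pi> \<in> perms n" using p by (auto simp: pp sites_with_def sites_def av_perms_def)
    then obtain a where a: "a < n" "Suc (\<pi> ! a) = n" using perm_pos(1) assms(3) by blast
    show "p \<in> (\<Union>x\<in>?I. C \<tau> x)"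
    proof (cases "a < i")
      case True
      then have "p \<in> C \<tau> (Inl a)" using p a by (simp add: C_def pp right_sites_def)
      then show ?thesis using a by blast
    next
      case False
      then have "p \<in> C \<tau> (Inr (i, a - i))" using p a by (simp add: C_def pp left_sites_def)
      moreover have "Inr (i, a - i) \<in> ?I" using a False by auto
      ultimately show ?thesis by blast
    qed
  qed (auto simp: C_def right_sites_def left_sites_def)
  have disj: "disjoint_family_on (C \<tau>) ?I" for \<tau>
  proof -
    have "x = y" if "p \<in> C \<tau> x" "p \<in> C \<tau> y" for p x y
    proof -
      obtain \<pi> i where pp: "p = (\<pi>, i)" by (cases p)
      have "\<pi> \<in> perms n" using that(1) by (auto simp: pp C_def right_sites_def left_sites_def sites_with_def sites_def av_perms_def split: sum.splits)
      note u = perm_pos(2)[OF this assms(3)]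
      define loc where "loc z = (case z of Inl a \<Rightarrow> a | Inr (e, f) \<Rightarrow> e + f)" for z :: "nat + nat \<times> nat"
      have C: "loc z < n \<and> Suc (\<pi> ! loc z) = n \<and> (case z of Inl a \<Rightarrow> a < i | Inr (e, f) \<Rightarrow> i = e)"
        if "p \<in> C \<tau> z" for z
        using that unfolding C_def pp right_sites_def left_sites_def loc_def by (auto split: sum.splits)
      have "loc x = loc y" using u C[OF that(1)] C[OF that(2)] by blast
      then show ?thesis using C[OF that(1)] C[OF that(2)] by (auto simp: loc_def split: sum.splits prod.splits)
    qed
    then show ?thesis unfolding disjoint_family_on_def by blast
  qed
  have "eqd (site_stats True) (C True x) (site_stats False) (C False x)" if x: "x \<in> ?I" for x
  proof (cases x)
    case (Inl a)
    then have "a < n" using x by auto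
    then obtain b where b: "n = a + b + 1" using less_imp_Suc_add by auto
    show ?thesis
    proof (cases "a \<le> M")
      case True
      then show ?thesis using right_sites_eqd[of a M b] assms(1,2) b by (simp add: C_def Inl)
    next
      case False
      have "right_sites \<tau> n M a = {}" for \<tau>
      proof -
        have "right_data \<tau> a b M = {}" using False by (auto simp: sites_with_def)
        then show ?thesis using bij_right[of \<tau> a b M] b unfolding bij_betw_def by simp
      qed
      then show ?thesis by (simp add: C_def Inl eqd_empty)
    qed
  next
    case (Inr y)
    obtain e f where y: "y = (e, f)" by (cases y)
    then have "e + f < n" using x Inr by auto
    then obtain b where b: "n = e + f + b + 1" using less_imp_Suc_add by auto
    show ?thesis
    proof (cases "e + f \<le> M")
      case True
      then show ?thesis using left_sites_eqd[of e f M b] assms(1,2) b by (simp add: C_def Inr y)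
    next
      case False
      have "left_sites \<tau> n M e f = {}" for \<tau>
      proof -
        have "left_data \<tau> e f b M = {}" using False by (auto simp: sites_with_def)
        then show ?thesis using bij_left[of \<tau> e f b M] b unfolding bij_betw_def by simp
      qed
      then show ?thesis by (simp add: C_def Inr y eqd_empty)
    qed
  qed
  then show ?thesis unfolding sites_eqd_def cover by (intro eqd_UN disj)
qed

lemma av_short: "length xs < 4 \<Longrightarrow> av \<tau> xs"
  by (simp add: av_def)

lemma av_perms_0: "av_perms \<tau> 0 = {[]}"
  by (auto simp: av_perms_def perms_def av_short)

lemma bij_ins: "bij_betw (\<lambda>p. ins (snd p) (fst p)) (sites \<tau> n) (av_perms \<tau> (Suc n))"
  unfolding bij_betw_def
proof
  have tw: "takeWhile (\<lambda>x. x \<noteq> n) (ins i \<pi>) = take i \<pi>" "dropWhile (\<lambda>x. x \<noteq> n) (ins i \<pi>) = n # drop i \<pi>"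
    if "\<pi> \<in> perms n" for i \<pi>
  proof -
    have l: "length \<pi> = n" using that perms_length by blast
    have "\<forall>x\<in>set (take i \<pi>). x \<noteq> n" using that by (auto simp: perms_def dest: in_set_takeD)
    then show "takeWhile (\<lambda>x. x \<noteq> n) (ins i \<pi>) = take i \<pi>" "dropWhile (\<lambda>x. x \<noteq> n) (ins i \<pi>) = n # drop i \<pi>"
      unfolding ins_def l by (simp_all add: takeWhile_append2 dropWhile_append2)
  qed
  show "inj_on (\<lambda>p. ins (snd p) (fst p)) (sites \<tau> n)"
  proof (rule inj_onI)
    fix p q assume *: "p \<in> sites \<tau> n" "q \<in> sites \<tau> n" "ins (snd p) (fst p) = ins (snd q) (fst q)"
    obtain \<pi> i \<pi>' i' where pq: "p = (\<pi>, i)" "q = (\<pi>', i')" by (metis surj_pair)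
    have P: "\<pi> \<in> perms n" "\<pi>' \<in> perms n" "i \<le> n" "i' \<le> n" using * by (auto simp: pq sites_def av_perms_def)
    have e: "ins i \<pi> = ins i' \<pi>'" using *(3) pq by simp
    have t: "take i \<pi> = take i' \<pi>'" "drop i \<pi> = drop i' \<pi>'"
      using tw[OF P(1), of i] tw[OF P(2), of i'] unfolding e by simp_all
    have "i = i'" using arg_cong[OF t(1), of length] P perms_length by simp
    moreover have "\<pi> = \<pi>'" using t by (metis append_take_drop_id)
    ultimately show "p = q" using pq by simp
  qed
  show "(\<lambda>p. ins (snd p) (fst p)) ` sites \<tau> n = av_perms \<tau> (Suc n)"
  proof
    show "(\<lambda>p. ins (snd p) (fst p)) ` sites \<tau> n \<subseteq> av_perms \<tau> (Suc n)"
      using ins_perms by (auto simp: sites_def av_perms_def)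
    show "av_perms \<tau> (Suc n) \<subseteq> (\<lambda>p. ins (snd p) (fst p)) ` sites \<tau> n"
    proof
      fix Y assume Y: "Y \<in> av_perms \<tau> (Suc n)"
      have s: "set Y = {..<Suc n}" "distinct Y" "length Y = Suc n" "av \<tau> Y"
        using Y perms_length by (auto simp: av_perms_def perms_def)
      then obtain P Q where PQ: "Y = P @ n # Q" using split_list[of n Y] by auto
      have d: "distinct (P @ Q)" "n \<notin> set (P @ Q)" "length (P @ Q) = n" using s(2,3) unfolding PQ by auto
      have "set (P @ Q) = {..<Suc n} - {n}" using d(2) s(1) unfolding PQ by auto
      also have "\<dots> = {..<n}" by auto
      finally have \<pi>: "P @ Q \<in> perms n" using d by (simp add: perms_def)
      have "subseq (P @ Q) Y" unfolding PQ subseq_append' by (simp add: list_emb_Cons)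
      then have "av \<tau> (P @ Q)" using av_subseq s(4) by blast
      moreover have "Y = ins (length P) (P @ Q)" unfolding ins_def d(3) PQ by simp
      ultimately have "(P @ Q, length P) \<in> sites \<tau> n" "Y = ins (length P) (P @ Q)"
        using \<pi> s(4) d(3) by (auto simp: sites_def av_perms_def)
      then show "Y \<in> (\<lambda>p. ins (snd p) (fst p)) ` sites \<tau> n" by force
    qed
  qed
qed

section \<open>Avoiders with a decreasing run after the maximum\<close>

definition dec :: "nat \<Rightarrow> nat list" where "dec b = rev [0..<b]"

lemma dec_perms: "dec b \<in> perms b"
  by (auto simp: dec_def perms_def)

lemma dec_subseq: "subseq [c,d] (dec b) \<Longrightarrow> d < c"
proof (induction b)
  case (Suc b)
  have D: "dec (Suc b) = b # dec b" by (simp add: dec_def)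
  have s: "set (dec b) = {..<b}" using dec_perms[of b] unfolding perms_def by blast
  have "subseq [c,d] (dec b) \<or> c = b \<and> d \<in> {..<b}"
    using Suc.prems unfolding D subseq_Cons_iff subseq_singleton_left s .
  then show ?case using Suc.IH by blast
qed (simp add: dec_def)

lemma dec_av_perms: "dec b \<in> av_perms \<tau> b"
proof -
  have "\<not> pat \<tau> x y c d" if "subseq [x,y,c,d] (dec b)" for x y c d
  proof -
    have "d < c" using dec_subseq[OF subseq_Cons'[OF subseq_Cons'[OF that]]] .
    then show ?thesis by (auto simp: pat_def)
  qed
  then show ?thesis using dec_perms by (auto simp: av_perms_def av_def)
qed

text \<open>There is no ascent to kill a cut, so the length of the run makes the number of free cuts
  a free parameter.\<close>

lemma free_cuts_dec: "free_cuts \<tau> (dec b) = {..b}"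
proof -
  have "\<not> kills_cut \<tau> y z j" if "subseq [y,z] (dec b)" for y z j
    using dec_subseq[OF that] by (auto simp: kills_cut_def)
  then show ?thesis using perms_length[OF dec_perms] by (auto simp: free_cuts_def)
qed

text \<open>Lets a decreasing suffix be recognised by \<open>rl\<close>, which the recursion
  controls.\<close>

lemma rl_full_iff:
  assumes "X \<in> perms b"
  shows "rl X = {..<b} \<longleftrightarrow> X = dec b"
proof
  have l: "length X = b" using assms perms_length by blast
  assume r: "rl X = {..<b}"
  have "sorted_wrt (>) X" unfolding sorted_wrt_iff_nth_less
  proof (intro allI impI)
    fix i j assume ij: "i < j" "j < length X"
    then have "i \<in> rl X" using r l by simp
    then show "X ! j < X ! i" using ij by (simp add: rl_def)
  qed
  then have "sorted_wrt (<) (rev X)" by (simp add: sorted_wrt_rev)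
  then have "sorted (rev X)" "distinct (rev X)" by (simp_all add: strict_sorted_iff)
  moreover have "set (rev X) = set [0..<b]"
    using assms unfolding perms_def set_rev set_upt lessThan_atLeast0 by blast
  ultimately have "rev X = [0..<b]" by (intro sorted_distinct_set_unique) auto
  then show "X = dec b" by (metis dec_def rev_rev_ident)
next
  assume "X = dec b"
  then show "rl X = {..<b}" by (auto simp: dec_def rl_def rev_nth)
qed

lemma rl_ins_0: "X \<in> perms b \<Longrightarrow> rl (ins 0 X) = insert 0 (Suc ` rl X)"
  unfolding ins_0 using perms_length by (intro rl_Cons_max) (auto simp: perms_def)

lemma shift_full_iff:
  assumes "R \<subseteq> {..<b}"
  shows "insert M ((\<lambda>k. k + Suc M) ` R) = {M..<Suc (M + b)} \<longleftrightarrow> R = {..<b}"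
proof
  assume e: "insert M ((\<lambda>k. k + Suc M) ` R) = {M..<Suc (M + b)}"
  have "k \<in> R" if "k < b" for k
  proof -
    have "k + Suc M \<in> insert M ((\<lambda>k. k + Suc M) ` R)" unfolding e using that by simp
    then show ?thesis by auto
  qed
  then show "R = {..<b}" using assms by auto
next
  assume R: "R = {..<b}"
  have "x \<in> insert M ((\<lambda>k. k + Suc M) ` R)" if "x \<in> {M..<Suc (M + b)}" for x
  proof (cases "x = M")
    case False
    then have "x = (x - Suc M) + Suc M" "x - Suc M \<in> R" using that R by auto
    then show ?thesis by blast
  qed simp
  moreover have "insert M ((\<lambda>k. k + Suc M) ` R) \<subseteq> {M..<Suc (M + b)}" using R by auto
  ultimately show "insert M ((\<lambda>k. k + Suc M) ` R) = {M..<Suc (M + b)}" by blast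
qed

text \<open>Codes \<open>(A, w)\<close> for the avoiders \<open>A n D\<close> with \<open>A\<close>
  of length \<open>M\<close> and \<open>D\<close> decreasing of length \<open>k\<close>.\<close>

definition dec_weaves :: "bool \<Rightarrow> nat \<Rightarrow> nat \<Rightarrow> (nat list \<times> nat list) set" where
  "dec_weaves \<tau> M k = (SIGMA A : av_perms \<tau> M. weaves \<tau> A (dec k))"

text \<open>Avoiders of the same shape, of length \<open>Suc n\<close>, coded as sites so that the
  recursion applies: \<open>rl\<close> is this interval when the maximum stands at \<open>M\<close>
  and a decreasing run follows.\<close>

definition dec_sites :: "bool \<Rightarrow> nat \<Rightarrow> nat \<Rightarrow> (nat list \<times> nat) set" where
  "dec_sites \<tau> M n = {p \<in> sites \<tau> n. rl (ins (snd p) (fst p)) = {M..<Suc n}}"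

text \<open>Recovers the descents of the prefix \<open>A\<close> from those of the whole
  permutation, by \<open>stats_glue\<close>.\<close>

definition des_below :: "nat \<Rightarrow> nat list \<Rightarrow> nat set" where
  "des_below M Y = {i \<in> des Y. Suc i < M}"

lemma stats_glue:
  assumes "A \<in> perms a" "X \<in> perms b" "w \<in> words a b"
  shows "rl (glue A X w) = insert a ((\<lambda>k. k + Suc a) ` rl X)" "des_below a (glue A X w) = des A"
proof -
  note p = glue_parts[OF assms]
  have rX: "rl (map (up w) X) = rl X" by (rule rl_map[OF up_mono])
  have "rl (glue A X w) = (\<lambda>k. k + a) ` rl ((a + b) # map (up w) X)"
    unfolding glue_def p(1,2) using p by (subst rl_append) auto
  also have "rl ((a + b) # map (up w) X) = insert 0 (Suc ` rl X)"
    unfolding rl_Cons_max[OF p(8)] rX ..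
  finally show "rl (glue A X w) = insert a ((\<lambda>k. k + Suc a) ` rl X)" by (simp add: image_image)
  have "des (glue A X w) = des A \<union> (\<lambda>k. k + a) ` des ((a + b) # map (up w) X)"
    unfolding glue_def p(1,2) des_append using p last_lt_max[OF p(7)] by auto
  moreover have "Suc i < a" if "i \<in> des A" for i using that p(1) by (auto simp: des_def)
  ultimately show "des_below a (glue A X w) = des A" unfolding des_below_def by auto
qed

lemma bij_dec_weaves_av_perms: "bij_betw (\<lambda>(A, w). glue A (dec k) w) (dec_weaves \<tau> M k) {Y \<in> av_perms \<tau> (M + k + 1). rl Y = {M..<Suc (M + k)}}"
  unfolding bij_betw_def
proof
  show "inj_on (\<lambda>(A, w). glue A (dec k) w) (dec_weaves \<tau> M k)"
  proof (rule inj_onI)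
    fix p q assume *: "p \<in> dec_weaves \<tau> M k" "q \<in> dec_weaves \<tau> M k" "(\<lambda>(A, w). glue A (dec k) w) p = (\<lambda>(A, w). glue A (dec k) w) q"
    obtain A w A' w' where pq: "p = (A, w)" "q = (A', w')" by (metis surj_pair)
    have m: "A \<in> av_perms \<tau> M" "A' \<in> av_perms \<tau> M" "w \<in> weaves \<tau> A (dec k)" "w' \<in> weaves \<tau> A' (dec k)" using * by (auto simp: pq dec_weaves_def)
    show "p = q" using glue_inj[of A M "dec k" k w A' "dec k" w'] *(3) m av_permsD_perms dec_perms av_perms_glue(2)[OF _ dec_av_perms] pq by auto
  qed
  show "(\<lambda>(A, w). glue A (dec k) w) ` dec_weaves \<tau> M k = {Y \<in> av_perms \<tau> (M + k + 1). rl Y = {M..<Suc (M + k)}}"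
  proof
    show "(\<lambda>(A, w). glue A (dec k) w) ` dec_weaves \<tau> M k \<subseteq> {Y \<in> av_perms \<tau> (M + k + 1). rl Y = {M..<Suc (M + k)}}"
    proof clarify
      fix A w assume "(A, w) \<in> dec_weaves \<tau> M k"
      then have m: "A \<in> av_perms \<tau> M" "w \<in> weaves \<tau> A (dec k)" by (auto simp: dec_weaves_def)
      have "rl (glue A (dec k) w) = {M..<Suc (M + k)}"
        unfolding stats_glue(1)[OF av_permsD_perms[OF m(1)] dec_perms av_perms_glue(2)[OF m(1) dec_av_perms m(2)]]
        using shift_full_iff[of "rl (dec k)" k M] rl_full_iff[OF dec_perms, of k] by simp
      then show "glue A (dec k) w \<in> av_perms \<tau> (M + k + 1) \<and> rl (glue A (dec k) w) = {M..<Suc (M + k)}"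
        using av_perms_glue(1)[OF m(1) dec_av_perms m(2)] by blast
    qed
    show "{Y \<in> av_perms \<tau> (M + k + 1). rl Y = {M..<Suc (M + k)}} \<subseteq> (\<lambda>(A, w). glue A (dec k) w) ` dec_weaves \<tau> M k"
    proof clarify
      fix Y assume Y: "Y \<in> av_perms \<tau> (M + k + 1)" "rl Y = {M..<Suc (M + k)}"
      have Yp: "Y \<in> perms (M + k + 1)" using Y av_permsD_perms by blast
      obtain a where a: "a < M + k + 1" "Suc (Y ! a) = M + k + 1" using perm_pos(1)[OF Yp] by auto
      obtain b where b: "M + k + 1 = a + b + 1" using less_imp_Suc_add[OF a(1)] by auto
      obtain A X w where g: "A \<in> av_perms \<tau> a" "X \<in> av_perms \<tau> b" "w \<in> weaves \<tau> A X" "Y = glue A X w"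
        using av_perms_glueE[of Y \<tau> a b] Y(1) a b by auto
      note p = av_permsD_perms[OF g(1)] av_permsD_perms[OF g(2)] av_perms_glue(2)[OF g(1-3)]
      have r: "insert a ((\<lambda>k. k + Suc a) ` rl X) = {M..<Suc (M + k)}"
        using stats_glue(1)[OF p] Y(2) g(4) by simp
      \<comment> \<open>The least elements of the two sides of \<open>r\<close> are
        compared.\<close>
      have "a = M"
      proof -
        have "a \<in> {M..<Suc (M + k)}" using r by blast
        moreover have "M \<in> insert a ((\<lambda>k. k + Suc a) ` rl X)" unfolding r by simp
        ultimately show ?thesis by auto
      qed
      moreover from this have "b = k" using b by simp
      ultimately have "rl X = {..<k}" using r shift_full_iff[of "rl X" k M] rl_subset[of X] perms_length[OF p(2)] by simp
      then have "X = dec k" using rl_full_iff p(2) \<open>b = k\<close> by blast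
      then have "(A, w) \<in> dec_weaves \<tau> M k" "Y = (\<lambda>(A, w). glue A (dec k) w) (A, w)" using g \<open>a = M\<close> by (auto simp: dec_weaves_def)
      then show "Y \<in> (\<lambda>(A, w). glue A (dec k) w) ` dec_weaves \<tau> M k" by blast
    qed
  qed
qed

lemma bij_dec_sites: "bij_betw (\<lambda>p. ins (snd p) (fst p)) (dec_sites \<tau> M n) {Y \<in> av_perms \<tau> (Suc n). rl Y = {M..<Suc n}}"
  using bij_ins[of \<tau> n] unfolding bij_betw_def dec_sites_def inj_on_def by auto

text \<open>Two codings of the avoiders with a run of length \<open>Suc k\<close>; in the second one
  the maximum has been removed, hence \<open>M + k + 1\<close>.\<close>

lemma dec_weaves_dec_sites: "eqd (\<lambda>(A, w). des A) (dec_weaves \<tau> M (Suc k)) (\<lambda>p. des_below M (ins (snd p) (fst p))) (dec_sites \<tau> M (M + k + 1))"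
proof -
  have 1: "eqd (\<lambda>(A, w). des A) (dec_weaves \<tau> M (Suc k)) (des_below M) {Y \<in> av_perms \<tau> (M + Suc k + 1). rl Y = {M..<Suc (M + Suc k)}}"
  proof (rule eqd_bij[OF bij_dec_weaves_av_perms])
    fix x assume x: "x \<in> dec_weaves \<tau> M (Suc k)"
    obtain A w where xx: "x = (A, w)" by (cases x)
    have m: "A \<in> av_perms \<tau> M" "w \<in> weaves \<tau> A (dec (Suc k))" using x by (auto simp: xx dec_weaves_def)
    show "des_below M (case x of (A, w) \<Rightarrow> glue A (dec (Suc k)) w) = (case x of (A, w) \<Rightarrow> des A)"
      using stats_glue(2)[OF av_permsD_perms[OF m(1)] dec_perms av_perms_glue(2)[OF m(1) dec_av_perms m(2)]] by (simp add: xx)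
  qed
  have 2: "eqd (\<lambda>p. des_below M (ins (snd p) (fst p))) (dec_sites \<tau> M (M + k + 1)) (des_below M) {Y \<in> av_perms \<tau> (M + Suc k + 1). rl Y = {M..<Suc (M + Suc k)}}"
    using eqd_bij[OF bij_dec_sites[of \<tau> M "M + k + 1"], where f = "\<lambda>p. des_below M (ins (snd p) (fst p))" and g = "des_below M"]
    by simp
  show ?thesis using eqd_trans[OF 1 eqd_sym[OF 2]] .
qed

text \<open>If the second largest value stands right of the maximum, it follows it immediately and can be
  removed; this lowers the length of the decreasing suffix by one.\<close>

lemma dec_sites_split:
  "dec_sites \<tau> M (M + k + 1) = (\<Union>a\<in>{..<M}. {p \<in> right_sites \<tau> (M + k + 1) M a. rl (ins (snd p) (fst p)) = {M..<M + k + 2}})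
    \<union> {p \<in> left_sites \<tau> (M + k + 1) M M 0. rl (ins (snd p) (fst p)) = {M..<M + k + 2}}" (is "_ = ?R")
proof (intro set_eqI iffI)
  fix p assume p: "p \<in> dec_sites \<tau> M (M + k + 1)"
  let ?n = "M + k + 1"
  obtain \<pi> i where pp: "p = (\<pi>, i)" by (cases p)
  have s: "(\<pi>, i) \<in> sites \<tau> ?n" and r: "rl (ins i \<pi>) = {M..<M + k + 2}"
    using p by (auto simp: pp dec_sites_def)
  have \<pi>: "\<pi> \<in> perms ?n" "i \<le> ?n" "av \<tau> \<pi>" "av \<tau> (ins i \<pi>)" using s by (auto simp: sites_def av_perms_def)
  have l: "length \<pi> = ?n" using perms_length \<pi> by blast
  have "num_non_rl p = M" using r l by (simp add: pp num_non_rl_def)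
  then have sc: "p \<in> sites_with \<tau> ?n 0 M" using s by (simp add: pp sites_with_def)
  have bd: "\<forall>x\<in>set (take i \<pi>). x < ?n" "\<forall>x\<in>set (drop i \<pi>). x < ?n"
    using \<pi> by (auto simp: perms_def dest: in_set_takeD in_set_dropD)
  have rr: "rl (ins i \<pi>) = (\<lambda>k. k + i) ` insert 0 (Suc ` rl (drop i \<pi>))"
    unfolding ins_def l using bd \<pi> l by (subst rl_append) (auto simp: rl_Cons_max)
  have i: "i = M"
  proof -
    have "i \<in> rl (ins i \<pi>)" unfolding rr by auto
    moreover have "M \<in> rl (ins i \<pi>)" using r by simp
    then have "i \<le> M" unfolding rr by auto
    ultimately show ?thesis using r by simp
  qed
  obtain a where a: "a < ?n" "Suc (\<pi> ! a) = ?n" using perm_pos(1)[OF \<pi>(1)] by auto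
  show "p \<in> ?R"
  proof (cases "a < M")
    case True
    then have "p \<in> right_sites \<tau> ?n M a" using sc a i by (simp add: pp right_sites_def)
    then show ?thesis using True r by (auto simp: pp)
  next
    case False
    have "p \<in> left_sites \<tau> ?n M M (a - M)" using sc a i False by (simp add: pp left_sites_def)
    \<comment> \<open>After the insertion the old maximum stands at \<open>a + 1\<close> and is the
      next right-to-left maximum after \<open>M\<close>; as \<open>rl\<close> is an interval, this
      is \<open>Suc M\<close>.\<close>
    moreover have "a = M"
    proof -
      obtain b where b: "?n = M + (a - M) + b + 1" using less_imp_Suc_add[OF a(1)] False by auto
      have "left_sites \<tau> ?n M M (a - M) = glue_left \<tau> ` left_data \<tau> M (a - M) b M"
        using bij_left[of \<tau> M "a - M" b M] unfolding b[symmetric] by (simp add: bij_betw_def)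
      then obtain E F X w where q: "(((E,F),X,0),w) \<in> left_data \<tau> M (a - M) b M" "p = glue_left \<tau> (((E,F),X,0),w)"
        using \<open>p \<in> left_sites \<tau> ?n M M (a - M)\<close> by auto
      then have m: "E \<in> av_perms \<tau> M" "F \<in> av_perms \<tau> (a - M)" "X \<in> av_perms \<tau> b" "w \<in> weaves \<tau> (join \<tau> E F) X"
        by (auto simp: sites_with_def sites_def)
      note P = av_permsD_perms[OF m(1)] av_permsD_perms[OF m(2)] av_permsD_perms[OF m(3)] av_perms_glue(2)[OF av_perms_join[OF m(1,2)] m(3,4)]
      have "rl (ins M \<pi>) = insert M ((\<lambda>k. k + (M + (a - M) + 1)) ` rl (ins 0 X))"
        using stats_left(2)[OF P] q(2) i perms_length[OF P(1)] by (simp add: pp glue_left_def)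
      moreover have "Suc M \<in> rl (ins M \<pi>)" using r i by simp
      ultimately have "Suc M \<in> insert M ((\<lambda>k. k + (M + (a - M) + 1)) ` rl (ins 0 X))" by simp
      then show ?thesis using False by auto
    qed
    ultimately show ?thesis using r by (simp add: pp)
  qed
next
  fix p assume "p \<in> ?R" then show "p \<in> dec_sites \<tau> M (M + k + 1)"
    by (auto simp: dec_sites_def right_sites_def left_sites_def sites_with_def)
qed

lemma bij_dec_weaves_left_sites:
  "bij_betw (\<lambda>(A, w). (glue A (dec k) w, M)) (dec_weaves \<tau> M k)
    {p \<in> left_sites \<tau> (M + k + 1) M M 0. rl (ins (snd p) (fst p)) = {M..<M + k + 2}}" (is "bij_betw ?f _ ?T")
  unfolding bij_betw_def
proof
  show "inj_on ?f (dec_weaves \<tau> M k)"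
    using bij_betw_imp_inj_on[OF bij_dec_weaves_av_perms[of k \<tau> M]] unfolding inj_on_def by fastforce
  have R: "rl (ins M (glue A X w)) = {M..<M + k + 2} \<longleftrightarrow> X = dec k" if "A \<in> perms M" "X \<in> perms k" "w \<in> words M k" for A X w
  proof -
    have "[] \<in> perms 0" by (simp add: perms_def)
    \<comment> \<open>Joining with an empty second summand changes nothing, so the flag
      \<open>True\<close> may stand for either pattern.\<close>
    from stats_left(2)[OF that(1) this that(2), of w True]
    have "rl (ins M (glue A X w)) = insert M ((\<lambda>k. k + Suc M) ` insert 0 (Suc ` rl X))"
      using that(3) rl_ins_0[OF that(2)] by simp
    moreover have "insert 0 (Suc ` rl X) = {..<Suc k} \<longleftrightarrow> rl X = {..<k}"
      unfolding lessThan_Suc_eq_insert_0 by (auto simp: set_eq_iff image_iff)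
    moreover have "insert 0 (Suc ` rl X) \<subseteq> {..<Suc k}" using rl_subset[of X] perms_length[OF that(2)] by auto
    ultimately show ?thesis using shift_full_iff[of "insert 0 (Suc ` rl X)" "Suc k" M] rl_full_iff[OF that(2)] by simp
  qed
  show "?f ` dec_weaves \<tau> M k = ?T"
  proof
    show "?f ` dec_weaves \<tau> M k \<subseteq> ?T"
    proof clarify
      fix A w assume "(A, w) \<in> dec_weaves \<tau> M k"
      then have m: "A \<in> av_perms \<tau> M" "w \<in> weaves \<tau> A (dec k)" by (auto simp: dec_weaves_def)
      note p = av_permsD_perms[OF m(1)] dec_perms[of k] av_perms_glue(2)[OF m(1) dec_av_perms m(2)]
      have g: "glue A (dec k) w \<in> av_perms \<tau> (M + k + 1)" using av_perms_glue(1)[OF m(1) dec_av_perms m(2)] .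
      \<comment> \<open>\<open>drop M A\<close> is empty, which makes the split condition
        void.\<close>
      have sp: "split_at \<tau> M A" using perms_length[OF p(1)] by (simp add: split_at_def)
      have av: "av \<tau> (ins M (glue A (dec k) w))" using site_left[OF p _ av_permsD_av[OF g], of M] sp by simp
      have r: "rl (ins M (glue A (dec k) w)) = {M..<M + k + 2}" using R[OF p] by simp
      have "num_non_rl (glue A (dec k) w, M) = M" using r av_perms_length[OF g] by (simp add: num_non_rl_def)
      then show "(glue A (dec k) w, M) \<in> left_sites \<tau> (M + k + 1) M M 0 \<and>
          rl (ins (snd (glue A (dec k) w, M)) (fst (glue A (dec k) w, M))) = {M..<M + k + 2}"
        using g av r glue_nth[OF p(1,2)] by (simp add: left_sites_def sites_with_def sites_def)
    qed
    show "?T \<subseteq> ?f ` dec_weaves \<tau> M k"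
    proof
      fix r assume r: "r \<in> ?T"
      obtain \<pi> where rp: "r = (\<pi>, M)" using r by (cases r) (auto simp: left_sites_def)
      have m: "\<pi> \<in> av_perms \<tau> (M + k + 1)" "\<pi> ! M = M + k" "rl (ins M \<pi>) = {M..<M + k + 2}"
        using r by (auto simp: rp left_sites_def sites_with_def sites_def)
      obtain A X w where g: "A \<in> av_perms \<tau> M" "X \<in> av_perms \<tau> k" "w \<in> weaves \<tau> A X" "\<pi> = glue A X w"
        using av_perms_glueE[OF m(1,2)] .
      have "X = dec k" using R[OF av_permsD_perms[OF g(1)] av_permsD_perms[OF g(2)] av_perms_glue(2)[OF g(1-3)]] m(3) g(4) by simp
      then show "r \<in> ?f ` dec_weaves \<tau> M k" using g rp by (force simp: dec_weaves_def)
    qed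
  qed
qed

lemma dec_weaves_left_sites: "eqd (\<lambda>(A, w). des A) (dec_weaves \<tau> M k) (\<lambda>p. des_below M (ins (snd p) (fst p)))
    {p \<in> left_sites \<tau> (M + k + 1) M M 0. rl (ins (snd p) (fst p)) = {M..<M + k + 2}}"
proof (rule eqd_bij[OF bij_dec_weaves_left_sites])
  fix x assume x: "x \<in> dec_weaves \<tau> M k"
  obtain A w where xx: "x = (A, w)" by (cases x)
  have m: "A \<in> av_perms \<tau> M" "w \<in> weaves \<tau> A (dec k)" using x by (auto simp: xx dec_weaves_def)
  note p = av_permsD_perms[OF m(1)] dec_perms[of k] av_perms_glue(2)[OF m(1) dec_av_perms m(2)]
  have "[] \<in> perms 0" by (simp add: perms_def)
  from stats_left(1)[OF p(1) this p(2), of w True]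
  have "des (ins M (glue A (dec k) w)) = des A \<union> {M} \<union> (\<lambda>k. k + (M + 1)) ` des (ins 0 (dec k))"
    using p(3) by simp
  moreover have "Suc i < M" if "i \<in> des A" for i using that perms_length[OF p(1)] by (auto simp: des_def)
  ultimately show "des_below M (ins (snd (case x of (A, w) \<Rightarrow> (glue A (dec k) w, M))) (fst (case x of (A, w) \<Rightarrow> (glue A (dec k) w, M))))
    = (case x of (A, w) \<Rightarrow> des A)" unfolding xx des_below_def by auto
qed

text \<open>The pieces with \<open>a < M\<close> need only smaller parameters. For the remaining
  piece \<open>left_sites_eqd\<close> would ask for \<open>gaps_eqd M\<close>, which this lemma is
  meant to prove; that piece is instead the case of a run shorter by one.\<close>

lemma dec_weaves_step:
  assumes "\<And>m. m < M \<Longrightarrow> gaps_eqd m" "\<And>m b. m < M \<Longrightarrow> sites_eqd b m"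
    and "eqd (\<lambda>(A, w). des A) (dec_weaves True M k) (\<lambda>(A, w). des A) (dec_weaves False M k)"
  shows "eqd (\<lambda>(A, w). des A) (dec_weaves True M (Suc k)) (\<lambda>(A, w). des A) (dec_weaves False M (Suc k))"
proof -
  let ?n = "M + k + 1"
  let ?l = "\<lambda>p. des_below M (ins (snd p) (fst p))"
  let ?R = "\<lambda>\<tau> a. {p \<in> right_sites \<tau> ?n M a. rl (ins (snd p) (fst p)) = {M..<M + k + 2}}"
  let ?L = "\<lambda>\<tau>. {p \<in> left_sites \<tau> ?n M M 0. rl (ins (snd p) (fst p)) = {M..<M + k + 2}}"
  have R: "eqd ?l (?R True a) ?l (?R False a)" if "a < M" for a
  proof -
    define b where "b = M + k - a"
    have b: "?n = a + b + 1" using that by (simp add: b_def)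
    have "eqd (site_stats True) (right_sites True ?n M a) (site_stats False) (right_sites False ?n M a)"
      unfolding b using right_sites_eqd[of a M b] assms(1,2) that by simp
    then have "eqd (site_stats True) (?R True a) (site_stats False) (?R False a)"
      by (rule eqd_filter[where R = "\<lambda>t. fst (snd t) = {M..<M + k + 2}"]) (auto simp: site_stats_def)
    then show ?thesis
      by (rule eqd_comp[where p = "\<lambda>t. {i \<in> fst t. Suc i < M}"]) (auto simp: site_stats_def des_below_def)
  qed
  have disj: "disjoint_family_on (?R \<tau>) {..<M}" for \<tau>
  proof -
    have "a = a'" if "p \<in> right_sites \<tau> ?n M a" "p \<in> right_sites \<tau> ?n M a'" for a a' p
    proof -
      have "fst p \<in> perms ?n" using that by (auto simp: right_sites_def sites_with_def sites_def av_perms_def)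
      from perm_pos(2)[OF this, of a a'] show ?thesis using that by (auto simp: right_sites_def)
    qed
    then show ?thesis unfolding disjoint_family_on_def by blast
  qed
  have disj2: "(\<Union>a\<in>{..<M}. ?R \<tau> a) \<inter> ?L \<tau> = {}" for \<tau>
  proof -
    have False if "p \<in> right_sites \<tau> ?n M a" "p \<in> left_sites \<tau> ?n M M 0" "a < M" for a p
    proof -
      have "fst p \<in> perms ?n" using that by (auto simp: right_sites_def sites_with_def sites_def av_perms_def)
      from perm_pos(2)[OF this, of a M] show ?thesis using that by (auto simp: right_sites_def left_sites_def)
    qed
    then show ?thesis by blast
  qed
  have L: "eqd ?l (?L True) ?l (?L False)"
    using eqd_trans[OF eqd_trans[OF eqd_sym[OF dec_weaves_left_sites] assms(3)] dec_weaves_left_sites] .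
  have "eqd ?l (dec_sites True M ?n) ?l (dec_sites False M ?n)"
    unfolding dec_sites_split by (intro eqd_Un eqd_UN R L disj disj2) simp
  then show ?thesis using eqd_trans[OF eqd_trans[OF dec_weaves_dec_sites] eqd_sym[OF dec_weaves_dec_sites]] by blast
qed

text \<open>For an empty run the claim concerns descents on avoiders of length \<open>M\<close>. For
  \<open>M > 0\<close> each of them has a right-to-left maximum, hence fewer than \<open>M\<close>
  other entries, so \<open>sites_eqd\<close> is needed only below \<open>M\<close>.\<close>

lemma dec_weaves_base:
  assumes "\<And>m b. m < M \<Longrightarrow> sites_eqd b m"
  shows "eqd (\<lambda>(A, w). des A) (dec_weaves True M 0) (\<lambda>(A, w). des A) (dec_weaves False M 0)"
proof -
  have 1: "eqd (\<lambda>(A, w). des A) (dec_weaves \<tau> M 0) des (av_perms \<tau> M)" for \<tau>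
  proof -
    have "weaves \<tau> A (dec 0) = {replicate M 0}" if "A \<in> av_perms \<tau> M" for A
    proof -
      have "w = replicate M 0" if "length w = M" "set w \<subseteq> {0}" for w
        using that replicate_eqI[of w M 0] by blast
      then show ?thesis using av_perms_length[OF that] unfolding weaves_def free_cuts_dec by (auto simp: jumps_def)
    qed
    then have "bij_betw fst (dec_weaves \<tau> M 0) (av_perms \<tau> M)"
      unfolding dec_weaves_def by (auto simp: bij_betw_def inj_on_def image_iff)
    then show ?thesis by (rule eqd_bij) auto
  qed
  have "eqd des (av_perms True M) des (av_perms False M)"
  proof (cases M)
    case 0
    then show ?thesis unfolding 0 av_perms_0 eqd_def by (intro exI[of _ id]) simp
  next
    case (Suc n)
    have "sites \<tau> n = (\<Union>m\<in>{..<M}. sites_with \<tau> n 0 m)" for \<tau>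
    proof -
      have "num_non_rl p < M" if "p \<in> sites \<tau> n" for p
      proof -
        have "fst p \<in> perms n" "snd p \<le> n" using that by (auto simp: sites_def av_perms_def)
        then show ?thesis using card_rl_ins[of "fst p" n "snd p"] perms_length[of "fst p" n] Suc by (simp add: num_non_rl_def)
      qed
      then show ?thesis by (auto simp: sites_with_def)
    qed
    moreover have "eqd (site_stats True) (\<Union>m\<in>{..<M}. sites_with True n 0 m) (site_stats False) (\<Union>m\<in>{..<M}. sites_with False n 0 m)"
      using assms[unfolded sites_eqd_def]
      by (intro eqd_UN) (auto simp: disjoint_family_on_def sites_with_def)
    ultimately have "eqd (site_stats True) (sites True n) (site_stats False) (sites False n)" by simp
    then have "eqd (\<lambda>p. des (ins (snd p) (fst p))) (sites True n) (\<lambda>p. des (ins (snd p) (fst p))) (sites False n)"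
      by (rule eqd_comp[where p = fst]) (auto simp: site_stats_def)
    then show ?thesis unfolding Suc by (rule eqd_transport[OF bij_ins bij_ins])
  qed
  then show ?thesis using eqd_trans[OF eqd_trans[OF 1] eqd_sym[OF 1]] by blast
qed

section \<open>Recovery of the active gaps and the double induction\<close>

lemma card_dec_weaves:
  assumes "M > 0"
  shows "card {x \<in> dec_weaves \<tau> M k. (\<lambda>(A, w). des A) x = v} =
    (\<Sum>r<Suc M. card {A \<in> av_perms \<tau> M. des A = v \<and> card (active_gaps \<tau> A) = Suc r} * word_count (Suc r) k)"
proof -
  have "{x \<in> dec_weaves \<tau> M k. (\<lambda>(A, w). des A) x = v} = (SIGMA A : {A \<in> av_perms \<tau> M. des A = v}. weaves \<tau> A (dec k))"
    by (auto simp: dec_weaves_def)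
  then have "card {x \<in> dec_weaves \<tau> M k. (\<lambda>(A, w). des A) x = v} = (\<Sum>A\<in>{A \<in> av_perms \<tau> M. des A = v}. card (weaves \<tau> A (dec k)))"
    using finite_av_perms finite_weaves by simp
  also have "\<dots> = (\<Sum>A\<in>{A \<in> av_perms \<tau> M. des A = v}. word_count (card (active_gaps \<tau> A)) k)"
  proof (rule sum.cong)
    fix A assume "A \<in> {A \<in> av_perms \<tau> M. des A = v}"
    then show "card (weaves \<tau> A (dec k)) = word_count (card (active_gaps \<tau> A)) k"
      using card_weaves[OF av_permsD_perms dec_perms assms, of A \<tau> \<tau> k] by (simp add: free_cuts_dec)
  qed simp
  also have "\<dots> = (\<Sum>A\<in>(\<Union>r\<in>{..<Suc M}. {A \<in> av_perms \<tau> M. des A = v \<and> card (active_gaps \<tau> A) = Suc r}). word_count (card (active_gaps \<tau> A)) k)"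
  proof (rule sum.cong)
    have "\<exists>r<Suc M. card (active_gaps \<tau> A) = Suc r" if "A \<in> av_perms \<tau> M" for A
    proof -
      have "card (active_gaps \<tau> A) \<le> card {..M}" using av_perms_length[OF that] by (intro card_mono) (auto simp: active_gaps_def)
      moreover have "card (active_gaps \<tau> A) \<noteq> 0" using active_gaps_0[of \<tau> A] by auto
      ultimately show ?thesis by (metis card_atMost less_Suc_eq_le not0_implies_Suc Suc_le_mono)
    qed
    then show "{A \<in> av_perms \<tau> M. des A = v} = (\<Union>r\<in>{..<Suc M}. {A \<in> av_perms \<tau> M. des A = v \<and> card (active_gaps \<tau> A) = Suc r})"
      by auto
  qed simp
  also have "\<dots> = (\<Sum>r<Suc M. \<Sum>A\<in>{A \<in> av_perms \<tau> M. des A = v \<and> card (active_gaps \<tau> A) = Suc r}. word_count (card (active_gaps \<tau> A)) k)"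
    using finite_av_perms by (intro sum.UNION_disjoint) auto
  also have "\<dots> = (\<Sum>r<Suc M. card {A \<in> av_perms \<tau> M. des A = v \<and> card (active_gaps \<tau> A) = Suc r} * word_count (Suc r) k)"
    by (intro sum.cong) (simp_all del: word_count.simps)
  finally show ?thesis .
qed

text \<open>For a fixed descent set \<open>v\<close>, the numbers of \<open>dec_weaves\<close> are
  linear combinations of the functions \<open>word_count (Suc r)\<close> of \<open>k\<close>, with
  the joint distribution of descents and active gaps as coefficients. They agree for all
  \<open>k\<close>, so by \<open>word_count_independent\<close> the coefficients agree.\<close>

lemma gaps_eqd_step:
  assumes "\<And>m. m < M \<Longrightarrow> gaps_eqd m" "\<And>m b. m < M \<Longrightarrow> sites_eqd b m"
  shows "gaps_eqd M"
proof (cases "M = 0")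
  case True
  have "active_gaps \<tau> [] = {0}" for \<tau> by (auto simp: active_gaps_def)
  then show ?thesis unfolding gaps_eqd_def True av_perms_0 eqd_def by (intro exI[of _ id]) simp
next
  case False
  have G: "eqd (\<lambda>(A, w). des A) (dec_weaves True M k) (\<lambda>(A, w). des A) (dec_weaves False M k)" for k
    by (induction k) (simp_all add: dec_weaves_base[OF assms(2)] dec_weaves_step[OF assms])
  have fin: "finite (dec_weaves \<tau> M k)" for \<tau> k unfolding dec_weaves_def using finite_av_perms finite_weaves by simp
  define N where "N \<tau> v r = card {A \<in> av_perms \<tau> M. des A = v \<and> card (active_gaps \<tau> A) = r}" for \<tau> v r
  have N: "N True v (Suc r) = N False v (Suc r)" if "r < Suc M" for v r
  proof -
    have "(\<Sum>r<Suc M. (int (N True v (Suc r)) - int (N False v (Suc r))) * int (word_count (Suc r) k)) = 0" for k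
    proof -
      have "(\<Sum>r<Suc M. N True v (Suc r) * word_count (Suc r) k) = (\<Sum>r<Suc M. N False v (Suc r) * word_count (Suc r) k)"
        using G[of k, unfolded eqd_card_iff[OF fin fin]] card_dec_weaves[of M True k v] card_dec_weaves[of M False k v] False
        unfolding N_def by simp
      then have "int (\<Sum>r<Suc M. N True v (Suc r) * word_count (Suc r) k) = int (\<Sum>r<Suc M. N False v (Suc r) * word_count (Suc r) k)"
        by presburger
      then show ?thesis by (simp add: left_diff_distrib sum_subtractf of_nat_sum del: word_count.simps sum.lessThan_Suc)
    qed
    then show ?thesis using word_count_independent[of 0 "\<lambda>r. int (N True v (Suc r)) - int (N False v (Suc r))" "Suc M" r] that by simp
  qed
  have N': "N True v r = N False v r" for v r
  proof (cases "\<exists>s<Suc M. r = Suc s")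
    case True then show ?thesis using N by blast
  next
    case F: False
    have "N \<tau> v r = 0" for \<tau>
    proof -
      have "card (active_gaps \<tau> A) \<noteq> r" if "A \<in> av_perms \<tau> M" for A
      proof -
        have "card (active_gaps \<tau> A) \<le> card {..M}" using av_perms_length[OF that] by (intro card_mono) (auto simp: active_gaps_def)
        moreover have "card (active_gaps \<tau> A) \<noteq> 0" using active_gaps_0[of \<tau> A] by auto
        ultimately show ?thesis using F by (cases r) auto
      qed
      then have "{A \<in> av_perms \<tau> M. des A = v \<and> card (active_gaps \<tau> A) = r} = {}" by blast
      then show ?thesis unfolding N_def by (simp only: card.empty)
    qed
    then show ?thesis by simp
  qed
  show ?thesis unfolding gaps_eqd_def eqd_card_iff[OF finite_av_perms finite_av_perms] using N' unfolding N_def by auto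
qed

lemma sites_eqd_0: "sites_eqd 0 M"
proof -
  have S: "sites \<tau> 0 = {([], 0)}" for \<tau>
    by (auto simp: sites_def av_perms_0 av_short)
  have "free_cuts \<tau> [] = {0}" for \<tau> by (auto simp: free_cuts_def)
  then show ?thesis unfolding sites_eqd_def sites_with_def S eqd_def
    by (intro exI[of _ id]) (auto simp: site_stats_def bij_betw_def)
qed

text \<open>For given \<open>M\<close> the active gaps come first and use sites of every length with
  smaller parameter; sites with parameter \<open>M\<close> then follow by induction on their
  length.\<close>

theorem gaps_sites_eqd: "gaps_eqd M \<and> (\<forall>n. sites_eqd n M)"
proof (induction M rule: less_induct)
  case (less M)
  have I: "gaps_eqd M" using gaps_eqd_step less by blast
  have "sites_eqd n M" for n
  proof (induction n rule: less_induct)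
    case (less n)
    show ?case
    proof (cases "n = 0")
      case False
      show ?thesis
      proof (rule sites_eqd_step)
        show "gaps_eqd m" if "m \<le> M" for m using that I \<open>\<And>y. y < M \<Longrightarrow> _\<close> by (cases "m = M") auto
        show "sites_eqd b m" if "b < n" "m \<le> M" for b m
          using that less \<open>\<And>y. y < M \<Longrightarrow> gaps_eqd y \<and> (\<forall>n. sites_eqd n y)\<close> by (cases "m = M") auto
      qed (use False in simp)
    qed (simp add: sites_eqd_0)
  qed
  then show ?case using I by blast
qed

lemma eqd_av_perms: "eqd (\<lambda>xs. (des xs, rl xs, second xs)) (av_perms True n) (\<lambda>xs. (des xs, rl xs, second xs)) (av_perms False n)"
proof (cases n)
  case 0
  then show ?thesis unfolding 0 av_perms_0 eqd_def by (intro exI[of _ id]) simp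
next
  case (Suc m)
  have "sites \<tau> m = (\<Union>M\<in>UNIV. sites_with \<tau> m 0 M)" for \<tau> by (auto simp: sites_with_def)
  moreover have "eqd (site_stats True) (\<Union>M\<in>UNIV. sites_with True m 0 M) (site_stats False) (\<Union>M\<in>UNIV. sites_with False m 0 M)"
    using gaps_sites_eqd[unfolded sites_eqd_def] by (intro eqd_UN) (auto simp: disjoint_family_on_def sites_with_def)
  ultimately have "eqd (site_stats True) (sites True m) (site_stats False) (sites False m)" by simp
  then have "eqd (\<lambda>p. (\<lambda>xs. (des xs, rl xs, second xs)) (ins (snd p) (fst p))) (sites True m)
     (\<lambda>p. (\<lambda>xs. (des xs, rl xs, second xs)) (ins (snd p) (fst p))) (sites False m)"
    by (rule eqd_comp[where p = "\<lambda>(d, r, s, k). (d, r, s)"]) (auto simp: site_stats_def)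
  then show ?thesis unfolding Suc by (rule eqd_transport[OF bij_ins bij_ins])
qed

subsection \<open>Steps\<close>

definition stp :: "nat list \<Rightarrow> nat set" where
  "stp xs = {i. Suc i < length xs \<and> xs ! i = Suc (xs ! Suc i)}"

definition skip :: "nat \<Rightarrow> nat \<Rightarrow> nat" where
  "skip v x = (if v \<le> x then Suc x else x)"

text \<open>Replaces the value \<open>v\<close> at position \<open>i\<close> by the step \<open>v + 1, v\<close>.\<close>

definition dup :: "nat \<Rightarrow> nat list \<Rightarrow> nat list" where
  "dup i \<pi> = map (skip (\<pi> ! i)) (take (Suc i) \<pi>) @ \<pi> ! i # map (skip (\<pi> ! i)) (drop (Suc i) \<pi>)"

lemma skip_less_iff [simp]: "skip v x < skip v y \<longleftrightarrow> x < y"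
  by (auto simp: skip_def)

lemma skip_mono: "strict_mono_on S (skip v)"
  by (simp add: strict_mono_on_def)

lemma skip_eq_iff [simp]: "skip v x = skip v y \<longleftrightarrow> x = y"
  by (auto simp: skip_def)

lemma skip_neq: "skip v x \<noteq> v"
  by (auto simp: skip_def)

lemma dup_length: "i < length \<pi> \<Longrightarrow> length (dup i \<pi>) = Suc (length \<pi>)"
  by (simp add: dup_def)

lemma dup_nth:
  assumes "i < length \<pi>"
  shows "j \<le> i \<Longrightarrow> dup i \<pi> ! j = skip (\<pi> ! i) (\<pi> ! j)"
    and "dup i \<pi> ! Suc i = \<pi> ! i"
    and "Suc i < j \<Longrightarrow> j \<le> length \<pi> \<Longrightarrow> dup i \<pi> ! j = skip (\<pi> ! i) (\<pi> ! (j - 1))"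
proof -
  have l: "length (map (skip (\<pi> ! i)) (take (Suc i) \<pi>)) = Suc i" using assms by simp
  show "j \<le> i \<Longrightarrow> dup i \<pi> ! j = skip (\<pi> ! i) (\<pi> ! j)"
    using assms by (simp add: dup_def nth_append)
  show "dup i \<pi> ! Suc i = \<pi> ! i"
    unfolding dup_def nth_append l by simp
  assume j: "Suc i < j" "j \<le> length \<pi>"
  then obtain k where k: "j = Suc (Suc (i + k))" using less_imp_Suc_add[OF j(1)] by auto
  show "dup i \<pi> ! j = skip (\<pi> ! i) (\<pi> ! (j - 1))"
    unfolding dup_def nth_append l k using j k by simp
qed

lemma subseq_pair:
  assumes "subseq l (x # y # Q)"
  shows "subseq l (x # Q) \<or> subseq l (y # Q) \<or> (\<exists>t. l = x # y # t)"
proof (cases l)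
  case Nil then show ?thesis by simp
next
  case (Cons h t)
  then consider "subseq (h # t) (y # Q)" | "h = x" "subseq t (y # Q)"
    using assms unfolding Cons subseq_Cons_iff[of _ _ x] by blast
  then show ?thesis
  proof cases
    case 1 then show ?thesis using Cons by blast
  next
    case 2
    show ?thesis
    proof (cases t)
      case Nil then show ?thesis using 2 Cons by simp
    next
      case t: (Cons h' t')
      then have "subseq t Q \<or> h' = y" using 2(2) unfolding t subseq_Cons_iff[of _ _ y] by blast
      then show ?thesis using 2 Cons t by auto
    qed
  qed
qed

text \<open>An occurrence that uses both \<open>Suc y\<close> and \<open>y\<close> has them as
  consecutive letters. The only descents in the patterns, 42 and 41, leave room for the 3 between
  their values, so this is impossible. An occurrence with at most one of the two survives the
  merging.\<close>

lemma av_step: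
  assumes "distinct (P @ Suc y # y # Q)"
  shows "av \<tau> (P @ Suc y # y # Q) \<longleftrightarrow> av \<tau> (P @ Suc y # Q)"
proof
  assume a: "av \<tau> (P @ Suc y # y # Q)"
  have "subseq (P @ Suc y # Q) (P @ Suc y # y # Q)"
    unfolding subseq_append' by (simp add: list_emb_Cons)
  then show "av \<tau> (P @ Suc y # Q)" using a av_subseq by blast
next
  assume a: "av \<tau> (P @ Suc y # Q)"
  \<comment> \<open>No remaining value lies between \<open>y\<close> and \<open>Suc y\<close>, so
    keeping \<open>y\<close> or keeping \<open>Suc y\<close> gives order-isomorphic lists.\<close>
  define f where "f z = (if z = y then Suc y else z)" for z
  have "map f (P @ y # Q) = P @ Suc y # Q"
  proof -
    have "map f P = P" "map f Q = Q"
      by (rule map_idI, use assms in \<open>auto simp: f_def\<close>)+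
    then show ?thesis by (simp add: f_def)
  qed
  moreover have "strict_mono_on (set (P @ y # Q)) f"
  proof (rule strict_mono_onI)
    fix r s assume "r \<in> set (P @ y # Q)" "s \<in> set (P @ y # Q)" "r < s"
    moreover have "Suc y \<notin> set (P @ y # Q)" using assms by auto
    ultimately have "r < s" "s \<noteq> Suc y" by blast+
    then show "f r < f s" by (simp add: f_def)
  qed
  ultimately have a': "av \<tau> (P @ y # Q)" using av_map a by metis
  show "av \<tau> (P @ Suc y # y # Q)"
    unfolding av_def
  proof (intro allI impI notI)
    fix a1 b c d assume s: "subseq [a1,b,c,d] (P @ Suc y # y # Q)" and p: "pat \<tau> a1 b c d"
    obtain l l' where l: "[a1,b,c,d] = l @ l'" "subseq l P" "subseq l' (Suc y # y # Q)"
      using s unfolding subseq_append_iff by blast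
    consider "subseq l' (Suc y # Q)" | "subseq l' (y # Q)" | t where "l' = Suc y # y # t"
      using subseq_pair[OF l(3)] by blast
    then show False
    proof cases
      case 1
      then have "subseq [a1,b,c,d] (P @ Suc y # Q)" unfolding l(1) using l(2) list_emb_append_mono by blast
      then show False using a p unfolding av_def by blast
    next
      case 2
      then have "subseq [a1,b,c,d] (P @ y # Q)" unfolding l(1) using l(2) list_emb_append_mono by blast
      then show False using a' p unfolding av_def by blast
    next
      case 3
      have "(a1 = Suc y \<and> b = y) \<or> (b = Suc y \<and> c = y) \<or> (c = Suc y \<and> d = y)"
        using l(1) unfolding 3 by (auto simp: Cons_eq_append_conv)
      then show False using p by (auto simp: pat_def split: if_splits)
    qed
  qed
qed

lemma dup_split:
  assumes "i < length \<pi>"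
  shows "dup i \<pi> = map (skip (\<pi> ! i)) (take i \<pi>) @ Suc (\<pi> ! i) # \<pi> ! i # map (skip (\<pi> ! i)) (drop (Suc i) \<pi>)"
  using assms by (simp add: dup_def take_Suc_conv_app_nth skip_def)

lemma dup_map:
  assumes "i < length \<pi>"
  shows "map (skip (\<pi> ! i)) (take i \<pi>) @ Suc (\<pi> ! i) # map (skip (\<pi> ! i)) (drop (Suc i) \<pi>) = map (skip (\<pi> ! i)) \<pi>"
proof -
  have "map (skip (\<pi> ! i)) \<pi> = map (skip (\<pi> ! i)) (take i \<pi> @ \<pi> ! i # drop (Suc i) \<pi>)"
    using id_take_nth_drop[OF assms] by simp
  then show ?thesis by (simp add: skip_def)
qed

lemma dup_perms:
  assumes "\<pi> \<in> perms n" "i < n"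
  shows "dup i \<pi> \<in> perms (Suc n)"
proof -
  have l: "length \<pi> = n" "set \<pi> = {..<n}" "distinct \<pi>" using assms perms_length by (auto simp: perms_def)
  have v: "\<pi> ! i < n" using l assms nth_mem by blast
  have d0: "distinct (take (Suc i) \<pi> @ drop (Suc i) \<pi>)" using l by simp
  then have d1: "distinct (take (Suc i) \<pi>)" "distinct (drop (Suc i) \<pi>)"
    "set (take (Suc i) \<pi>) \<inter> set (drop (Suc i) \<pi>) = {}" unfolding distinct_append by blast+
  then have d: "distinct (dup i \<pi>)"
    unfolding dup_def by (auto simp: distinct_map inj_on_def skip_neq skip_neq[symmetric])
  have "set (dup i \<pi>) \<subseteq> {..<Suc n}"
  proof -
    have "set (take (Suc i) \<pi>) \<subseteq> {..<n}" "set (drop (Suc i) \<pi>) \<subseteq> {..<n}"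
      using set_take_subset set_drop_subset l(2) by (metis)+
    then show ?thesis using v unfolding dup_def by (force simp: skip_def)
  qed
  then have "set (dup i \<pi>) = {..<Suc n}"
    using distinct_card[OF d] dup_length[of i \<pi>] l assms(2) by (intro card_subset_eq) auto
  then show ?thesis using d by (simp add: perms_def)
qed

lemma av_dup:
  assumes "\<pi> \<in> perms n" "i < n"
  shows "av \<tau> (dup i \<pi>) \<longleftrightarrow> av \<tau> \<pi>"
proof -
  have l: "i < length \<pi>" using assms perms_length by simp
  have "distinct (dup i \<pi>)" using dup_perms[OF assms] by (simp add: perms_def)
  then show ?thesis unfolding dup_split[OF l]
    using av_step dup_map[OF l] av_map[OF skip_mono] by metis
qed

text \<open>Maps a position of \<open>dup i \<pi>\<close> to the position of \<open>\<pi>\<close> it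
  comes from; \<open>i\<close> and \<open>Suc i\<close> collapse to \<open>i\<close>.\<close>

definition fold_pos :: "nat \<Rightarrow> nat \<Rightarrow> nat" where
  "fold_pos i j = (if j \<le> i then j else j - 1)"

text \<open>The two entries of the step have adjacent values, so each compares with every other
  entry as the original entry did.\<close>

lemma dup_less:
  assumes "\<pi> \<in> perms n" "i < n" "j \<le> n" "k \<le> n" "fold_pos i j \<noteq> fold_pos i k"
  shows "dup i \<pi> ! j < dup i \<pi> ! k \<longleftrightarrow> \<pi> ! fold_pos i j < \<pi> ! fold_pos i k"
proof -
  have l: "length \<pi> = n" "distinct \<pi>" using assms(1) perms_length by (auto simp: perms_def)
  have il: "i < length \<pi>" using l assms by simp
  note N = dup_nth[OF il]
  have ne: "\<pi> ! a \<noteq> \<pi> ! i" if "a < n" "a \<noteq> i" for a using l that assms(2) by (simp add: nth_eq_iff_index_eq)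
  have s: "\<pi> ! i < skip (\<pi> ! i) x \<longleftrightarrow> \<pi> ! i < x" if "x \<noteq> \<pi> ! i" for x using that by (auto simp: skip_def)
  have s': "skip (\<pi> ! i) x < \<pi> ! i \<longleftrightarrow> x < \<pi> ! i" for x by (auto simp: skip_def)
  consider "j \<le> i" | "j = Suc i" | "Suc i < j" by linarith
  then show ?thesis
  proof cases
    case 1
    consider "k \<le> i" | "k = Suc i" | "Suc i < k" by linarith
    then show ?thesis
    proof cases
      case 11: 1 then show ?thesis using 1 N(1) by (simp add: fold_pos_def)
    next
      case 12: 2 then show ?thesis using 1 N(1)[OF 1] N(2) s' by (simp add: fold_pos_def)
    next
      case 13: 3 then show ?thesis using 1 N(1)[OF 1] N(3)[of k] l assms by (simp add: fold_pos_def)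
    qed
  next
    case 2
    consider "k \<le> i" | "k = Suc i" | "Suc i < k" by linarith
    then show ?thesis
    proof cases
      case 11: 1
      then have "k < n" "k \<noteq> i" using assms 2 by (auto simp: fold_pos_def)
      then show ?thesis using 2 N(1)[OF 11] N(2) s[OF ne] 11 by (simp add: fold_pos_def)
    next
      case 12: 2 then show ?thesis using 2 assms by simp
    next
      case 13: 3
      then have "k - 1 < n" "k - 1 \<noteq> i" using assms by auto
      then show ?thesis using 2 N(2) N(3)[of k] s[OF ne] 13 l assms by (simp add: fold_pos_def)
    qed
  next
    case 3
    consider "k \<le> i" | "k = Suc i" | "Suc i < k" by linarith
    then show ?thesis
    proof cases
      case 11: 1 then show ?thesis using 3 N(1)[OF 11] N(3)[of j] l assms by (simp add: fold_pos_def)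
    next
      case 12: 2 then show ?thesis using 3 N(2) N(3)[of j] s' l assms by (simp add: fold_pos_def)
    next
      case 13: 3 then show ?thesis using 3 N(3)[of j] N(3)[of k] l assms by (simp add: fold_pos_def)
    qed
  qed
qed

lemma dup_step: "i < length \<pi> \<Longrightarrow> dup i \<pi> ! i = Suc (dup i \<pi> ! Suc i)"
  using dup_nth(1)[of i \<pi> i] dup_nth(2)[of i \<pi>] by (simp add: skip_def)

lemma des_dup:
  assumes "\<pi> \<in> perms n" "i < n"
  shows "des (dup i \<pi>) = insert i {j. j \<noteq> i \<and> fold_pos i j \<in> des \<pi>}"
proof (rule set_eqI)
  fix j
  have l: "length \<pi> = n" "i < length \<pi>" using assms perms_length by auto
  show "j \<in> des (dup i \<pi>) \<longleftrightarrow> j \<in> insert i {j. j \<noteq> i \<and> fold_pos i j \<in> des \<pi>}"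
  proof (cases "j = i")
    case True then show ?thesis using dup_step[OF l(2)] l dup_length[OF l(2)] by (simp add: des_def)
  next
    case False
    then have f: "fold_pos i (Suc j) = Suc (fold_pos i j)" by (auto simp: fold_pos_def)
    have le: "Suc j < Suc n \<longleftrightarrow> Suc (fold_pos i j) < n" using False assms by (auto simp: fold_pos_def)
    show ?thesis using dup_less[OF assms, of "Suc j" j] f False le l dup_length[OF l(2)] by (auto simp: des_def)
  qed
qed

lemma rl_dup:
  assumes "\<pi> \<in> perms n" "i < n"
  shows "rl (dup i \<pi>) = {j. j \<le> n \<and> fold_pos i j \<in> rl \<pi>}"
proof (rule set_eqI)
  fix j
  have l: "length \<pi> = n" "i < length \<pi>" using assms perms_length by auto
  have L: "length (dup i \<pi>) = Suc n" using dup_length[OF l(2)] l by simp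
  have fl: "fold_pos i k < n" if "k \<le> n" for k using that assms by (auto simp: fold_pos_def)
  show "j \<in> rl (dup i \<pi>) \<longleftrightarrow> j \<in> {j. j \<le> n \<and> fold_pos i j \<in> rl \<pi>}"
  proof
    assume j: "j \<in> rl (dup i \<pi>)"
    then have jn: "j \<le> n" using L by (simp add: rl_def)
    have "\<pi> ! k < \<pi> ! fold_pos i j" if k: "fold_pos i j < k" "k < n" for k
    proof -
      define k' where "k' = (if k \<le> i then k else Suc k)"
      have k': "fold_pos i k' = k" "k' \<le> n" "j < k'" using k by (auto simp: k'_def fold_pos_def split: if_splits)
      have "dup i \<pi> ! k' < dup i \<pi> ! j" using j k' L by (simp add: rl_def)
      then show ?thesis using dup_less[OF assms k'(2) jn] k k'(1) by simp
    qed
    then show "j \<in> {j. j \<le> n \<and> fold_pos i j \<in> rl \<pi>}" using jn fl l by (simp add: rl_def)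
  next
    assume j: "j \<in> {j. j \<le> n \<and> fold_pos i j \<in> rl \<pi>}"
    have "dup i \<pi> ! k < dup i \<pi> ! j" if k: "j < k" "k \<le> n" for k
    proof (cases "fold_pos i j = fold_pos i k")
      case True
      then have "j = i" "k = Suc i" using k by (auto simp: fold_pos_def split: if_splits)
      then show ?thesis using dup_step[OF l(2)] by simp
    next
      case False
      then have "fold_pos i j < fold_pos i k" using k by (auto simp: fold_pos_def split: if_splits)
      then have "\<pi> ! fold_pos i k < \<pi> ! fold_pos i j" using j fl[OF k(2)] l by (simp add: rl_def)
      then show ?thesis using dup_less[OF assms k(2), of j] j False by simp
    qed
    then show "j \<in> rl (dup i \<pi>)" using j L by (simp add: rl_def)
  qed
qed

lemma stp_dup:
  assumes "\<pi> \<in> perms n" "i < n"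
  shows "stp (dup i \<pi>) = insert i {j. j \<noteq> i \<and> fold_pos i j \<in> stp \<pi>}"
proof (rule set_eqI)
  fix j
  have l: "length \<pi> = n" "i < length \<pi>" "distinct \<pi>" using assms perms_length by (auto simp: perms_def)
  note N = dup_nth[OF l(2)]
  have ne: "\<pi> ! a \<noteq> \<pi> ! i" if "a < n" "a \<noteq> i" for a using l that assms(2) by (simp add: nth_eq_iff_index_eq)
  show "j \<in> stp (dup i \<pi>) \<longleftrightarrow> j \<in> insert i {j. j \<noteq> i \<and> fold_pos i j \<in> stp \<pi>}"
  proof (cases "j = i")
    case True then show ?thesis using dup_step[OF l(2)] l dup_length[OF l(2)] by (simp add: stp_def)
  next
    case False
    have le: "Suc j < Suc n \<longleftrightarrow> Suc (fold_pos i j) < n" using False assms by (auto simp: fold_pos_def)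
    have "dup i \<pi> ! j = Suc (dup i \<pi> ! Suc j) \<longleftrightarrow> \<pi> ! fold_pos i j = Suc (\<pi> ! Suc (fold_pos i j))"
      if jn: "Suc j < Suc n"
    proof -
      consider "j < i" | "j = Suc i" | "Suc i < j" using False by linarith
      then show ?thesis
      proof cases
        case 1
        then have "\<pi> ! j \<noteq> \<pi> ! i" using ne assms by simp
        then show ?thesis using 1 N(1)[of j] N(1)[of "Suc j"] by (auto simp: fold_pos_def skip_def)
      next
        case 2
        then have "\<pi> ! Suc i \<noteq> \<pi> ! i" using ne jn by simp
        then show ?thesis using 2 N(2) N(3)[of "Suc j"] jn l by (auto simp: fold_pos_def skip_def)
      next
        case 3
        then have "\<pi> ! (j - 1) \<noteq> \<pi> ! i" "\<pi> ! j \<noteq> \<pi> ! i" using ne[of "j - 1"] ne[of j] jn by auto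
        then show ?thesis using 3 N(3)[of j] N(3)[of "Suc j"] jn l by (auto simp: fold_pos_def skip_def)
      qed
    qed
    then show ?thesis using False le l dup_length[OF l(2)] by (auto simp: stp_def)
  qed
qed

text \<open>The maximum is the first right-to-left maximum, so \<open>rl\<close> determines its
  position. This both provides the case distinction in \<open>second_dup\<close> and preserves the
  position of the value \<open>n\<close> in the end.\<close>

lemma max_pos_iff:
  assumes "\<pi> \<in> perms n" "i < n"
  shows "Suc (\<pi> ! i) = n \<longleftrightarrow> i \<in> rl \<pi> \<and> (\<forall>j\<in>rl \<pi>. i \<le> j)"
proof -
  have l: "length \<pi> = n" "set \<pi> = {..<n}" "distinct \<pi>" using assms perms_length by (auto simp: perms_def)
  have lt: "\<pi> ! j < \<pi> ! m" if "Suc (\<pi> ! m) = n" "m < n" "j < n" "j \<noteq> m" for j m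
  proof -
    have "\<pi> ! j < n" "\<pi> ! j \<noteq> \<pi> ! m" using l that nth_mem[of j \<pi>] by (auto simp: nth_eq_iff_index_eq)
    then show ?thesis using that(1) by linarith
  qed
  have rl: "m \<in> rl \<pi>" if "Suc (\<pi> ! m) = n" "m < n" for m
    using lt[OF that] that l(1) by (simp add: rl_def)
  show ?thesis
  proof
    assume m: "Suc (\<pi> ! i) = n"
    have "i \<le> j" if "j \<in> rl \<pi>" for j
    proof (rule ccontr)
      assume "\<not> i \<le> j"
      then have "\<pi> ! i < \<pi> ! j" using that assms(2) l(1) by (simp add: rl_def)
      moreover have "\<pi> ! j < \<pi> ! i" using lt[OF m assms(2), of j] \<open>\<not> i \<le> j\<close> assms(2) by simp
      ultimately show False by simp
    qed
    then show "i \<in> rl \<pi> \<and> (\<forall>j\<in>rl \<pi>. i \<le> j)" using rl[OF m assms(2)] by blast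
  next
    assume i: "i \<in> rl \<pi> \<and> (\<forall>j\<in>rl \<pi>. i \<le> j)"
    obtain m where m: "m < n" "Suc (\<pi> ! m) = n" using perm_pos(1)[OF assms(1)] assms(2) by auto
    then have "i \<le> m" using i rl by blast
    moreover have "\<not> i < m"
    proof
      assume "i < m"
      then have "\<pi> ! m < \<pi> ! i" using i m l(1) by (simp add: rl_def)
      moreover have "\<pi> ! i < \<pi> ! m" using lt[OF m(2,1) assms(2)] \<open>i < m\<close> by simp
      ultimately show False by simp
    qed
    ultimately show "Suc (\<pi> ! i) = n" using m by simp
  qed
qed

text \<open>Doubling the maximum makes its lower copy the second largest value. The case is stated
  through \<open>rl\<close> so that the result depends on the statistics of \<open>\<pi>\<close>
  alone.\<close>

lemma second_dup:
  assumes "\<pi> \<in> perms n" "i < n"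
  shows "second (dup i \<pi>) = (if i \<in> rl \<pi> \<and> (\<forall>j\<in>rl \<pi>. i \<le> j) then {Suc i}
    else (\<lambda>j. if j \<le> i then j else Suc j) ` second \<pi>)"
proof -
  have l: "length \<pi> = n" "i < length \<pi>" "set \<pi> = {..<n}" "distinct \<pi>" using assms perms_length by (auto simp: perms_def)
  note N = dup_nth[OF l(2)] and P = dup_perms[OF assms]
  show ?thesis
  proof (cases "Suc (\<pi> ! i) = n")
    case True
    have "second (dup i \<pi>) = {Suc i}"
      by (rule second_eq[OF P]) (use True N(2) assms in auto)
    then show ?thesis using max_pos_iff[OF assms] True by simp
  next
    case False
    have v: "Suc (\<pi> ! i) < n" using nth_mem[OF l(2)] l(3) False by (metis Suc_lessI lessThan_iff)
    then have "n - 2 \<in> set \<pi>" using l(3) by simp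
    then obtain q where q: "q < n" "\<pi> ! q = n - 2" using l(1) by (auto simp: in_set_conv_nth)
    have s: "second \<pi> = {q}" by (rule second_eq[OF assms(1) q(1)]) (use q v in simp)
    have "second (dup i \<pi>) = {if q \<le> i then q else Suc q}"
    proof (rule second_eq[OF P])
      show "(if q \<le> i then q else Suc q) < Suc n" using q by simp
      have "dup i \<pi> ! (if q \<le> i then q else Suc q) = skip (\<pi> ! i) (\<pi> ! q)"
        using N(1)[of q] N(3)[of "Suc q"] q l by auto
      then show "Suc (Suc (dup i \<pi> ! (if q \<le> i then q else Suc q))) = Suc n"
      proof -
        have "\<pi> ! i \<le> n - 2" "Suc (Suc (n - 2)) = n" using v by linarith+
        then show ?thesis using \<open>dup i \<pi> ! (if q \<le> i then q else Suc q) = skip (\<pi> ! i) (\<pi> ! q)\<close> q(2)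
          by (simp add: skip_def)
      qed
    qed
    then show ?thesis using max_pos_iff[OF assms] False s by simp
  qed
qed

lemma bij_dup:
  assumes "i < n"
  shows "bij_betw (dup i) (av_perms \<tau> n) {Y \<in> av_perms \<tau> (Suc n). i \<in> stp Y}"
  unfolding bij_betw_def
proof
  show "inj_on (dup i) (av_perms \<tau> n)"
  proof (rule inj_onI)
    fix \<pi> \<pi>' assume p: "\<pi> \<in> av_perms \<tau> n" "\<pi>' \<in> av_perms \<tau> n" and e: "dup i \<pi> = dup i \<pi>'"
    have l: "i < length \<pi>" "i < length \<pi>'" using av_perms_length p assms by auto
    have v: "\<pi> ! i = \<pi>' ! i" using dup_nth(2)[OF l(1)] dup_nth(2)[OF l(2)] e by simp
    have len: "length (map (skip (\<pi> ! i)) (take (Suc i) \<pi>)) = length (map (skip (\<pi>' ! i)) (take (Suc i) \<pi>'))"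
      using l by simp
    have "map (skip (\<pi> ! i)) (take (Suc i) \<pi>) = map (skip (\<pi> ! i)) (take (Suc i) \<pi>')"
      "map (skip (\<pi> ! i)) (drop (Suc i) \<pi>) = map (skip (\<pi> ! i)) (drop (Suc i) \<pi>')"
      using e len unfolding dup_def v by (simp_all add: append_eq_append_conv)
    moreover have "inj (skip (\<pi> ! i))" by (simp add: inj_on_def)
    ultimately have "take (Suc i) \<pi> = take (Suc i) \<pi>'" "drop (Suc i) \<pi> = drop (Suc i) \<pi>'"
      using inj_map_eq_map by blast+
    then show "\<pi> = \<pi>'" by (metis append_take_drop_id)
  qed
  show "dup i ` av_perms \<tau> n = {Y \<in> av_perms \<tau> (Suc n). i \<in> stp Y}"
  proof
    show "dup i ` av_perms \<tau> n \<subseteq> {Y \<in> av_perms \<tau> (Suc n). i \<in> stp Y}"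
      using dup_perms av_dup stp_dup assms by (auto simp: av_perms_def)
    show "{Y \<in> av_perms \<tau> (Suc n). i \<in> stp Y} \<subseteq> dup i ` av_perms \<tau> n"
    proof clarify
      fix Y assume Y: "Y \<in> av_perms \<tau> (Suc n)" "i \<in> stp Y"
      have Yp: "length Y = Suc n" "distinct Y" "set Y = {..<Suc n}" "av \<tau> Y"
        using Y perms_length by (auto simp: av_perms_def perms_def)
      define v where "v = Y ! Suc i"
      have st: "Suc i < Suc n" "Y ! i = Suc v" using Y(2) Yp(1) by (auto simp: stp_def v_def)
      define P Q where "P = take i Y" and "Q = drop (Suc (Suc i)) Y"
      have YY: "Y = P @ Suc v # v # Q"
      proof -
        have "drop i Y = Suc v # drop (Suc i) Y" "drop (Suc i) Y = v # Q"
          using Cons_nth_drop_Suc[of i Y] Cons_nth_drop_Suc[of "Suc i" Y] st Yp(1) by (simp_all add: v_def Q_def)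
        then show ?thesis unfolding P_def by (metis append_take_drop_id)
      qed
      have lP: "length P = i" using st Yp(1) by (simp add: P_def)
      \<comment> \<open>\<open>u\<close> closes the hole left by the value \<open>v\<close>; in
        particular it sends \<open>Suc v\<close> to \<open>v\<close>.\<close>
      define u where "u x = (if v < x then x - 1 else x)" for x :: nat
      have su: "skip v (u x) = x" if "x \<noteq> v" for x using that by (auto simp: skip_def u_def)
      have nv: "v \<notin> set (P @ Suc v # Q)" using Yp(2) unfolding YY by auto
      have mono: "strict_mono_on (set (P @ Suc v # Q)) u"
      proof (rule strict_mono_onI)
        fix r s assume "r \<in> set (P @ Suc v # Q)" "s \<in> set (P @ Suc v # Q)" "r < s"
        moreover from this have "r \<noteq> v" "s \<noteq> v" using nv by blast+
        ultimately show "u r < u s" by (auto simp: u_def)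
      qed
      define \<pi> where "\<pi> = map u (P @ Suc v # Q)"
      have l\<pi>: "length \<pi> = n" using arg_cong[OF YY, of length] Yp(1) by (simp add: \<pi>_def)
      have \<pi>i: "\<pi> ! i = v" using lP by (simp add: \<pi>_def nth_append u_def)
      have d: "distinct \<pi>" unfolding \<pi>_def distinct_map
        using Yp(2) strict_mono_on_imp_inj_on[OF mono] unfolding YY by auto
      have "set \<pi> \<subseteq> {..<n}"
      proof
        fix x assume "x \<in> set \<pi>"
        then obtain y where y: "y \<in> set (P @ Suc v # Q)" "x = u y" by (auto simp: \<pi>_def)
        have "set (P @ Suc v # Q) \<subseteq> {..<Suc n}" unfolding Yp(3)[symmetric] YY by auto
        then have "y < Suc n" "Suc v < Suc n" using y(1) by auto
        moreover have "y \<noteq> v" using y(1) nv by blast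
        ultimately show "x \<in> {..<n}" by (auto simp: y u_def)
      qed
      then have "set \<pi> = {..<n}" using distinct_card[OF d] l\<pi> by (intro card_subset_eq) auto
      then have p: "\<pi> \<in> perms n" using d by (simp add: perms_def)
      have sx: "skip v (u x) = x" if "x \<in> set (P @ Suc v # Q)" for x
      proof -
        have "x \<noteq> v" using that nv by metis
        then show ?thesis by (rule su)
      qed
      have t: "take (Suc i) \<pi> = map u (P @ [Suc v])" "drop (Suc i) \<pi> = map u Q"
        unfolding \<pi>_def using lP by simp_all
      have "map (skip v) (map u (P @ [Suc v])) = P @ [Suc v]" "map (skip v) (map u Q) = Q"
        unfolding map_map by (rule map_idI, use sx in force)+
      then have D: "dup i \<pi> = Y" unfolding dup_def \<pi>i t YY by simp
      then have "av \<tau> \<pi>" using av_dup[OF p assms, of \<tau>] Yp(4) by simp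
      then show "Y \<in> dup i ` av_perms \<tau> n" using p D by (auto simp: av_perms_def)
    qed
  qed
qed

text \<open>Avoiders with a step are sorted by their first step \<open>i\<close> and come from
  shorter ones by \<open>dup i\<close>. Those without a step are what remains of
  \<open>eqd_av_perms\<close> after this part is cancelled, and for them \<open>stp\<close> is
  constant.\<close>

lemma eqd_av_perms_stp: "eqd (\<lambda>xs. (des xs, rl xs, second xs, stp xs)) (av_perms True n) (\<lambda>xs. (des xs, rl xs, second xs, stp xs)) (av_perms False n)"
proof (induction n)
  case 0
  then show ?case unfolding av_perms_0 eqd_def by (intro exI[of _ id]) simp
next
  case (Suc n)
  let ?s = "\<lambda>xs. (des xs, rl xs, second xs, stp xs)"
  let ?t = "\<lambda>xs. (des xs, rl xs, second xs)"
  let ?A = "\<lambda>\<tau>. av_perms \<tau> (Suc n)"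
  let ?M = "\<lambda>\<tau> i. {Y \<in> {Y \<in> ?A \<tau>. i \<in> stp Y}. \<forall>j\<in>stp Y. i \<le> j}"
  let ?E = "\<lambda>\<tau>. {Y \<in> ?A \<tau>. stp Y = {}}"
  have i: "eqd ?s {Y \<in> ?A True. i \<in> stp Y} ?s {Y \<in> ?A False. i \<in> stp Y}" if "i < n" for i
  proof (rule eqd_transport[OF bij_dup[OF that] bij_dup[OF that]])
    let ?\<phi> = "\<lambda>(d, r, s, t). (insert i {j. j \<noteq> i \<and> fold_pos i j \<in> d}, {j. j \<le> n \<and> fold_pos i j \<in> r},
      if i \<in> r \<and> (\<forall>j\<in>r. i \<le> j) then {Suc i} else (\<lambda>j. if j \<le> i then j else Suc j) ` s,
      insert i {j. j \<noteq> i \<and> fold_pos i j \<in> t})"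
    have "?s (dup i x) = ?\<phi> (?s x)" if "x \<in> av_perms \<tau> n" for x \<tau>
    proof -
      have p: "x \<in> perms n" using that av_permsD_perms by blast
      show ?thesis using des_dup[OF p \<open>i < n\<close>] rl_dup[OF p \<open>i < n\<close>] stp_dup[OF p \<open>i < n\<close>] second_dup[OF p \<open>i < n\<close>]
        by simp
    qed
    then show "eqd (\<lambda>x. ?s (dup i x)) (av_perms True n) (\<lambda>x. ?s (dup i x)) (av_perms False n)"
      by (intro eqd_comp[OF Suc, where p = ?\<phi>]) blast+
  qed
  have m: "eqd ?s (?M True i) ?s (?M False i)" if "i < n" for i
    by (rule eqd_filter[OF i[OF that], where R = "\<lambda>(d, r, s, t). \<forall>j\<in>t. i \<le> j"]) auto
  have u: "?A \<tau> = ?E \<tau> \<union> (\<Union>i\<in>{..<n}. ?M \<tau> i)" for \<tau>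
  proof -
    have "\<exists>i<n. i \<in> stp Y \<and> (\<forall>j\<in>stp Y. i \<le> j)" if "Y \<in> ?A \<tau>" "stp Y \<noteq> {}" for Y
    proof (intro exI conjI ballI)
      let ?i = "LEAST j. j \<in> stp Y"
      show i: "?i \<in> stp Y" using that(2) LeastI_ex[of "\<lambda>j. j \<in> stp Y"] by blast
      show "?i < n" using i av_perms_length[OF that(1)] by (simp add: stp_def)
      show "?i \<le> j" if "j \<in> stp Y" for j using that by (rule Least_le)
    qed
    then show ?thesis by blast
  qed
  have dj: "disjoint_family_on (?M \<tau>) {..<n}" for \<tau>
    unfolding disjoint_family_on_def by (blast intro: le_antisym)
  have dj': "?E \<tau> \<inter> (\<Union>i\<in>{..<n}. ?M \<tau> i) = {}" for \<tau> by blast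
  have M: "eqd ?s (\<Union>i\<in>{..<n}. ?M True i) ?s (\<Union>i\<in>{..<n}. ?M False i)"
    by (rule eqd_UN[OF _ dj dj], rule m) simp
  have Mt: "eqd ?t (\<Union>i\<in>{..<n}. ?M True i) ?t (\<Union>i\<in>{..<n}. ?M False i)"
    by (rule eqd_comp[OF M, where p = "\<lambda>(d, r, s, t). (d, r, s)"]) auto
  have "eqd ?t (?E True) ?t (?E False)"
  proof (rule eqd_cancel_Un[OF _ _ _ Mt dj' dj'])
    show "finite (?E True \<union> (\<Union>i\<in>{..<n}. ?M True i))" "finite (?E False \<union> (\<Union>i\<in>{..<n}. ?M False i))"
      unfolding u[symmetric] by (rule finite_av_perms)+
    show "eqd ?t (?E True \<union> (\<Union>i\<in>{..<n}. ?M True i)) ?t (?E False \<union> (\<Union>i\<in>{..<n}. ?M False i))"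
      unfolding u[symmetric] by (rule eqd_av_perms)
  qed
  then have "eqd ?s (?E True) ?s (?E False)"
    by (rule eqd_comp[where p = "\<lambda>(d, r, s). (d, r, s, {})"]) auto
  from eqd_Un[OF this M dj' dj'] show ?case unfolding u[symmetric] .
qed

section \<open>Transfer to 1-based permutations\<close>

lemma order_isomorphic_1423: "order_isomorphic [a,b,c,d] [1,4,2,3] \<longleftrightarrow> pat True a b c d"
proof -
  have "{1..length [a,b,c,d]} = {1,2,3,4}" by auto
  then show ?thesis unfolding order_isomorphic_def by (simp add: entry_def pat_def) linarith
qed

lemma order_isomorphic_2413: "order_isomorphic [a,b,c,d] [2,4,1,3] \<longleftrightarrow> pat False a b c d"
proof -
  have "{1..length [a,b,c,d]} = {1,2,3,4}" by auto
  then show ?thesis unfolding order_isomorphic_def by (simp add: entry_def pat_def) linarith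
qed

lemma avoids_av:
  assumes "length t = 4" "\<And>a b c d. order_isomorphic [a,b,c,d] t \<longleftrightarrow> pat \<tau> a b c d"
  shows "avoids xs t \<longleftrightarrow> av \<tau> xs"
proof -
  have "\<exists>a b c d. \<sigma> = [a,b,c,d]" if "order_isomorphic \<sigma> t" for \<sigma>
    using that assms(1) unfolding order_isomorphic_def by (auto simp: length_Suc_conv numeral_eq_Suc)
  then show ?thesis unfolding avoids_def av_def using assms(2) by blast
qed

lemma avoiders_av_perms:
  assumes "length t = 4" "\<And>a b c d. order_isomorphic [a,b,c,d] t \<longleftrightarrow> pat \<tau> a b c d"
  shows "avoiders n t = map Suc ` av_perms \<tau> n"
proof (intro set_eqI iffI)
  have m: "strict_mono_on S Suc" for S by (simp add: strict_mono_on_def)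
  fix ys
  {
    assume "ys \<in> avoiders n t"
    then have ys: "set ys = {1..n}" "distinct ys" "av \<tau> ys"
      using avoids_av[OF assms] by (auto simp: avoiders_def permutations_of_set_def)
    define xs where "xs = map (\<lambda>x. x - 1) ys"
    have "ys = map Suc xs" using ys(1) unfolding xs_def by (auto simp: o_def intro!: map_idI[symmetric])
    moreover have "Suc ` set xs = Suc ` {..<n}"
      using ys(1) unfolding calculation by (simp add: image_Suc_lessThan)
    then have "set xs = {..<n}" by (simp add: inj_image_eq_iff)
    moreover have "distinct xs" using ys(2) unfolding calculation(1) by (simp add: distinct_map)
    moreover have "av \<tau> xs" using ys(3) av_map[OF m] unfolding calculation(1) by blast
    ultimately show "ys \<in> map Suc ` av_perms \<tau> n" by (auto simp: av_perms_def perms_def)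
  }
  assume "ys \<in> map Suc ` av_perms \<tau> n"
  then obtain xs where xs: "ys = map Suc xs" "xs \<in> perms n" "av \<tau> xs" by (auto simp: av_perms_def)
  have "av \<tau> ys" using xs av_map[OF m] by blast
  moreover have "set ys = {1..n}" "distinct ys" using xs(1,2)
    by (auto simp: perms_def distinct_map image_Suc_lessThan)
  ultimately show "ys \<in> avoiders n t" using avoids_av[OF assms] by (simp add: avoiders_def permutations_of_set_def)
qed

lemma Des_map_Suc: "Des (map Suc xs) = Suc ` des xs"
proof (intro set_eqI iffI)
  fix i assume "i \<in> Des (map Suc xs)"
  then show "i \<in> Suc ` des xs" by (cases i) (auto simp: Des_def entry_def des_def)
qed (auto simp: Des_def entry_def des_def)

lemma Stp_map_Suc: "Stp (map Suc xs) = Suc ` stp xs"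
proof (intro set_eqI iffI)
  fix i assume "i \<in> Stp (map Suc xs)"
  then show "i \<in> Suc ` stp xs" by (cases i) (auto simp: Stp_def entry_def stp_def)
qed (auto simp: Stp_def entry_def stp_def)

lemma RLmax_map_Suc: "RLmax (map Suc xs) = Suc ` rl xs"
proof (intro set_eqI iffI)
  fix i assume i: "i \<in> RLmax (map Suc xs)"
  then obtain k where k: "i = Suc k" "k < length xs" by (cases i) (auto simp: RLmax_def)
  have "xs ! j < xs ! k" if "k < j" "j < length xs" for j
    using i that unfolding RLmax_def entry_def k(1) by (auto dest!: bspec[of _ _ "Suc j"])
  then show "i \<in> Suc ` rl xs" using k by (simp add: rl_def)
next
  fix i assume "i \<in> Suc ` rl xs"
  then obtain k where k: "i = Suc k" "k \<in> rl xs" by blast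
  have "entry (map Suc xs) j < entry (map Suc xs) i" if "j \<in> {1..length xs}" "i < j" for j
    using that k by (cases j) (auto simp: rl_def entry_def)
  then show "i \<in> RLmax (map Suc xs)" using k by (auto simp: RLmax_def rl_def)
qed

theorem mainTheorem1:
  fixes n :: nat
  assumes "n \<ge> 1"
  shows "\<exists>\<Theta> :: nat list \<Rightarrow> nat list.
    bij_betw \<Theta> (avoiders n [1,4,2,3]) (avoiders n [2,4,1,3]) \<and>
    (\<forall>\<pi> \<in> avoiders n [1,4,2,3].
       Des (\<Theta> \<pi>) = Des \<pi> \<and>
       RLmax (\<Theta> \<pi>) = RLmax \<pi> \<and>
       Stp (\<Theta> \<pi>) = Stp \<pi> \<and>
       (\<forall>i \<in> {1..n}. entry (\<Theta> \<pi>) i = n \<longleftrightarrow> entry \<pi> i = n) \<and>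
       (\<forall>i \<in> {1..n}. entry (\<Theta> \<pi>) i = n - 1 \<longleftrightarrow> entry \<pi> i = n - 1)) \<and>
    (\<forall>\<pi> \<in> avoiders n [1,4,2,3] \<inter> avoiders n [2,4,1,3]. \<Theta> \<pi> = \<pi>)"
proof -
  let ?A = "av_perms True n" and ?B = "av_perms False n"
  let ?s = "\<lambda>xs. (des xs, rl xs, second xs, stp xs)"
  have av: "avoiders n [1,4,2,3] = map Suc ` ?A" "avoiders n [2,4,1,3] = map Suc ` ?B"
    using avoiders_av_perms[OF _ order_isomorphic_1423] avoiders_av_perms[OF _ order_isomorphic_2413] by simp_all
  have "eqd ?s (?A \<inter> ?B) ?s (?A \<inter> ?B)" unfolding eqd_def by (intro exI[of _ id]) simp
  then have "eqd ?s (?A - ?A \<inter> ?B) ?s (?B - ?A \<inter> ?B)"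
    using eqd_Diff[OF finite_av_perms finite_av_perms eqd_av_perms_stp] by (meson Int_lower1 Int_lower2)
  then obtain h where h: "bij_betw h (?A - ?A \<inter> ?B) (?B - ?A \<inter> ?B)" "\<forall>x\<in>?A - ?A \<inter> ?B. ?s (h x) = ?s x"
    unfolding eqd_def by blast
  define f where "f xs = (if xs \<in> ?A \<inter> ?B then xs else h xs)" for xs
  have f1: "bij_betw f (?A - ?A \<inter> ?B) (?B - ?A \<inter> ?B)"
    using h(1) by (subst bij_betw_cong[of _ f h]) (auto simp: f_def)
  have f2: "bij_betw f (?A \<inter> ?B) (?A \<inter> ?B)"
    by (subst bij_betw_cong[of _ f id]) (auto simp: f_def)
  have "bij_betw f ((?A - ?A \<inter> ?B) \<union> (?A \<inter> ?B)) ((?B - ?A \<inter> ?B) \<union> (?A \<inter> ?B))"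
    by (rule bij_betw_combine[OF f1 f2]) blast
  moreover have "(?A - ?A \<inter> ?B) \<union> (?A \<inter> ?B) = ?A" "(?B - ?A \<inter> ?B) \<union> (?A \<inter> ?B) = ?B" by blast+
  ultimately have f: "bij_betw f ?A ?B" by simp
  have fs: "?s (f xs) = ?s xs" if "xs \<in> ?A" for xs using that h(2) by (auto simp: f_def)
  define g :: "nat list \<Rightarrow> nat list" where "g = map (\<lambda>x. x - 1)"
  have g: "g (map Suc xs) = xs" for xs by (simp add: g_def o_def)
  define \<Theta> where "\<Theta> \<pi> = map Suc (f (g \<pi>))" for \<pi>
  have \<Theta>: "\<Theta> (map Suc xs) = map Suc (f xs)" for xs by (simp add: \<Theta>_def g)
  have inj: "inj (map Suc)" by simp
  have bij: "bij_betw \<Theta> (map Suc ` ?A) (map Suc ` ?B)"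
  proof -
    have "\<Theta> ` (map Suc ` ?A) = map Suc ` ?B"
      using f unfolding bij_betw_def by (simp add: image_image \<Theta>) (metis image_image)
    moreover have "inj_on \<Theta> (map Suc ` ?A)"
      using f unfolding bij_betw_def by (auto simp: inj_on_def \<Theta>)
    ultimately show ?thesis by (simp add: bij_betw_def)
  qed
  have stat: "Des (\<Theta> \<pi>) = Des \<pi> \<and> RLmax (\<Theta> \<pi>) = RLmax \<pi> \<and> Stp (\<Theta> \<pi>) = Stp \<pi> \<and>
       (\<forall>i \<in> {1..n}. entry (\<Theta> \<pi>) i = n \<longleftrightarrow> entry \<pi> i = n) \<and>
       (\<forall>i \<in> {1..n}. entry (\<Theta> \<pi>) i = n - 1 \<longleftrightarrow> entry \<pi> i = n - 1)"
    if "\<pi> \<in> map Suc ` ?A" for \<pi>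
  proof -
    obtain xs where xs: "\<pi> = map Suc xs" "xs \<in> ?A" using \<open>\<pi> \<in> map Suc ` ?A\<close> by blast
    have fB: "f xs \<in> ?B" using f xs(2) bij_betwE by blast
    have p: "xs \<in> perms n" "f xs \<in> perms n" using av_permsD_perms xs(2) fB by blast+
    have l: "length xs = n" "length (f xs) = n" using perms_length p by auto
    have s: "des (f xs) = des xs" "rl (f xs) = rl xs" "second (f xs) = second xs" "stp (f xs) = stp xs"
      using fs[OF xs(2)] by auto
    have e: "entry (map Suc ys) i = Suc (ys ! (i - 1))" if "length ys = n" "i \<in> {1..n}" for ys i
      using that by (auto simp: entry_def)
    have "entry (\<Theta> \<pi>) i = n \<longleftrightarrow> entry \<pi> i = n" if i: "i \<in> {1..n}" for i
    proof -
      have "i - 1 < n" using i by auto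
      then show ?thesis using max_pos_iff[OF p(1)] max_pos_iff[OF p(2)] s(2)
        by (simp add: xs(1) \<Theta> e[OF l(1) i] e[OF l(2) i])
    qed
    moreover have "entry (\<Theta> \<pi>) i = n - 1 \<longleftrightarrow> entry \<pi> i = n - 1" if i: "i \<in> {1..n}" for i
    proof -
      \<comment> \<open>For \<open>n = 1\<close> both sides are false: \<open>second\<close> is
        empty and \<open>n - 1 = 0\<close> is not a successor.\<close>
      have sec: "i - 1 \<in> second ys \<longleftrightarrow> Suc (ys ! (i - 1)) = n - 1" if "length ys = n" for ys
        using i that by (auto simp: second_def)
      show ?thesis using sec[OF l(1)] sec[OF l(2)] s(3)
        by (simp add: xs(1) \<Theta> e[OF l(1) i] e[OF l(2) i])
    qed
    ultimately show ?thesis using s by (simp add: xs(1) \<Theta> Des_map_Suc RLmax_map_Suc Stp_map_Suc)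
  qed
  have same: "\<Theta> \<pi> = \<pi>" if \<pi>: "\<pi> \<in> map Suc ` ?A \<inter> map Suc ` ?B" for \<pi>
  proof -
    have "map Suc ` ?A \<inter> map Suc ` ?B = map Suc ` (?A \<inter> ?B)" by (rule image_Int[OF inj, symmetric])
    then have "\<pi> \<in> map Suc ` (?A \<inter> ?B)" using \<pi> by (simp only:)
    then obtain xs where "\<pi> = map Suc xs" "xs \<in> ?A \<inter> ?B" by (rule imageE)
    then show ?thesis by (simp add: \<Theta> f_def)
  qed
  show ?thesis unfolding av by (intro exI[of _ \<Theta>] conjI ballI bij same) (use stat in blast)+
qed

end
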